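(* Let $j^\uparrow,j^\downarrow,j^\rightarrow\in\tfrac12\mathbb Z_{\ge0}$ be such that the invariant space $$\mathcal I=\operatorname{Inv}_{SU(2)}\big(\mathcal H_{j^\uparrow}\otimes\mathcal H_{j^\downarrow}\otimes\mathcal H_{j^\rightarrow}\otimes\mathcal H_{1/2}\big)$$ is two-dimensional. Put $J^{a}=j^{a}+\tfrac12$ for $a\in\{\uparrow,\downarrow,\rightarrow\}$ and $$A=\frac12\Big(\frac{J^\uparrow}{J^\rightarrow}\Big)^2+\frac12\Big(\frac{J^\downarrow}{J^\rightarrow}\Big)^2-\frac14,\qquad C=\frac12\Big(\frac{J^\uparrow}{J^\rightarrow}\Big)^2-\frac12\Big(\frac{J^\downarrow}{J^\rightarrow}\Big)^2,$$ $$B(r)=\frac12\Big(\frac{J^\uparrow}{J^\rightarrow}\Big)^2+\frac12\Big(\frac{J^\downarrow}{J^\rightarrow}\Big)^2-\frac14-\frac r4\frac1{J^\rightarrow}-\frac14\frac1{(J^\rightarrow)^2},\qquad r=\pm1 .$$ Then the eigenvalues of the cosine operator $\cos_{S\mathcal F,v}$ on $\mathcal I$ are $$\lambda_\pm=\pm\frac1{\sqrt3}\left[\frac1{\sqrt{B(+1)}}\,\frac{\sqrt A\mp C}{2}+\frac1{\sqrt{B(-1)}}\,\frac{\sqrt A\pm C}{2}\right].$$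
   Context: Here $\mathcal H_j$ is the spin-$j$ irreducible representation of $SU(2)$ (dimension $2j+1$). The setting is a vertex $v$ of a spin network in loop quantum gravity carrying one fermion (a spin-$\tfrac12$ factor), lying on a surface $\mathcal F$. The spins of the edges at $v$ lying above, below and tangential to $\mathcal F$ have been recoupled to total spins $j^\uparrow$, $j^\downarrow$, $j^\rightarrow$ respectively, and the state at $v$ is an intertwiner in $\mathcal I$. Let $J^\uparrow_i,J^\downarrow_i,J^\rightarrow_i,S_i$ ($i=1,2,3$) be the self-adjoint angular momentum operators (satisfying $[L_i,L_j]=\mathrm i\,\epsilon_{ijk}L_k$, units $\hbar=1$) acting on the tensor factors $\mathcal H_{j^\uparrow},\mathcal H_{j^\downarrow},\mathcal H_{j^\rightarrow},\mathcal H_{1/2}$ respectively; $S_i$ is the fermion spin. (The scalars $J^a=j^a+\frac12$ of the claim are numbers, not these operators.) The operators $\sum_i S_i^2=\tfrac34$, $\sum_i S_i(J^\uparrow_i-J^\downarrow_i)$ and $\sum_i(J^\uparrow_i-J^\downarrow_i)^2$ commute with the total $SU(2)$ action and hence act on $\mathcal I$. The cosine operator (of the angle between the fermion spin and the normal of $\mathcal F$) is $$\cos_{S\mathcal F,v}=\tfrac12\big(C_{S\mathcal F,v}+C_{S\mathcal F,v}^\dagger\big),$$ $$C_{S\mathcal F,v}=\frac1{\sqrt{\sum_iS_i^2}}\;\sum_iS_i\,(J^\uparrow_i-J^\downarrow_i)\;\frac1{\sqrt{\sum_i(J^\uparrow_i-J^\downarrow_i)^2}}\,,$$ restricted to $\mathcal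 I$. The space $\mathcal I$ is two-dimensional exactly when both $l=j^\rightarrow+\tfrac12$ and $l=j^\rightarrow-\tfrac12$ are admissible total spins in the coupling of $j^\uparrow$ and $j^\downarrow$. *)

theory Defs
  imports "HOL-Analysis.Derivative" "Jordan_Normal_Form.Schur_Decomposition"
    "Jordan_Normal_Form.Matrix_Kernel"
begin

no_notation inner (infix "\<bullet>" 70)
no_notation Finite_Cartesian_Product.vec_nth (infixl "$" 90)

definition SU2 :: "complex mat set" where
  "SU2 = {g \<in> carrier_mat 2 2. mat_adjoint g * g = 1\<^sub>m 2 \<and> det g = 1}"

(* The spin-j irreducible representation for j = n/2, as unitary matrices of size n + 1.
   It is the n-th symmetric power of the defining representation: g acts on homogeneous
   polynomials of degree n by  x \<mapsto> g11 x + g21 y,  y \<mapsto> g12 x + g22 y, and the matrix is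
   taken in the orthonormal basis  e_l = sqrt (n choose l) x^(n-l) y^l  (weight n/2 - l).
   Setting x = 1, coefficients of x^(n-k) y^k become coefficients of degree k. *)
definition spin_rep :: "nat \<Rightarrow> complex mat \<Rightarrow> complex mat" where
  "spin_rep n g = Matrix.mat (n + 1) (n + 1) (\<lambda>(k, l).
     complex_of_real (sqrt (real (n choose l) / real (n choose k))) *
     coeff ([:g $$ (0,0), g $$ (1,0):] ^ (n - l) * [:g $$ (0,1), g $$ (1,1):] ^ l) k)"

definition pauli :: "nat \<Rightarrow> complex mat" where
  "pauli i =
     (if i = 1 then mat_of_rows_list 2 [[0, 1], [1, 0]]
      else if i = 2 then mat_of_rows_list 2 [[0, - \<i>], [\<i>, 0]]
      else mat_of_rows_list 2 [[1, 0], [0, - 1]])"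

(* The one-parameter subgroup exp (- \<i> t \<sigma>_i / 2), in closed form since \<sigma>_i squares to 1. *)
definition rot :: "nat \<Rightarrow> real \<Rightarrow> complex mat" where
  "rot i t = complex_of_real (cos (t / 2)) \<cdot>\<^sub>m 1\<^sub>m 2
     + (- \<i> * complex_of_real (sin (t / 2))) \<cdot>\<^sub>m pauli i"

(* The self-adjoint generator: spin_rep n (rot i t) = exp (- \<i> t spin_op n i). *)
definition spin_op :: "nat \<Rightarrow> nat \<Rightarrow> complex mat" where
  "spin_op n i = Matrix.mat (n + 1) (n + 1) (\<lambda>(k, l).
     \<i> * vector_derivative (\<lambda>t. spin_rep n (rot i t) $$ (k, l)) (at 0))"

definition kron :: "complex mat \<Rightarrow> complex mat \<Rightarrow> complex mat"  (infixl "\<otimes>\<^sub>m" 75) where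
  "A \<otimes>\<^sub>m B = Matrix.mat (dim_row A * dim_row B) (dim_col A * dim_col B) (\<lambda>(i, j).
     A $$ (i div dim_row B, j div dim_col B) * B $$ (i mod dim_row B, j mod dim_col B))"

(* From here on nu, nd, nr are twice the spins of the upper, lower and tangential factor;
   the tensor factors are ordered up, down, tangential, fermion. *)
definition state_dim :: "nat \<Rightarrow> nat \<Rightarrow> nat \<Rightarrow> nat" where
  "state_dim nu nd nr = (nu + 1) * (nd + 1) * (nr + 1) * 2"

definition intertwiners :: "nat \<Rightarrow> nat \<Rightarrow> nat \<Rightarrow> complex Matrix.vec set" where
  "intertwiners nu nd nr = {v \<in> carrier_vec (state_dim nu nd nr).
     \<forall>g \<in> SU2. (spin_rep nu g \<otimes>\<^sub>m spin_rep nd g \<otimes>\<^sub>m spin_rep nr g \<otimes>\<^sub>m spin_rep 1 g) *\<^sub>v v = v}"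

definition intertwiner_dim :: "nat \<Rightarrow> nat \<Rightarrow> nat \<Rightarrow> nat" where
  "intertwiner_dim nu nd nr = vectorspace.dim class_ring
     ((module_vec TYPE(complex) (state_dim nu nd nr))\<lparr>carrier := intertwiners nu nd nr\<rparr>)"

definition J_up :: "nat \<Rightarrow> nat \<Rightarrow> nat \<Rightarrow> nat \<Rightarrow> complex mat" where
  "J_up nu nd nr i = spin_op nu i \<otimes>\<^sub>m 1\<^sub>m (nd + 1) \<otimes>\<^sub>m 1\<^sub>m (nr + 1) \<otimes>\<^sub>m 1\<^sub>m 2"

definition J_down :: "nat \<Rightarrow> nat \<Rightarrow> nat \<Rightarrow> nat \<Rightarrow> complex mat" where
  "J_down nu nd nr i = 1\<^sub>m (nu + 1) \<otimes>\<^sub>m spin_op nd i \<otimes>\<^sub>m 1\<^sub>m (nr + 1) \<otimes>\<^sub>m 1\<^sub>m 2"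

definition S_op :: "nat \<Rightarrow> nat \<Rightarrow> nat \<Rightarrow> nat \<Rightarrow> complex mat" where
  "S_op nu nd nr i = 1\<^sub>m (nu + 1) \<otimes>\<^sub>m 1\<^sub>m (nd + 1) \<otimes>\<^sub>m 1\<^sub>m (nr + 1) \<otimes>\<^sub>m spin_op 1 i"

definition op_dot :: "(nat \<Rightarrow> complex mat) \<Rightarrow> (nat \<Rightarrow> complex mat) \<Rightarrow> complex mat" where
  "op_dot X Y = X 1 * Y 1 + X 2 * Y 2 + X 3 * Y 3"

(* The order on complex is the partial one: 0 \<le> z says that z is real and nonnegative. *)
definition pos_semidef :: "complex mat \<Rightarrow> bool" where
  "pos_semidef M \<longleftrightarrow> M \<in> carrier_mat (dim_row M) (dim_row M) \<and> mat_adjoint M = M \<and>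
     (\<forall>v \<in> carrier_vec (dim_row M). 0 \<le> (M *\<^sub>v v) \<bullet>c v)"

(* The positive square root of the inverse of M; meaningful for positive definite M. *)
definition inv_sqrt_op :: "complex mat \<Rightarrow> complex mat" where
  "inv_sqrt_op M = (THE R. R \<in> carrier_mat (dim_row M) (dim_row M) \<and> pos_semidef R \<and>
     R * R * M = 1\<^sub>m (dim_row M))"

(* The sum of the squares of J_up - J_down is positive definite on the whole tensor product
   unless nu = nd = 0; in that case the intertwiner space has dimension at most 1. *)
definition C_op :: "nat \<Rightarrow> nat \<Rightarrow> nat \<Rightarrow> complex mat" where
  "C_op nu nd nr =
     (let S = S_op nu nd nr; V = (\<lambda>i. J_up nu nd nr i - J_down nu nd nr i)
      in inv_sqrt_op (op_dot S S) * op_dot S V * inv_sqrt_op (op_dot V V))"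

definition cos_op :: "nat \<Rightarrow> nat \<Rightarrow> nat \<Rightarrow> complex mat" where
  "cos_op nu nd nr = (1 / 2) \<cdot>\<^sub>m (C_op nu nd nr + mat_adjoint (C_op nu nd nr))"

(* Eigenvalues of the restriction of M to the subspace W. *)
definition eigenvalues_on :: "complex Matrix.vec set \<Rightarrow> complex mat \<Rightarrow> complex set" where
  "eigenvalues_on W M = {c. \<exists>v \<in> W. v \<noteq> 0\<^sub>v (dim_vec v) \<and> M *\<^sub>v v = c \<cdot>\<^sub>v v}"

end

theory Submission
  imports Defs "Jordan_Normal_Form.Spectral_Radius"
begin

text \<open>
  Let \<open>V = J\<^sub>u - J\<^sub>d\<close>, \<open>L = J\<^sub>u + J\<^sub>d\<close>, and let \<open>K = - (1 + 2 \<sigma> \<cdot> J\<^sub>r)\<close> be twice the analogue of Dirac's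
  operator. Write \<open>a, b, c\<close> for the dimensions of the three representations. Using only the commutation
  relations, the Casimir values and \<open>L = - (J\<^sub>r + S)\<close> on intertwiners, one finds there, with
  \<open>X = 4 S \<cdot> V\<close>,
  \<open>K\<^sup>2 = c\<^sup>2\<close>, \<open>X\<^sup>2 = 2 a\<^sup>2 + 2 b\<^sup>2 - c\<^sup>2\<close>, \<open>K X + X K = 2 (a\<^sup>2 - b\<^sup>2)\<close> and
  \<open>4 V\<^sup>2 = 2 a\<^sup>2 + 2 b\<^sup>2 - c\<^sup>2 - 4 + 2 K\<close>.
  An eigenvector of \<open>K\<close> among the intertwiners is determined by one component, with highest weight in
  the first and lowest weight in the second factor. So the eigenspaces of \<open>K\<close> are at most
  one-dimensional, and a two-dimensional intertwiner space has an eigenbasis of \<open>K\<close>. In it \<open>V\<^sup>2\<close> is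
  diagonal, and the relations determine the diagonal of \<open>X\<close> and the product of its off-diagonal entries,
  hence the trace and the determinant of the cosine operator.
\<close>

text \<open>The cosine is a multiple of X R + R X, where R is the inverse square root of V^2. R is
  diagonal in an eigenbasis of K, so each entry of the cosine is an entry of X times a sum of two
  eigenvalues of R. Its trace and determinant involve only the diagonal of X and the product of the
  off-diagonal entries. KX + XK being scalar fixes the first, X^2 being scalar the second, so the
  basis vectors and their phases never have to be computed. X^2 is scalar because the Pauli identity
  writes it as 4 V^2 minus twice 4 S . L, and on intertwiners the parts of these two that contain K
  cancel. Two features of the statement shape the rest. Intertwiners are invariant under finite
  group elements, while the spin operators are derivatives; solutions of U' = U X, carried through
  symmetric powers and tensor products, connect the two. The inverse root is a definite description,
  so its existence and uniqueness are settled on the whole tensor product before it is evaluated on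
  two eigenvectors.\<close>

section \<open>The algebra of four coupled spins\<close>

text \<open>Four times the dot product, in ladder components \<open>e = v\<^sub>1 + \<i> v\<^sub>2\<close>, \<open>f = v\<^sub>1 - \<i> v\<^sub>2\<close>, \<open>h = 2 v\<^sub>3\<close>, which makes
  all structure constants integers.\<close>
definition spin_dot :: "'a::ring_1 \<Rightarrow> 'a \<Rightarrow> 'a \<Rightarrow> 'a \<Rightarrow> 'a \<Rightarrow> 'a \<Rightarrow> 'a" where
  "spin_dot e f h e' f' h' = 2 * (e * f' + f * e') + h * h'"

text \<open>\<open>algebra_simps\<close> nests products to the right, which hides an adjacent pair
  \<open>p * q\<close> inside \<open>p * (q * z)\<close>. Through \<open>THEN\<close> every relation
  gets a second form that matches there.\<close>

lemma mult_swap_left: "p * q = r \<Longrightarrow> p * (q * z) = r * (z::'a::ring_1)"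
  by (metis mult.assoc)

text \<open>The raising and lowering parts of a spin 1/2 obey the relations of one fermionic mode,
  which are stronger than the commutation relations. They reduce every word in the half spin to a
  combination of 1, \<open>es\<close>, \<open>fs\<close> and \<open>es * fs\<close>.\<close>

locale half_spin =
  fixes es fs hs :: "'a::ring_1"
  assumes half: "fs * es = 1 - es * fs" "es * es = 0" "fs * fs = 0" "hs = es * fs + es * fs - 1"

text \<open>Two instances occur: v = V with l = L, and v = l = J_r.\<close>

locale half_spin_vector = half_spin es fs hs
  for es fs hs :: "'a::ring_1" +
  fixes el fl hl ev fv hv :: 'a
  assumes comm_v: "es * ev = ev * es" "es * fv = fv * es" "es * hv = hv * es"
      "fs * ev = ev * fs" "fs * fv = fv * fs" "fs * hv = hv * fs"
    and comm_l: "es * el = el * es" "es * fl = fl * es" "es * hl = hl * es"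
      "fs * el = el * fs" "fs * fl = fl * fs" "fs * hl = hl * fs"
begin

lemmas half_spin_simps = half(1-3) comm_v comm_l

text \<open>The Pauli identity (sigma . v)^2 = v . v + i sigma . (v x v), for a vector operator with
  v x v = i l. The hypotheses are this cross product in ladder components.\<close>

lemma spin_dot_square:
  assumes "fv * ev = ev * fv - hl" "hv * ev = ev * hv + el + el" "hv * fv = fv * hv - fl - fl"
  shows "spin_dot es fs hs ev fv hv * spin_dot es fs hs ev fv hv =
    spin_dot ev fv hv ev fv hv - 2 * spin_dot es fs hs el fl hl"
  unfolding spin_dot_def half(4) mult_2
  by (simp add: half_spin_simps assms half_spin_simps[THEN mult_swap_left]
      assms[THEN mult_swap_left] algebra_simps)

text \<open>The symmetrised Pauli identity contains l x v + v x l, which equals 2 i v because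
  \<open>v\<close> transforms as a vector under \<open>l\<close>. This produces the term linear in
  \<open>v\<close>.\<close>

lemma spin_dot_anticommute:
  assumes "el * ev = ev * el" "fl * fv = fv * fl" "hl * hv = hv * hl"
    "fl * ev = ev * fl - hv" "fv * el = el * fv - hv"
    "hl * ev = ev * hl + ev + ev" "hv * el = el * hv + ev + ev"
    "hl * fv = fv * hl - fv - fv" "hv * fl = fl * hv - fv - fv"
  shows "spin_dot es fs hs el fl hl * spin_dot es fs hs ev fv hv +
      spin_dot es fs hs ev fv hv * spin_dot es fs hs el fl hl =
    2 * spin_dot el fl hl ev fv hv - 4 * spin_dot es fs hs ev fv hv"
proof -
  \<comment> \<open>Sums in place of numerals let \<open>algebra_simps\<close> collect equal words;
    \<open>mult_2\<close> serves the same purpose.\<close>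
  have four: "4 * (z::'a) = z + z + (z + z)" for z
    by (metis mult_2 numeral_Bit0 distrib_right)
  show ?thesis
    unfolding spin_dot_def half(4) mult_2 four
    by (simp add: half_spin_simps assms half_spin_simps[THEN mult_swap_left]
        assms[THEN mult_swap_left] algebra_simps)
qed
end

text \<open>The relations are oriented towards one normal form: e, f, h in this order within a
  factor, and the factors in the order up, down, tangential, fermion. Identities are then checked by
  rewriting. The Casimir values are 4 j (j + 1) = (2 j + 1)^2 - 1.\<close>

locale four_spins = half_spin es fs hs
  for es fs hs :: "'a::ring_1" +
  fixes eu fu hu ed fd hd er fr hr :: 'a and a b c :: int
  assumes su2_u: "fu * eu = eu * fu - hu" "hu * eu = eu * hu + eu + eu" "hu * fu = fu * hu - fu - fu"
    and su2_d: "fd * ed = ed * fd - hd" "hd * ed = ed * hd + ed + ed" "hd * fd = fd * hd - fd - fd"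
    and su2_r: "fr * er = er * fr - hr" "hr * er = er * hr + er + er" "hr * fr = fr * hr - fr - fr"
    and casimir_u: "spin_dot eu fu hu eu fu hu = of_int (a * a - 1)"
    and casimir_d: "spin_dot ed fd hd ed fd hd = of_int (b * b - 1)"
    and casimir_r: "spin_dot er fr hr er fr hr = of_int (c * c - 1)"
    and comm_ud: "ed * eu = eu * ed" "ed * fu = fu * ed" "ed * hu = hu * ed"
      "fd * eu = eu * fd" "fd * fu = fu * fd" "fd * hu = hu * fd"
      "hd * eu = eu * hd" "hd * fu = fu * hd" "hd * hu = hu * hd"
    and comm_ur: "er * eu = eu * er" "er * fu = fu * er" "er * hu = hu * er"
      "fr * eu = eu * fr" "fr * fu = fu * fr" "fr * hu = hu * fr"
      "hr * eu = eu * hr" "hr * fu = fu * hr" "hr * hu = hu * hr"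
    and comm_us: "es * eu = eu * es" "es * fu = fu * es" "es * hu = hu * es"
      "fs * eu = eu * fs" "fs * fu = fu * fs" "fs * hu = hu * fs"
    and comm_dr: "er * ed = ed * er" "er * fd = fd * er" "er * hd = hd * er"
      "fr * ed = ed * fr" "fr * fd = fd * fr" "fr * hd = hd * fr"
      "hr * ed = ed * hr" "hr * fd = fd * hr" "hr * hd = hd * hr"
    and comm_ds: "es * ed = ed * es" "es * fd = fd * es" "es * hd = hd * es"
      "fs * ed = ed * fs" "fs * fd = fd * fs" "fs * hd = hd * fs"
    and comm_rs: "es * er = er * es" "es * fr = fr * es" "es * hr = hr * es"
      "fs * er = er * fs" "fs * fr = fr * fs" "fs * hr = hr * fs"
begin

definition "s_dot_v = spin_dot es fs hs (eu - ed) (fu - fd) (hu - hd)"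
definition "v_dot_v = spin_dot (eu - ed) (fu - fd) (hu - hd) (eu - ed) (fu - fd) (hu - hd)"
definition "dirac_op = - 1 - spin_dot es fs hs er fr hr"
text \<open>A vector enters the algebra as a ring element \<open>w\<close> on which operators act
  from the left, so that vectors and operators share one type.\<close>

definition "invariant w \<longleftrightarrow> (eu + ed + er + es) * w = 0 \<and> (fu + fd + fr + fs) * w = 0 \<and>
  (hu + hd + hr + hs) * w = 0"

lemmas rels = su2_u su2_d su2_r half(1-3) comm_ud comm_ur comm_us comm_dr comm_ds comm_rs
lemmas rel_simps = rels rels[THEN mult_swap_left]

sublocale l: half_spin_vector es fs hs "eu + ed" "fu + fd" "hu + hd" "eu - ed" "fu - fd" "hu - hd"
  by unfold_locales (simp_all add: comm_us comm_ds algebra_simps)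

sublocale r: half_spin_vector es fs hs er fr hr er fr hr
  by unfold_locales (simp_all add: comm_rs)

text \<open>Dot products of vector operators are rotation invariant; this keeps the intertwiners
  stable under X and K.\<close>

lemma total_commute:
  "(eu + ed + er + es) * s_dot_v = s_dot_v * (eu + ed + er + es)"
  "(fu + fd + fr + fs) * s_dot_v = s_dot_v * (fu + fd + fr + fs)"
  "(hu + hd + hr + hs) * s_dot_v = s_dot_v * (hu + hd + hr + hs)"
  "(eu + ed + er + es) * dirac_op = dirac_op * (eu + ed + er + es)"
  "(fu + fd + fr + fs) * dirac_op = dirac_op * (fu + fd + fr + fs)"
  "(hu + hd + hr + hs) * dirac_op = dirac_op * (hu + hd + hr + hs)"
  unfolding s_dot_v_def dirac_op_def unfolding spin_dot_def half(4) mult_2 by (simp_all add: rel_simps algebra_simps)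

lemma invariant_s_dot_v: "invariant w \<Longrightarrow> invariant (s_dot_v * w)"
  and invariant_dirac_op: "invariant w \<Longrightarrow> invariant (dirac_op * w)"
  unfolding invariant_def mult.assoc[symmetric] total_commute by (simp_all add: mult.assoc)

text \<open>J_u and J_d commute and the minus sign in V squares away, so the commutators of the
  components of V give L.\<close>

lemma s_dot_v_square: "s_dot_v * s_dot_v = v_dot_v - 2 * spin_dot es fs hs (eu + ed) (fu + fd) (hu + hd)"
  unfolding s_dot_v_def v_dot_v_def by (rule l.spin_dot_square) (simp_all add: rel_simps algebra_simps)

text \<open>With y = 4 S . J_r the Pauli identity gives y^2 = (c^2 - 1) - 2 y; completing the square
  yields (1 + y)^2 = c^2.\<close>

lemma dirac_op_square: "dirac_op * dirac_op = of_int (c * c)"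
proof -
  have "spin_dot es fs hs er fr hr * spin_dot es fs hs er fr hr =
      spin_dot er fr hr er fr hr - 2 * spin_dot es fs hs er fr hr"
    by (rule r.spin_dot_square) (simp_all add: su2_r)
  then show ?thesis
    unfolding dirac_op_def casimir_r by (simp add: algebra_simps mult_2)
qed

text \<open>V is a vector operator under L, and L . V is the difference of the two Casimirs because
  J_u and J_d commute.\<close>

lemma anticommute_l:
  "spin_dot es fs hs (eu + ed) (fu + fd) (hu + hd) * s_dot_v + s_dot_v * spin_dot es fs hs (eu + ed) (fu + fd) (hu + hd)
    = of_int (2 * (a * a - b * b)) - 4 * s_dot_v"
proof -
  have "spin_dot (eu + ed) (fu + fd) (hu + hd) (eu - ed) (fu - fd) (hu - hd)
      = spin_dot eu fu hu eu fu hu - spin_dot ed fd hd ed fd hd"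
    by (simp add: spin_dot_def mult_2 rel_simps algebra_simps)
  also have "\<dots> = of_int (a * a - b * b)"
    by (simp add: casimir_u casimir_d)
  finally have dot: "spin_dot (eu + ed) (fu + fd) (hu + hd) (eu - ed) (fu - fd) (hu - hd) = of_int (a * a - b * b)" .
  show ?thesis
    unfolding s_dot_v_def
  proof (subst l.spin_dot_anticommute)
    show "2 * spin_dot (eu + ed) (fu + fd) (hu + hd) (eu - ed) (fu - fd) (hu - hd)
        - 4 * spin_dot es fs hs (eu - ed) (fu - fd) (hu - hd)
      = of_int (2 * (a * a - b * b)) - 4 * spin_dot es fs hs (eu - ed) (fu - fd) (hu - hd)"
      unfolding dot by simp
  qed (simp_all add: rel_simps algebra_simps)
qed

text \<open>The parallelogram law for J_u + J_d and J_u - J_d, with the Casimir values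
  inserted.\<close>

lemma v_dot_v_eq: "v_dot_v = of_int (2 * a * a + 2 * b * b - 4) - spin_dot (eu + ed) (fu + fd) (hu + hd) (eu + ed) (fu + fd) (hu + hd)"
proof -
  have "v_dot_v + spin_dot (eu + ed) (fu + fd) (hu + hd) (eu + ed) (fu + fd) (hu + hd)
      = 2 * spin_dot eu fu hu eu fu hu + 2 * spin_dot ed fd hd ed fd hd"
    by (simp add: v_dot_v_def spin_dot_def mult_2 rel_simps algebra_simps)
  also have "\<dots> = of_int (2 * (a * a - 1) + 2 * (b * b - 1))"
    by (simp add: casimir_u casimir_d)
  also have "2 * (a * a - 1) + 2 * (b * b - 1) = 2 * a * a + 2 * b * b - 4"
    by (simp add: algebra_simps)
  finally show ?thesis by (simp add: eq_diff_eq)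
qed

lemma dot_half_half: "spin_dot es fs hs es fs hs = 3"
proof -
  have "spin_dot es fs hs es fs hs = 1 + (1 + 1)"
    unfolding spin_dot_def half(4) mult_2 by (simp add: rel_simps algebra_simps)
  then show ?thesis by simp
qed

context
  fixes w
  assumes w: "invariant w"
begin

lemma l_eq: "(eu + ed) * w = - ((er + es) * w)" "(fu + fd) * w = - ((fr + fs) * w)"
  "(hu + hd) * w = - ((hr + hs) * w)"
  using w by (simp_all add: invariant_def algebra_simps eq_neg_iff_add_eq_0)

text \<open>Replacing L by -(J_r + S) turns 4 S . L into -(4 S . J_r) - 3, of which
  \<open>dirac_op\<close> absorbs -1.\<close>

lemma dot_half_l: "spin_dot es fs hs (eu + ed) (fu + fd) (hu + hd) * w = dirac_op * w - 2 * w"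
proof -
  have "spin_dot es fs hs (eu + ed) (fu + fd) (hu + hd) * w =
      2 * (es * ((fu + fd) * w) + fs * ((eu + ed) * w)) + hs * ((hu + hd) * w)"
    by (simp add: spin_dot_def algebra_simps)
  also have "\<dots> = - ((spin_dot es fs hs er fr hr + spin_dot es fs hs es fs hs) * w)"
    unfolding l_eq by (simp add: spin_dot_def algebra_simps)
  also have "\<dots> = - ((spin_dot es fs hs er fr hr + (1 + 2)) * w)"
    unfolding dot_half_half by simp
  also have "\<dots> = dirac_op * w - 2 * w"
    unfolding dirac_op_def by (simp add: algebra_simps del: one_add_one numeral_plus_one one_plus_numeral)
  finally show ?thesis .
qed

lemma dot_l_l: "spin_dot (eu + ed) (fu + fd) (hu + hd) (eu + ed) (fu + fd) (hu + hd) * w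
  = of_int (c * c) * w - 2 * (dirac_op * w)"
proof -
  \<comment> \<open>\<open>l_eq\<close> applies only next to \<open>w\<close>. After its first use a
    component of L stands to the left of J_r + S; as the two commute, it is moved back to
    \<open>w\<close> and replaced as well.\<close>
  have comm: "(eu + ed) * ((fr + fs) * w) = (fr + fs) * ((eu + ed) * w)"
    "(fu + fd) * ((er + es) * w) = (er + es) * ((fu + fd) * w)"
    "(hu + hd) * ((hr + hs) * w) = (hr + hs) * ((hu + hd) * w)"
    unfolding half(4) by (simp_all add: rel_simps algebra_simps)
  have "spin_dot (eu + ed) (fu + fd) (hu + hd) (eu + ed) (fu + fd) (hu + hd) * w =
      2 * ((eu + ed) * ((fu + fd) * w) + (fu + fd) * ((eu + ed) * w)) + (hu + hd) * ((hu + hd) * w)"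
    by (simp add: spin_dot_def algebra_simps)
  also have "\<dots> = 2 * ((fr + fs) * ((er + es) * w) + (er + es) * ((fr + fs) * w)) + (hr + hs) * ((hr + hs) * w)"
    by (simp only: l_eq comm mult_minus_right minus_minus)
  also have "\<dots> = spin_dot (er + es) (fr + fs) (hr + hs) (er + es) (fr + fs) (hr + hs) * w"
    by (simp add: spin_dot_def algebra_simps)
  also have "spin_dot (er + es) (fr + fs) (hr + hs) (er + es) (fr + fs) (hr + hs) =
      spin_dot er fr hr er fr hr + spin_dot es fs hs es fs hs + 2 * spin_dot es fs hs er fr hr"
    unfolding spin_dot_def half(4) mult_2 by (simp add: rel_simps algebra_simps)
  also have "\<dots> = of_int (c * c) - 2 * dirac_op"
    unfolding casimir_r dot_half_half dirac_op_def by (simp add: algebra_simps)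
  finally show ?thesis by (simp add: algebra_simps)
qed

lemma v_dot_v_apply: "v_dot_v * w = of_int (2 * a * a + 2 * b * b - c * c - 4) * w + 2 * (dirac_op * w)"
  unfolding v_dot_v_eq left_diff_distrib dot_l_l by (simp add: algebra_simps)

text \<open>On an intertwiner 4 V^2 contributes 2 K - 4 and the term with 4 S . L contributes -2 (K
  - 2); these cancel.\<close>

lemma s_dot_v_square_apply: "s_dot_v * (s_dot_v * w) = of_int (2 * a * a + 2 * b * b - c * c) * w"
proof -
  have "s_dot_v * (s_dot_v * w) = v_dot_v * w - 2 * (spin_dot es fs hs (eu + ed) (fu + fd) (hu + hd) * w)"
    unfolding mult.assoc[symmetric] s_dot_v_square by (simp add: algebra_simps)
  also have "\<dots> = of_int (2 * a * a + 2 * b * b - c * c) * w"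
    unfolding v_dot_v_apply dot_half_l by (simp add: algebra_simps)
  finally show ?thesis .
qed

end

text \<open>4 S . L acts as K - 2 both on \<open>w\<close> and on X \<open>w\<close>, which is again
  invariant. The two shifts by 2 account for the term -4 X in \<open>anticommute_l\<close>.\<close>

lemma anticommute_apply:
  assumes w: "invariant w"
  shows "dirac_op * (s_dot_v * w) + s_dot_v * (dirac_op * w) = of_int (2 * (a * a - b * b)) * w"
proof -
  let ?y = "spin_dot es fs hs (eu + ed) (fu + fd) (hu + hd)"
  have "?y * (s_dot_v * w) + s_dot_v * (?y * w) = (of_int (2 * (a * a - b * b)) - 4 * s_dot_v) * w"
    unfolding anticommute_l[symmetric] by (simp add: algebra_simps)
  moreover have "2 * (s_dot_v * w) + s_dot_v * (2 * w) = 4 * s_dot_v * w"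
    by (metis (no_types, lifting) distrib_left mult.assoc mult_2 numeral_Bit0 distrib_right)
  ultimately show ?thesis
    unfolding dot_half_l[OF w] dot_half_l[OF invariant_s_dot_v[OF w]]
    by (simp add: algebra_simps)
qed

end

section \<open>Matrices as elements of a ring\<close>

text \<open>Matrices of a given size do not form a type. Linear maps on all sequences are one type
  that serves every size and is an instance of \<open>ring_1\<close>, so the algebra above can be
  interpreted in it.\<close>

typedef lin_op = "{f :: (nat \<Rightarrow> complex) \<Rightarrow> nat \<Rightarrow> complex.
    \<forall>c x y. f (\<lambda>i. c * x i + y i) = (\<lambda>i. c * f x i + f y i)}"
  morphisms app Lin_op
  by (rule exI[of _ "\<lambda>x. x"]) simp

setup_lifting type_definition_lin_op

lemma app_comb: "app f (\<lambda>i. c * x i + y i) = (\<lambda>i. c * app f x i + app f y i)"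
  using app[of f] by simp

lemma app_add: "app f (\<lambda>i. x i + y i) = (\<lambda>i. app f x i + app f y i)"
  using app_comb[of f 1] by simp

instantiation lin_op :: ring_1
begin

lift_definition zero_lin_op :: lin_op is "\<lambda>x i. 0" by simp
lift_definition one_lin_op :: lin_op is "\<lambda>x. x" by simp
lift_definition plus_lin_op :: "lin_op \<Rightarrow> lin_op \<Rightarrow> lin_op" is "\<lambda>f g x i. f x i + g x i"
  by (simp add: algebra_simps)
lift_definition minus_lin_op :: "lin_op \<Rightarrow> lin_op \<Rightarrow> lin_op" is "\<lambda>f g x i. f x i - g x i"
  by (simp add: algebra_simps)
lift_definition uminus_lin_op :: "lin_op \<Rightarrow> lin_op" is "\<lambda>f x i. - f x i"
  by (simp add: algebra_simps)
lift_definition times_lin_op :: "lin_op \<Rightarrow> lin_op \<Rightarrow> lin_op" is "\<lambda>f g x. f (g x)"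
  by simp

lemmas app_simps = zero_lin_op.rep_eq one_lin_op.rep_eq plus_lin_op.rep_eq minus_lin_op.rep_eq
  uminus_lin_op.rep_eq times_lin_op.rep_eq

instance
proof
  fix f g h :: lin_op
  show "f * g * h = f * (g * h)" "f + g + h = f + (g + h)" "f + g = g + f" "0 + f = f" "- f + f = 0"
    "f - g = f + - g" "1 * f = f" "f * 1 = f" "(f + g) * h = f * h + g * h" "f * (g + h) = f * g + f * h"
    by (simp_all add: app_inject[symmetric] app_simps app_add fun_eq_iff)
  have "app (0 :: lin_op) (\<lambda>i. 1) 0 \<noteq> app 1 (\<lambda>i. 1) 0"
    by (simp add: app_simps)
  then show "(0 :: lin_op) \<noteq> 1"
    by metis
qed

end

lemma app_of_int: "app (of_int k) x i = of_int k * x i"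
proof -
  have nat: "app (of_nat n) x i = of_nat n * x i" for n
    by (induction n) (simp_all add: app_simps algebra_simps)
  show ?thesis
    by (cases k) (simp_all add: app_simps nat algebra_simps del: of_nat_Suc)
qed

text \<open>An \<open>N \<times> N\<close> matrix acts on sequences blockwise, so that the identity matrix becomes the unit.\<close>
lift_definition op_of :: "nat \<Rightarrow> complex mat \<Rightarrow> lin_op" is
  "\<lambda>N M x i. \<Sum>j<N. M $$ (i mod N, j) * x (N * (i div N) + j)"
  by (simp add: sum.distrib sum_distrib_left algebra_simps)

context
  fixes N :: nat
  assumes N: "N > 0"
begin

lemma op_of_one: "op_of N (1\<^sub>m N) = 1"
proof -
  have "app (op_of N (1\<^sub>m N)) x i = x i" for x i
  proof -
    have "app (op_of N (1\<^sub>m N)) x i = (\<Sum>j<N. if j = i mod N then x (N * (i div N) + j) else 0)"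
      unfolding op_of.rep_eq using N by (intro sum.cong) auto
    also have "\<dots> = x i" using N by simp
    finally show ?thesis .
  qed
  then show ?thesis
    by (simp add: app_inject[symmetric] app_simps fun_eq_iff)
qed

lemma op_of_zero: "op_of N (0\<^sub>m N N) = 0"
  using N by (simp add: app_inject[symmetric] app_simps fun_eq_iff op_of.rep_eq)

lemma op_of_add:
  assumes "A \<in> carrier_mat N N" "B \<in> carrier_mat N N"
  shows "op_of N (A + B) = op_of N A + op_of N B"
  using assms N by (simp add: app_inject[symmetric] app_simps fun_eq_iff op_of.rep_eq
      sum.distrib distrib_right)

lemma op_of_minus:
  assumes "A \<in> carrier_mat N N" "B \<in> carrier_mat N N"
  shows "op_of N (A - B) = op_of N A - op_of N B"
  using assms N by (simp add: app_inject[symmetric] app_simps fun_eq_iff op_of.rep_eq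
      sum_subtractf left_diff_distrib)

lemma op_of_smult:
  assumes "A \<in> carrier_mat N N"
  shows "op_of N (of_int k \<cdot>\<^sub>m A) = of_int k * op_of N A"
  using assms N by (simp add: app_inject[symmetric] app_simps fun_eq_iff op_of.rep_eq app_of_int
      sum_distrib_left algebra_simps)

lemma op_of_mult:
  assumes A: "A \<in> carrier_mat N N" and B: "B \<in> carrier_mat N N"
  shows "op_of N (A * B) = op_of N A * op_of N B"
proof -
  have "app (op_of N (A * B)) x i = app (op_of N A) (app (op_of N B) x) i" for x i
  proof -
    have "app (op_of N (A * B)) x i =
        (\<Sum>j<N. \<Sum>k<N. A $$ (i mod N, k) * B $$ (k, j) * x (N * (i div N) + j))"
      unfolding op_of.rep_eq using A B N
      by (intro sum.cong) (auto simp: scalar_prod_def sum_distrib_right atLeast0LessThan)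
    also have "\<dots> = (\<Sum>k<N. \<Sum>j<N. A $$ (i mod N, k) * B $$ (k, j) * x (N * (i div N) + j))"
      by (rule sum.swap)
    also have "\<dots> = app (op_of N A) (app (op_of N B) x) i"
      unfolding op_of.rep_eq by (intro sum.cong) (auto simp: sum_distrib_left algebra_simps)
    finally show ?thesis .
  qed
  then show ?thesis
    by (simp add: app_inject[symmetric] app_simps fun_eq_iff)
qed

lemma op_of_inject:
  assumes A: "A \<in> carrier_mat N N" and B: "B \<in> carrier_mat N N"
  shows "op_of N A = op_of N B \<longleftrightarrow> A = B"
proof
  assume eq: "op_of N A = op_of N B"
  \<comment> \<open>A sequence supported at one point \<open>j < N\<close> lies in block 0 and picks
    out column \<open>j\<close> of the matrix.\<close>
  have entry: "app (op_of N M) (\<lambda>k. if k = j then 1 else 0) i = M $$ (i, j)" if "i < N" "j < N" for M i j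
    unfolding op_of.rep_eq using that by (simp add: if_distrib cong: if_cong)
  show "A = B"
    by (rule eq_matI) (use A B eq entry[of _ _ A] entry[of _ _ B] in auto)
qed simp

end

text \<open>A vector becomes the matrix all of whose columns equal it, so that applying a matrix to
  the vector is a product in the ring.\<close>

definition op_vec :: "nat \<Rightarrow> complex Matrix.vec \<Rightarrow> lin_op" where
  "op_vec N v = op_of N (Matrix.mat N N (\<lambda>(i, j). v $ i))"

context
  fixes N :: nat
  assumes N: "N > 0"
begin

lemma op_vec_inject:
  assumes "v \<in> carrier_vec N" "w \<in> carrier_vec N"
  shows "op_vec N v = op_vec N w \<longleftrightarrow> v = w"
proof
  assume "op_vec N v = op_vec N w"
  then have eq: "Matrix.mat N N (\<lambda>(i, j). v $ i) = Matrix.mat N N (\<lambda>(i, j). w $ i)"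
    unfolding op_vec_def by (subst (asm) op_of_inject[OF N]) auto
  show "v = w"
  proof (rule eq_vecI)
    fix i assume "i < dim_vec w"
    with assms N show "v $ i = w $ i"
      using arg_cong[OF eq, of "\<lambda>M. M $$ (i, 0)"] by auto
  qed (use assms in auto)
qed simp

lemma op_vec_mult:
  assumes "M \<in> carrier_mat N N" "v \<in> carrier_vec N"
  shows "op_vec N (M *\<^sub>v v) = op_of N M * op_vec N v"
proof -
  have "Matrix.mat N N (\<lambda>(i, j). (M *\<^sub>v v) $ i) = M * Matrix.mat N N (\<lambda>(i, j). v $ i)"
    using assms by (intro eq_matI) (auto simp: scalar_prod_def)
  then show ?thesis
    unfolding op_vec_def using assms by (simp add: op_of_mult[OF N])
qed

lemma op_vec_smult:
  assumes "v \<in> carrier_vec N"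
  shows "op_vec N (of_int k \<cdot>\<^sub>v v) = of_int k * op_vec N v"
proof -
  have "Matrix.mat N N (\<lambda>(i, j). (of_int k \<cdot>\<^sub>v v) $ i) = of_int k \<cdot>\<^sub>m Matrix.mat N N (\<lambda>(i, j). v $ i)"
    using assms by (intro eq_matI) auto
  then show ?thesis
    unfolding op_vec_def by (simp add: op_of_smult[OF N])
qed

lemma op_vec_add:
  assumes "v \<in> carrier_vec N" "w \<in> carrier_vec N"
  shows "op_vec N (v + w) = op_vec N v + op_vec N w"
proof -
  have "Matrix.mat N N (\<lambda>(i, j). (v + w) $ i) = Matrix.mat N N (\<lambda>(i, j). v $ i) + Matrix.mat N N (\<lambda>(i, j). w $ i)"
    using assms by (intro eq_matI) auto
  then show ?thesis
    unfolding op_vec_def by (simp add: op_of_add[OF N])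
qed

lemma op_vec_zero: "op_vec N (0\<^sub>v N) = 0"
proof -
  have "Matrix.mat N N (\<lambda>(i, j). 0\<^sub>v N $ i) = (0\<^sub>m N N :: complex mat)"
    by (intro eq_matI) auto
  then show ?thesis
    unfolding op_vec_def by (simp add: op_of_zero[OF N])
qed

end

section \<open>Kronecker products\<close>

lemma dim_kron [simp]:
  "dim_row (A \<otimes>\<^sub>m B) = dim_row A * dim_row B" "dim_col (A \<otimes>\<^sub>m B) = dim_col A * dim_col B"
  by (simp_all add: kron_def)

lemma kron_carrier [intro]:
  "A \<in> carrier_mat p q \<Longrightarrow> B \<in> carrier_mat r s \<Longrightarrow> A \<otimes>\<^sub>m B \<in> carrier_mat (p * r) (q * s)"
  by (intro carrier_matI) auto

lemma div_less_factor: "i < p * q \<Longrightarrow> i div q < (p :: nat)"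
  by (simp add: less_mult_imp_div_less)

lemma mod_less_factor: "i < p * q \<Longrightarrow> i mod q < (q :: nat)"
  by (metis mod_less_divisor mult_0_right neq0_conv not_less_zero)

lemma index_less_mult: "i < p \<Longrightarrow> j < q \<Longrightarrow> i * q + j < p * (q :: nat)"
proof -
  assume "i < p" "j < q"
  then have "i * q + j < (i + 1) * q" "(i + 1) * q \<le> p * q"
    by (simp, intro mult_le_mono1, simp)
  then show ?thesis by linarith
qed

lemma index_kron:
  assumes "i < dim_row A * dim_row B" "j < dim_col A * dim_col B"
  shows "(A \<otimes>\<^sub>m B) $$ (i, j) = A $$ (i div dim_row B, j div dim_col B) * B $$ (i mod dim_row B, j mod dim_col B)"
  using assms by (simp add: kron_def)

lemma index_kron_mult_add:
  assumes "i < dim_row A" "j < dim_col A" "k < dim_row B" "l < dim_col B"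
  shows "(A \<otimes>\<^sub>m B) $$ (i * dim_row B + k, j * dim_col B + l) = A $$ (i, j) * B $$ (k, l)"
  using assms by (subst index_kron) (auto intro: index_less_mult)

lemma sum_mult_index:
  fixes f :: "nat \<Rightarrow> 'a::comm_monoid_add"
  shows "(\<Sum>r<p * q. f r) = (\<Sum>i<p. \<Sum>j<q. f (i * q + j))"
proof -
  have "(\<Sum>i<p. \<Sum>j<q. f (i * q + j)) = (\<Sum>(i, j)\<in>{..<p} \<times> {..<q}. f (i * q + j))"
    by (rule sum.cartesian_product)
  also have "\<dots> = (\<Sum>r<p * q. f r)"
    by (rule sum.reindex_bij_witness[where i = "\<lambda>r. (r div q, r mod q)" and j = "\<lambda>(i, j). i * q + j"])
      (auto intro: index_less_mult div_less_factor mod_less_factor)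
  finally show ?thesis by simp
qed

lemma kron_mult:
  assumes "dim_col A = dim_row C" "dim_col B = dim_row D"
  shows "(A \<otimes>\<^sub>m B) * (C \<otimes>\<^sub>m D) = (A * C) \<otimes>\<^sub>m (B * D)"
proof (rule eq_matI)
  fix i j assume "i < dim_row ((A * C) \<otimes>\<^sub>m (B * D))" "j < dim_col ((A * C) \<otimes>\<^sub>m (B * D))"
  then have i: "i < dim_row A * dim_row B" and j: "j < dim_col C * dim_col D" by auto
  note ij = div_less_factor[OF i] mod_less_factor[OF i] div_less_factor[OF j] mod_less_factor[OF j]
  let ?a = "\<lambda>k. A $$ (i div dim_row B, k) * C $$ (k, j div dim_col D)"
  let ?b = "\<lambda>l. B $$ (i mod dim_row B, l) * D $$ (l, j mod dim_col D)"
  have "((A \<otimes>\<^sub>m B) * (C \<otimes>\<^sub>m D)) $$ (i, j) =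
      (\<Sum>r<dim_row C * dim_row D. (A \<otimes>\<^sub>m B) $$ (i, r) * (C \<otimes>\<^sub>m D) $$ (r, j))"
    using i j assms by (simp add: scalar_prod_def atLeast0LessThan)
  also have "\<dots> = (\<Sum>k<dim_row C. \<Sum>l<dim_row D.
      (A \<otimes>\<^sub>m B) $$ (i, k * dim_row D + l) * (C \<otimes>\<^sub>m D) $$ (k * dim_row D + l, j))"
    by (rule sum_mult_index)
  also have "\<dots> = (\<Sum>k<dim_row C. \<Sum>l<dim_row D. ?a k * ?b l)"
    using i j assms by (intro sum.cong) (auto simp: index_kron index_less_mult)
  also have "\<dots> = (\<Sum>k<dim_row C. ?a k) * (\<Sum>l<dim_row D. ?b l)"
    by (simp add: sum_product)
  also have "\<dots> = ((A * C) \<otimes>\<^sub>m (B * D)) $$ (i, j)"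
    using i j ij assms by (subst index_kron) (auto simp: scalar_prod_def atLeast0LessThan)
  finally show "((A \<otimes>\<^sub>m B) * (C \<otimes>\<^sub>m D)) $$ (i, j) = ((A * C) \<otimes>\<^sub>m (B * D)) $$ (i, j)" .
qed auto

lemma kron_one: "1\<^sub>m p \<otimes>\<^sub>m 1\<^sub>m q = 1\<^sub>m (p * q)"
proof (rule eq_matI)
  fix i j assume "i < dim_row (1\<^sub>m (p * q) :: complex mat)" "j < dim_col (1\<^sub>m (p * q) :: complex mat)"
  then have i: "i < p * q" and j: "j < p * q" by auto
  have "i = j \<longleftrightarrow> i div q = j div q \<and> i mod q = j mod q"
    by (metis div_mult_mod_eq)
  then show "(1\<^sub>m p \<otimes>\<^sub>m 1\<^sub>m q) $$ (i, j) = 1\<^sub>m (p * q) $$ (i, j)"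
    using i j div_less_factor[OF i] mod_less_factor[OF i] div_less_factor[OF j] mod_less_factor[OF j]
    by (auto simp: index_kron)
qed auto

section \<open>Adjoints and the Hermitian inner product\<close>

lemma dim_mat_adjoint [simp]: "dim_row (mat_adjoint A) = dim_col A" "dim_col (mat_adjoint A) = dim_row A"
  by (simp_all add: mat_adjoint_def)

lemma mat_adjoint_carrier [intro]: "A \<in> carrier_mat p q \<Longrightarrow> mat_adjoint A \<in> carrier_mat q p"
  by (intro carrier_matI) auto

lemma index_mat_adjoint:
  "i < dim_col A \<Longrightarrow> j < dim_row A \<Longrightarrow> mat_adjoint A $$ (i, j) = conjugate (A $$ (j, i))"
  by (simp add: mat_adjoint_def mat_of_rows_index)

lemma smult_mat_mult_vec:
  fixes A :: "'a::comm_ring_1 mat"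
  assumes "A \<in> carrier_mat p q" "v \<in> carrier_vec q"
  shows "(c \<cdot>\<^sub>m A) *\<^sub>v v = c \<cdot>\<^sub>v (A *\<^sub>v v)"
  using assms by (intro eq_vecI) (auto simp: scalar_prod_def sum_distrib_left mult.assoc)

lemma index_mult_mat_vec_sum:
  assumes "A \<in> carrier_mat p q" "v \<in> carrier_vec q" "i < p"
  shows "(A *\<^sub>v v) $ i = (\<Sum>j<q. A $$ (i, j) * v $ j)"
  using assms by (auto simp: scalar_prod_def atLeast0LessThan)

lemma mat_adjoint_mult:
  fixes A B :: "complex mat"
  assumes "dim_col A = dim_row B"
  shows "mat_adjoint (A * B) = mat_adjoint B * mat_adjoint A"
  by (rule eq_matI)
    (use assms in \<open>auto simp: index_mat_adjoint scalar_prod_def atLeast0LessThan sum_conjugate mult.commute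
      conjugate_dist_mul conjugate_complex_def intro!: sum.cong\<close>)

lemma mat_adjoint_add:
  fixes A B :: "complex mat"
  assumes "A \<in> carrier_mat p q" "B \<in> carrier_mat p q"
  shows "mat_adjoint (A + B) = mat_adjoint A + mat_adjoint B"
  by (rule eq_matI) (use assms in \<open>auto simp: index_mat_adjoint conjugate_dist_add\<close>)

lemma mat_adjoint_minus:
  fixes A B :: "complex mat"
  assumes "A \<in> carrier_mat p q" "B \<in> carrier_mat p q"
  shows "mat_adjoint (A - B) = mat_adjoint A - mat_adjoint B"
  by (rule eq_matI) (use assms in \<open>auto simp: index_mat_adjoint conjugate_complex_def\<close>)

lemma mat_adjoint_smult:
  fixes A :: "complex mat"
  shows "mat_adjoint (c \<cdot>\<^sub>m A) = cnj c \<cdot>\<^sub>m mat_adjoint A"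
  by (rule eq_matI) (auto simp: index_mat_adjoint conjugate_complex_def)

lemma mat_adjoint_one: "mat_adjoint (1\<^sub>m n :: complex mat) = 1\<^sub>m n"
  by (rule eq_matI) (auto simp: index_mat_adjoint conjugate_complex_def)

lemma mat_adjoint_adjoint: "mat_adjoint (mat_adjoint A) = (A :: complex mat)"
  by (rule eq_matI) (auto simp: index_mat_adjoint)

lemma mat_adjoint_kron: "mat_adjoint (A \<otimes>\<^sub>m B) = mat_adjoint A \<otimes>\<^sub>m mat_adjoint B"
  by (rule eq_matI) (auto simp: index_mat_adjoint index_kron div_less_factor mod_less_factor conjugate_dist_mul)

lemma inner_adjoint:
  fixes A :: "complex mat"
  assumes A: "A \<in> carrier_mat p q" and v: "v \<in> carrier_vec q" and w: "w \<in> carrier_vec p"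
  shows "(A *\<^sub>v v) \<bullet>c w = v \<bullet>c (mat_adjoint A *\<^sub>v w)"
proof -
  have "(A *\<^sub>v v) \<bullet>c w = (\<Sum>i<p. \<Sum>j<q. A $$ (i, j) * v $ j * cnj (w $ i))"
    using assms by (auto simp: scalar_prod_def atLeast0LessThan conjugate_complex_def sum_distrib_right
        intro!: sum.cong)
  also have "\<dots> = (\<Sum>j<q. \<Sum>i<p. A $$ (i, j) * v $ j * cnj (w $ i))"
    by (rule sum.swap)
  also have "\<dots> = v \<bullet>c (mat_adjoint A *\<^sub>v w)"
    using assms by (auto simp: scalar_prod_def atLeast0LessThan conjugate_complex_def sum_distrib_left
        index_mat_adjoint intro!: sum.cong)
  finally show ?thesis .
qed

section \<open>Operators acting on a single tensor factor\<close>

definition up_leg :: "nat \<Rightarrow> nat \<Rightarrow> nat \<Rightarrow> complex mat \<Rightarrow> complex mat" where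
  "up_leg nu nd nr A = A \<otimes>\<^sub>m 1\<^sub>m (nd + 1) \<otimes>\<^sub>m 1\<^sub>m (nr + 1) \<otimes>\<^sub>m 1\<^sub>m 2"

definition down_leg :: "nat \<Rightarrow> nat \<Rightarrow> nat \<Rightarrow> complex mat \<Rightarrow> complex mat" where
  "down_leg nu nd nr A = 1\<^sub>m (nu + 1) \<otimes>\<^sub>m A \<otimes>\<^sub>m 1\<^sub>m (nr + 1) \<otimes>\<^sub>m 1\<^sub>m 2"

definition tan_leg :: "nat \<Rightarrow> nat \<Rightarrow> nat \<Rightarrow> complex mat \<Rightarrow> complex mat" where
  "tan_leg nu nd nr A = 1\<^sub>m (nu + 1) \<otimes>\<^sub>m 1\<^sub>m (nd + 1) \<otimes>\<^sub>m A \<otimes>\<^sub>m 1\<^sub>m 2"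

definition spin_leg :: "nat \<Rightarrow> nat \<Rightarrow> nat \<Rightarrow> complex mat \<Rightarrow> complex mat" where
  "spin_leg nu nd nr A = 1\<^sub>m (nu + 1) \<otimes>\<^sub>m 1\<^sub>m (nd + 1) \<otimes>\<^sub>m 1\<^sub>m (nr + 1) \<otimes>\<^sub>m A"

lemmas leg_defs = up_leg_def down_leg_def tan_leg_def spin_leg_def

lemma kron_add_left:
  "dim_row A = dim_row B \<Longrightarrow> dim_col A = dim_col B \<Longrightarrow> (A + B) \<otimes>\<^sub>m C = A \<otimes>\<^sub>m C + B \<otimes>\<^sub>m C"
  by (rule eq_matI) (auto simp: index_kron div_less_factor distrib_right)

lemma kron_add_right:
  "dim_row A = dim_row B \<Longrightarrow> dim_col A = dim_col B \<Longrightarrow> C \<otimes>\<^sub>m (A + B) = C \<otimes>\<^sub>m A + C \<otimes>\<^sub>m B"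
  by (rule eq_matI) (auto simp: index_kron mod_less_factor distrib_left)

lemma kron_smult_left: "(c \<cdot>\<^sub>m A) \<otimes>\<^sub>m C = c \<cdot>\<^sub>m (A \<otimes>\<^sub>m C)"
  by (rule eq_matI) (auto simp: index_kron div_less_factor)

lemma kron_smult_right: "C \<otimes>\<^sub>m (c \<cdot>\<^sub>m A) = c \<cdot>\<^sub>m (C \<otimes>\<^sub>m A)"
  by (rule eq_matI) (auto simp: index_kron mod_less_factor)

text \<open>A unital algebra homomorphism compatible with adjoints, from matrices on one tensor
  factor to matrices on the whole space. The four factors are handled uniformly through it.\<close>

locale leg =
  fixes N k :: nat and f :: "complex mat \<Rightarrow> complex mat"
  assumes leg_carrier: "A \<in> carrier_mat k k \<Longrightarrow> f A \<in> carrier_mat N N"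
    and leg_add: "A \<in> carrier_mat k k \<Longrightarrow> B \<in> carrier_mat k k \<Longrightarrow> f (A + B) = f A + f B"
    and leg_mult: "A \<in> carrier_mat k k \<Longrightarrow> B \<in> carrier_mat k k \<Longrightarrow> f (A * B) = f A * f B"
    and leg_smult: "f (c \<cdot>\<^sub>m A) = c \<cdot>\<^sub>m f A"
    and leg_one: "f (1\<^sub>m k) = 1\<^sub>m N"
    and leg_adjoint: "f (mat_adjoint A) = mat_adjoint (f A)"

lemmas kron_simps = kron_add_left kron_add_right kron_mult kron_smult_left kron_smult_right kron_one
  mat_adjoint_kron mat_adjoint_one

context
  fixes nu nd nr :: nat
begin

lemma leg_up: "leg (state_dim nu nd nr) (nu + 1) (up_leg nu nd nr)"
  by unfold_locales
    (auto simp: up_leg_def state_dim_def kron_simps simp del: mult_Suc mult_Suc_right)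

lemma leg_down: "leg (state_dim nu nd nr) (nd + 1) (down_leg nu nd nr)"
  by unfold_locales
    (auto simp: down_leg_def state_dim_def kron_simps simp del: mult_Suc mult_Suc_right)

lemma leg_tan: "leg (state_dim nu nd nr) (nr + 1) (tan_leg nu nd nr)"
  by unfold_locales
    (auto simp: tan_leg_def state_dim_def kron_simps simp del: mult_Suc mult_Suc_right)

lemma leg_spin: "leg (state_dim nu nd nr) 2 (spin_leg nu nd nr)"
  by unfold_locales
    (auto simp: spin_leg_def state_dim_def kron_simps simp del: mult_Suc mult_Suc_right)

lemma leg_commute:
  "A \<in> carrier_mat (nu + 1) (nu + 1) \<Longrightarrow> B \<in> carrier_mat (nd + 1) (nd + 1) \<Longrightarrow>
    down_leg nu nd nr B * up_leg nu nd nr A = up_leg nu nd nr A * down_leg nu nd nr B"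
  "A \<in> carrier_mat (nu + 1) (nu + 1) \<Longrightarrow> B \<in> carrier_mat (nr + 1) (nr + 1) \<Longrightarrow>
    tan_leg nu nd nr B * up_leg nu nd nr A = up_leg nu nd nr A * tan_leg nu nd nr B"
  "A \<in> carrier_mat (nu + 1) (nu + 1) \<Longrightarrow> B \<in> carrier_mat 2 2 \<Longrightarrow>
    spin_leg nu nd nr B * up_leg nu nd nr A = up_leg nu nd nr A * spin_leg nu nd nr B"
  "A \<in> carrier_mat (nd + 1) (nd + 1) \<Longrightarrow> B \<in> carrier_mat (nr + 1) (nr + 1) \<Longrightarrow>
    tan_leg nu nd nr B * down_leg nu nd nr A = down_leg nu nd nr A * tan_leg nu nd nr B"
  "A \<in> carrier_mat (nd + 1) (nd + 1) \<Longrightarrow> B \<in> carrier_mat 2 2 \<Longrightarrow>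
    spin_leg nu nd nr B * down_leg nu nd nr A = down_leg nu nd nr A * spin_leg nu nd nr B"
  "A \<in> carrier_mat (nr + 1) (nr + 1) \<Longrightarrow> B \<in> carrier_mat 2 2 \<Longrightarrow>
    spin_leg nu nd nr B * tan_leg nu nd nr A = tan_leg nu nd nr A * spin_leg nu nd nr B"
  by (auto simp: leg_defs kron_mult simp del: mult_Suc mult_Suc_right)

end

section \<open>Ladder matrices\<close>

text \<open>The matrix element sqrt ((j - m) (j + m + 1)) that raises weight m = n/2 - k to m + 1.
  Basis vectors are counted downwards from the highest weight, so \<open>raise\<close> decreases the
  index.\<close>

definition ladder_coeff :: "nat \<Rightarrow> nat \<Rightarrow> complex" where
  "ladder_coeff n k = complex_of_real (sqrt (real k * real (n + 1 - k)))"

definition raise :: "nat \<Rightarrow> complex mat" where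
  "raise n = Matrix.mat (n + 1) (n + 1) (\<lambda>(k, l). if l = Suc k then ladder_coeff n l else 0)"

definition lower :: "nat \<Rightarrow> complex mat" where
  "lower n = Matrix.mat (n + 1) (n + 1) (\<lambda>(k, l). if k = Suc l then ladder_coeff n k else 0)"

definition weight :: "nat \<Rightarrow> complex mat" where
  "weight n = Matrix.mat (n + 1) (n + 1) (\<lambda>(k, l). if k = l then of_nat n - 2 * of_nat k else 0)"

lemma ladder_carrier [simp]:
  "raise n \<in> carrier_mat (n + 1) (n + 1)" "lower n \<in> carrier_mat (n + 1) (n + 1)"
  "weight n \<in> carrier_mat (n + 1) (n + 1)"
  by (simp_all add: raise_def lower_def weight_def)

lemma ladder_dim [simp]:
  "dim_row (raise n) = n + 1" "dim_col (raise n) = n + 1" "dim_row (lower n) = n + 1"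
  "dim_col (lower n) = n + 1" "dim_row (weight n) = n + 1" "dim_col (weight n) = n + 1"
  by (simp_all add: raise_def lower_def weight_def)

lemma ladder_coeff_0 [simp]: "ladder_coeff n 0 = 0"
  and ladder_coeff_Suc [simp]: "ladder_coeff n (Suc n) = 0"
  by (simp_all add: ladder_coeff_def)

lemma ladder_coeff_nonzero: "0 < k \<Longrightarrow> k \<le> n \<Longrightarrow> ladder_coeff n k \<noteq> 0"
  by (simp add: ladder_coeff_def)

lemma ladder_coeff_square: 
  "k \<le> n + 1 \<Longrightarrow> ladder_coeff n k * ladder_coeff n k = of_nat k * (of_nat n + 1 - of_nat k)"
proof -
  assume k: "k \<le> n + 1"
  have "ladder_coeff n k * ladder_coeff n k = complex_of_real (real k * real (n + 1 - k))"
    by (simp add: ladder_coeff_def of_real_mult[symmetric] del: of_real_mult)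
  with k show ?thesis
    by (simp add: of_nat_diff)
qed

text \<open>At the ends of the ladder the coefficient vanishes, so the out-of-range argument of \<open>f\<close> does no harm.\<close>
lemma sum_raise:
  fixes f :: "nat \<Rightarrow> complex"
  assumes "k \<le> n"
  shows "(\<Sum>j<n + 1. raise n $$ (k, j) * f j) = ladder_coeff n (Suc k) * f (Suc k)"
proof -
  have "(\<Sum>j<n + 1. raise n $$ (k, j) * f j) =
      (\<Sum>j<n + 1. if j = Suc k then ladder_coeff n (Suc k) * f (Suc k) else 0)"
    using assms by (intro sum.cong) (auto simp: raise_def)
  with assms show ?thesis
    by (cases "k = n") auto
qed

lemma sum_lower:
  fixes f :: "nat \<Rightarrow> complex"
  assumes "k \<le> n"
  shows "(\<Sum>j<n + 1. lower n $$ (k, j) * f j) = ladder_coeff n k * f (k - 1)"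
proof -
  have "(\<Sum>j<n + 1. lower n $$ (k, j) * f j) =
      (\<Sum>j<n + 1. if j = k - 1 then ladder_coeff n k * f (k - 1) else 0)"
    using assms by (intro sum.cong; cases k) (auto simp: lower_def)
  with assms show ?thesis
    by auto
qed

lemma sum_weight:
  fixes f :: "nat \<Rightarrow> complex"
  assumes "k \<le> n"
  shows "(\<Sum>j<n + 1. weight n $$ (k, j) * f j) = (of_nat n - 2 * of_nat k) * f k"
proof -
  have "(\<Sum>j<n + 1. weight n $$ (k, j) * f j) =
      (\<Sum>j<n + 1. if j = k then (of_nat n - 2 * of_nat k) * f k else 0)"
    using assms by (intro sum.cong) (auto simp: weight_def)
  with assms show ?thesis
    by auto
qed

context
  fixes n :: nat and A :: "complex mat" and k l :: nat
  assumes A: "dim_row A = n + 1" "dim_col A = n + 1" and k: "k \<le> n" and l: "l \<le> n"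
begin

lemma index_raise_mult: "(raise n * A) $$ (k, l) = ladder_coeff n (Suc k) * A $$ (Suc k, l)"
  using A k l sum_raise[OF k, of "\<lambda>j. A $$ (j, l)"] by (auto simp: scalar_prod_def atLeast0LessThan)

lemma index_lower_mult: "(lower n * A) $$ (k, l) = ladder_coeff n k * A $$ (k - 1, l)"
  using A k l sum_lower[OF k, of "\<lambda>j. A $$ (j, l)"] by (auto simp: scalar_prod_def atLeast0LessThan)

lemma index_weight_mult: "(weight n * A) $$ (k, l) = (of_nat n - 2 * of_nat k) * A $$ (k, l)"
  using A k l sum_weight[OF k, of "\<lambda>j. A $$ (j, l)"] by (auto simp: scalar_prod_def atLeast0LessThan)

end

lemmas index_ladder_mult = index_raise_mult index_lower_mult index_weight_mult

lemma index_raise: "k \<le> n \<Longrightarrow> l \<le> n \<Longrightarrow> raise n $$ (k, l) = (if l = Suc k then ladder_coeff n l else 0)"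
  and index_lower: "k \<le> n \<Longrightarrow> l \<le> n \<Longrightarrow> lower n $$ (k, l) = (if k = Suc l then ladder_coeff n k else 0)"
  and index_weight: "k \<le> n \<Longrightarrow> l \<le> n \<Longrightarrow> weight n $$ (k, l) = (if k = l then of_nat n - 2 * of_nat k else 0)"
  by (simp_all add: raise_def lower_def weight_def)

lemmas index_ladder = index_raise index_lower index_weight

lemma index_raise_lower:
  assumes "k \<le> n" "l \<le> n"
  shows "(raise n * lower n) $$ (k, l) = (if k = l then (of_nat k + 1) * (of_nat n - of_nat k) else 0)"
proof -
  have "lower n $$ (Suc k, l) = (if k = l then ladder_coeff n (Suc k) else 0)" if "k < n"
    using assms that by (simp add: index_lower)
  with assms show ?thesis
    by (cases "k = n") (auto simp: index_raise_mult ladder_coeff_square algebra_simps simp del: index_mult_mat(1))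
qed

lemma index_lower_raise:
  assumes "k \<le> n" "l \<le> n"
  shows "(lower n * raise n) $$ (k, l) = (if k = l then of_nat k * (of_nat n + 1 - of_nat k) else 0)"
proof -
  have "raise n $$ (k - 1, l) = (if k = l then ladder_coeff n l else 0)" if "0 < k"
    using assms that by (simp add: index_raise)
  with assms show ?thesis
    by (cases "k = 0") (auto simp: index_lower_mult ladder_coeff_square simp del: index_mult_mat(1))
qed

lemma ladder_relations:
  "lower n * raise n = raise n * lower n - weight n"
  "weight n * raise n = raise n * weight n + raise n + raise n"
  "weight n * lower n = lower n * weight n - lower n - lower n"
proof -
  show "lower n * raise n = raise n * lower n - weight n"
  proof (rule eq_matI)
    fix k l assume "k < dim_row (raise n * lower n - weight n)" "l < dim_col (raise n * lower n - weight n)"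
    then have kl: "k \<le> n" "l \<le> n" by auto
    then show "(lower n * raise n) $$ (k, l) = (raise n * lower n - weight n) $$ (k, l)"
      by (simp add: index_raise_lower index_lower_raise index_weight algebra_simps del: index_mult_mat(1))
  qed auto
next
  show "weight n * raise n = raise n * weight n + raise n + raise n"
  proof (rule eq_matI)
    fix k l assume "k < dim_row (raise n * weight n + raise n + raise n)" "l < dim_col (raise n * weight n + raise n + raise n)"
    then have kl: "k \<le> n" "l \<le> n" by auto
    then show "(weight n * raise n) $$ (k, l) = (raise n * weight n + raise n + raise n) $$ (k, l)"
      by (cases "k = n") (auto simp: index_ladder_mult index_ladder algebra_simps
          simp del: index_mult_mat(1))
  qed auto
next
  show "weight n * lower n = lower n * weight n - lower n - lower n"
  proof (rule eq_matI)
    fix k l assume "k < dim_row (lower n * weight n - lower n - lower n)" "l < dim_col (lower n * weight n - lower n - lower n)"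
    then have kl: "k \<le> n" "l \<le> n" by auto
    then show "(weight n * lower n) $$ (k, l) = (lower n * weight n - lower n - lower n) $$ (k, l)"
      by (cases k) (auto simp: index_ladder_mult index_ladder algebra_simps
          simp del: index_mult_mat(1))
  qed auto
qed

text \<open>The matrix counterpart of \<open>spin_dot\<close>; \<open>op_of_mat_dot\<close> relates
  the two.\<close>

definition mat_dot :: "complex mat \<Rightarrow> complex mat \<Rightarrow> complex mat \<Rightarrow> complex mat \<Rightarrow> complex mat \<Rightarrow> complex mat \<Rightarrow> complex mat" where
  "mat_dot e f h e' f' h' = 2 \<cdot>\<^sub>m (e * f' + f * e') + h * h'"

text \<open>The diagonal entry 2 ((k + 1) (n - k) + k (n + 1 - k)) + (n - 2 k)^2 equals n (n + 2)
  for every k.\<close>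

lemma ladder_casimir:
  "mat_dot (raise n) (lower n) (weight n) (raise n) (lower n) (weight n) = of_int ((int n + 1) * (int n + 1) - 1) \<cdot>\<^sub>m 1\<^sub>m (n + 1)"
  (is "?L = ?R")
proof (rule eq_matI)
  fix k l assume "k < dim_row ?R" "l < dim_col ?R"
  then have kl: "k \<le> n" "l \<le> n" by auto
  then show "?L $$ (k, l) = ?R $$ (k, l)"
    by (simp add: mat_dot_def index_raise_lower index_lower_raise index_weight_mult index_weight algebra_simps
        del: index_mult_mat(1))
qed (auto simp: mat_dot_def)

lemma half_spin_relations:
  "lower 1 * raise 1 = 1\<^sub>m 2 - raise 1 * lower 1" "raise 1 * raise 1 = 0\<^sub>m 2 2" "lower 1 * lower 1 = 0\<^sub>m 2 2"
  "weight 1 = raise 1 * lower 1 + raise 1 * lower 1 - 1\<^sub>m 2"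
proof -
  have two: "k = 0 \<or> k = 1" if "k < 2" for k :: nat using that by auto
  note [simp] = index_ladder_mult index_ladder ladder_coeff_def
  show "lower 1 * raise 1 = 1\<^sub>m 2 - raise 1 * lower 1"
    by (rule eq_matI) (auto dest!: two simp del: index_mult_mat(1) One_nat_def)
  show "raise 1 * raise 1 = 0\<^sub>m 2 2"
    by (rule eq_matI) (auto dest!: two simp del: index_mult_mat(1) One_nat_def)
  show "lower 1 * lower 1 = 0\<^sub>m 2 2"
    by (rule eq_matI) (auto dest!: two simp del: index_mult_mat(1) One_nat_def)
  show "weight 1 = raise 1 * lower 1 + raise 1 * lower 1 - 1\<^sub>m 2"
    by (rule eq_matI) (auto dest!: two simp del: index_mult_mat(1) One_nat_def)
qed

lemma ladder_adjoint:
  "mat_adjoint (raise n) = lower n" "mat_adjoint (lower n) = raise n" "mat_adjoint (weight n) = weight n"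
  by (rule eq_matI; auto simp: mat_adjoint_def mat_of_rows_index raise_def lower_def weight_def ladder_coeff_def
     conjugate_complex_def)+

section \<open>One-parameter groups and their generators\<close>

text \<open>The entries of \<open>spin_rep\<close> are, up to constants, coefficients of products of
  linear polynomials, so curves of polynomials are differentiated coefficient by
  coefficient.\<close>

definition coeff_deriv :: "(real \<Rightarrow> complex poly) \<Rightarrow> complex poly \<Rightarrow> real \<Rightarrow> bool" where
  "coeff_deriv p p' t \<longleftrightarrow> (\<forall>k. ((\<lambda>s. coeff (p s) k) has_vector_derivative coeff p' k) (at t))"

lemma coeff_deriv_mult:
  assumes "coeff_deriv p p' t" "coeff_deriv q q' t"
  shows "coeff_deriv (\<lambda>s. p s * q s) (p' * q t + p t * q') t"
  unfolding coeff_deriv_def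
proof
  fix k
  have "((\<lambda>s. \<Sum>i\<le>k. coeff (p s) i * coeff (q s) (k - i)) has_vector_derivative
      (\<Sum>i\<le>k. coeff (p t) i * coeff q' (k - i) + coeff p' i * coeff (q t) (k - i))) (at t)"
    using assms unfolding coeff_deriv_def
    by (intro has_vector_derivative_sum has_vector_derivative_mult) auto
  then show "((\<lambda>s. coeff (p s * q s) k) has_vector_derivative coeff (p' * q t + p t * q') k) (at t)"
    by (simp add: coeff_mult sum.distrib add.commute)
qed

lemma coeff_deriv_power:
  assumes "coeff_deriv p p' t"
  shows "coeff_deriv (\<lambda>s. p s ^ m) (of_nat m * p' * p t ^ (m - 1)) t"
proof (induction m)
  case 0
  show ?case by (simp add: coeff_deriv_def)
next
  case (Suc m)
  have "p' * p t ^ m + p t * (of_nat m * p' * p t ^ (m - 1)) = of_nat (Suc m) * p' * p t ^ (Suc m - 1)"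
    by (cases m) (simp_all add: algebra_simps)
  with coeff_deriv_mult[OF assms Suc.IH] show ?case
    by simp
qed

lemma sum_mult_raise:
  fixes f :: "nat \<Rightarrow> complex"
  assumes "l \<le> n"
  shows "(\<Sum>j<n + 1. f j * raise n $$ (j, l)) = f (l - 1) * ladder_coeff n l"
proof -
  have "(\<Sum>j<n + 1. f j * raise n $$ (j, l)) = (\<Sum>j<n + 1. if j = l - 1 then f (l - 1) * ladder_coeff n l else 0)"
    using assms by (intro sum.cong; cases l) (auto simp: raise_def)
  with assms show ?thesis by auto
qed

lemma sum_mult_lower:
  fixes f :: "nat \<Rightarrow> complex"
  assumes "l \<le> n"
  shows "(\<Sum>j<n + 1. f j * lower n $$ (j, l)) = f (Suc l) * ladder_coeff n (Suc l)"
proof -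
  have "(\<Sum>j<n + 1. f j * lower n $$ (j, l)) = (\<Sum>j<n + 1. if j = Suc l then f (Suc l) * ladder_coeff n (Suc l) else 0)"
    using assms by (intro sum.cong) (auto simp: lower_def)
  with assms show ?thesis by (cases "l = n") auto
qed

lemma sum_mult_weight:
  fixes f :: "nat \<Rightarrow> complex"
  assumes "l \<le> n"
  shows "(\<Sum>j<n + 1. f j * weight n $$ (j, l)) = f l * (of_nat n - 2 * of_nat l)"
proof -
  have "(\<Sum>j<n + 1. f j * weight n $$ (j, l)) = (\<Sum>j<n + 1. if j = l then f l * (of_nat n - 2 * of_nat l) else 0)"
    using assms by (intro sum.cong) (auto simp: weight_def)
  with assms show ?thesis by auto
qed

text \<open>On monomials the infinitesimal action has matrix entries \<open>l\<close> and
  \<open>n - l\<close>. Rescaling by the norms sqrt (n choose l) turns these into ladder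
  coefficients; under the root this is the absorption identity for binomials. In the application
  \<open>r\<close> is \<open>n choose k\<close>.\<close>

lemma ladder_coeff_binomial:
  assumes "l \<le> n"
  shows "sqrt (real (n choose (l - 1)) / r) * sqrt (real l * real (n + 1 - l)) = real l * sqrt (real (n choose l) / r)"
    and "sqrt (real (n choose Suc l) / r) * sqrt (real (Suc l) * real (n + 1 - Suc l)) = real (n - l) * sqrt (real (n choose l) / r)"
proof -
  have 1: "real l * real (n choose l) = real (n + 1 - l) * real (n choose (l - 1))" if pos: "0 < l"
  proof -
    obtain m where l: "l = Suc m" using pos by (cases l) auto
    have "Suc m * (n choose Suc m) = (n - m) * (n choose m)"
      by (simp only: binomial_absorb_comp binomial_absorption)
    then show ?thesis
      unfolding l of_nat_mult[symmetric] by simp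
  qed
  show "sqrt (real (n choose (l - 1)) / r) * sqrt (real l * real (n + 1 - l)) = real l * sqrt (real (n choose l) / r)"
  proof (cases "l = 0")
    case False
    have "real (n choose (l - 1)) / r * (real l * real (n + 1 - l)) = (real l)\<^sup>2 * (real (n choose l) / r)"
      using 1 False by (simp add: power2_eq_square field_simps)
    then have "sqrt (real (n choose (l - 1)) / r * (real l * real (n + 1 - l))) = sqrt ((real l)\<^sup>2 * (real (n choose l) / r))"
      by (rule arg_cong)
    then show ?thesis
      by (simp only: real_sqrt_mult real_sqrt_abs abs_of_nat)
  qed simp
  have 2: "real (Suc l) * real (n choose Suc l) = real (n - l) * real (n choose l)"
  proof -
    have "Suc l * (n choose Suc l) = (n - l) * (n choose l)"
      by (simp only: binomial_absorb_comp binomial_absorption)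
    then show ?thesis
      unfolding of_nat_mult[symmetric] by simp
  qed
  have "real (n choose Suc l) / r * (real (Suc l) * real (n + 1 - Suc l)) = (real (Suc l) * real (n choose Suc l)) * real (n - l) / r"
    by simp
  also have "\<dots> = (real (n - l))\<^sup>2 * (real (n choose l) / r)"
    unfolding 2 by (simp add: power2_eq_square)
  finally have "sqrt (real (n choose Suc l) / r * (real (Suc l) * real (n + 1 - Suc l))) = sqrt ((real (n - l))\<^sup>2 * (real (n choose l) / r))"
    by (rule arg_cong)
  then show "sqrt (real (n choose Suc l) / r) * sqrt (real (Suc l) * real (n + 1 - Suc l)) = real (n - l) * sqrt (real (n choose l) / r)"
    by (simp only: real_sqrt_mult real_sqrt_abs abs_of_nat)
qed

text \<open>The differential of \<^const>\<open>spin_rep\<close> at the identity, correct only for traceless \<open>X\<close>.\<close>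
definition spin_deriv :: "nat \<Rightarrow> complex mat \<Rightarrow> complex mat" where
  "spin_deriv n X = X $$ (0, 1) \<cdot>\<^sub>m raise n + X $$ (1, 0) \<cdot>\<^sub>m lower n + X $$ (0, 0) \<cdot>\<^sub>m weight n"

lemma spin_deriv_carrier: "spin_deriv n X \<in> carrier_mat (n + 1) (n + 1)"
  by (auto simp: spin_deriv_def)

text \<open>The equation U' = U X with U 0 = 1, entrywise and at all times. It passes to symmetric
  powers and Kronecker products, and relates vectors fixed by U to vectors killed by X.\<close>

definition flow :: "nat \<Rightarrow> (real \<Rightarrow> complex mat) \<Rightarrow> complex mat \<Rightarrow> bool" where
  "flow p U X \<longleftrightarrow> X \<in> carrier_mat p p \<and> U 0 = 1\<^sub>m p \<and> (\<forall>t. U t \<in> carrier_mat p p) \<and>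
     (\<forall>t. \<forall>i<p. \<forall>j<p. ((\<lambda>s. U s $$ (i, j)) has_vector_derivative (U t * X) $$ (i, j)) (at t))"

lemma spin_rep_one: "spin_rep n (1\<^sub>m 2) = 1\<^sub>m (n + 1)"
proof (rule eq_matI)
  fix k l assume "k < dim_row (1\<^sub>m (n + 1) :: complex mat)" "l < dim_col (1\<^sub>m (n + 1) :: complex mat)"
  moreover have "[:0, 1::complex:] ^ l = monom 1 l"
    by (simp add: monom_altdef)
  moreover have "[:1::complex:] = 1"
    by simp
  ultimately show "spin_rep n (1\<^sub>m 2) $$ (k, l) = 1\<^sub>m (n + 1) $$ (k, l)"
    by (auto simp: spin_rep_def one_pCons[symmetric])
qed (auto simp: spin_rep_def)

text \<open>The columns of g, read as linear polynomials P and Q, are the images of x and y. The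
  flow equation makes P' and Q' combinations of P and Q with the columns of \<open>X\<close> as
  coefficients, and the Leibniz rule on P^(n - l) Q^l yields such products with \<open>l\<close>
  changed by at most one. Tracelessness merges the two diagonal contributions into the weight n - 2
  l.\<close>

lemma flow_spin_rep:
  assumes g: "flow 2 g X" and traceless: "X $$ (1, 1) = - X $$ (0, 0)"
  shows "flow (n + 1) (\<lambda>t. spin_rep n (g t)) (spin_deriv n X)"
  unfolding flow_def
proof (intro conjI allI impI)
  fix t k l assume "k < n + 1" and "l < n + 1"
  then have k: "k \<le> n" and l: "l \<le> n" by auto
  have X: "X \<in> carrier_mat 2 2" and gt: "g t \<in> carrier_mat 2 2" for t
    using g by (auto simp: flow_def)
  define P where "P = (\<lambda>s. [:g s $$ (0,0), g s $$ (1,0):])"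
  define Q where "Q = (\<lambda>s. [:g s $$ (0,1), g s $$ (1,1):])"
  have gX: "(g t * X) $$ (i, j) = g t $$ (i, 0) * X $$ (0, j) + g t $$ (i, 1) * X $$ (1, j)" if "i < 2" "j < 2" for i j
    using X gt[of t] that by (auto simp: scalar_prod_def eval_nat_numeral)
  have der: "((\<lambda>s. g s $$ (i, j)) has_vector_derivative g t $$ (i, 0) * X $$ (0, j) + g t $$ (i, 1) * X $$ (1, j)) (at t)"
    if "i < 2" "j < 2" for i j
    unfolding gX[OF that, symmetric] using g that by (auto simp: flow_def)
  have P': "coeff_deriv P (smult (X $$ (0,0)) (P t) + smult (X $$ (1,0)) (Q t)) t"
    unfolding coeff_deriv_def P_def Q_def using der[of 0 0] der[of 1 0]
    by (auto simp: coeff_pCons mult.commute split: nat.split)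
  have Q': "coeff_deriv Q (smult (X $$ (0,1)) (P t) + smult (X $$ (1,1)) (Q t)) t"
    unfolding coeff_deriv_def P_def Q_def using der[of 0 1] der[of 1 1]
    by (auto simp: coeff_pCons mult.commute split: nat.split)
  define F where "F = (\<lambda>l. P t ^ (n - l) * Q t ^ l)"
  let ?D = "smult (of_nat (n - l) * X $$ (1,0)) (F (Suc l)) + smult (of_nat l * X $$ (0,1)) (F (l - 1))
      + smult ((of_nat n - 2 * of_nat l) * X $$ (0,0)) (F l)"
  \<comment> \<open>The factors \<open>of_nat (n - l)\<close> and \<open>of_nat l\<close> keep these
    three identities true at exponent 0, where truncated subtraction would spoil them.\<close>
  have a: "of_nat (n - l) * P t ^ (n - l - 1) * P t = of_nat (n - l) * P t ^ (n - l)"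
    by (cases "n - l") (simp_all add: algebra_simps)
  have b: "of_nat l * Q t ^ (l - 1) * Q t = of_nat l * Q t ^ l"
    by (cases l) (simp_all add: algebra_simps)
  have c: "of_nat l * P t ^ (n - (l - 1)) = of_nat l * (P t ^ (n - l) * P t)"
  proof (cases "l = 0")
    case False
    with l have "n - (l - 1) = Suc (n - l)" by simp
    then show ?thesis by (simp only: power_Suc2)
  qed simp
  have sm: "smult (of_nat m * z) p = of_nat m * smult z p" for m z and p :: "complex poly"
    by (simp add: of_nat_poly mult.commute)
  have "(of_nat (n - l) * (smult (X $$ (0,0)) (P t) + smult (X $$ (1,0)) (Q t)) * P t ^ (n - l - 1)) * Q t ^ l
      + P t ^ (n - l) * (of_nat l * (smult (X $$ (0,1)) (P t) + smult (X $$ (1,1)) (Q t)) * Q t ^ (l - 1))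
    = smult (X $$ (0,0)) ((of_nat (n - l) * P t ^ (n - l - 1) * P t) * Q t ^ l)
      + smult (X $$ (1,0)) (of_nat (n - l) * P t ^ (n - l - 1) * Q t ^ Suc l)
      + smult (X $$ (0,1)) ((of_nat l * (P t ^ (n - l) * P t)) * Q t ^ (l - 1))
      + smult (X $$ (1,1)) ((of_nat l * Q t ^ (l - 1) * Q t) * P t ^ (n - l))"
    by (simp add: algebra_simps smult_add_right)
  also have "\<dots> = smult (X $$ (0,0)) (of_nat (n - l) * F l) + smult (X $$ (1,0)) (of_nat (n - l) * F (Suc l))
      + smult (X $$ (0,1)) (of_nat l * F (l - 1)) + smult (- X $$ (0,0)) (of_nat l * F l)"
    unfolding a b c[symmetric] traceless F_def by (simp add: mult_ac)
  also have "\<dots> = smult (of_nat (n - l) * X $$ (0,0)) (F l) + smult (of_nat (n - l) * X $$ (1,0)) (F (Suc l))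
      + smult (of_nat l * X $$ (0,1)) (F (l - 1)) + smult (of_nat l * - X $$ (0,0)) (F l)"
    by (simp add: sm)
  also have "\<dots> = ?D"
  proof -
    have "(of_nat n - 2 * of_nat l) * X $$ (0,0) = of_nat (n - l) * X $$ (0,0) + of_nat l * - X $$ (0,0)"
      using l by (simp add: of_nat_diff algebra_simps)
    then show ?thesis
      by (simp only: smult_add_left add_ac)
  qed
  finally have "coeff_deriv (\<lambda>s. P s ^ (n - l) * Q s ^ l) ?D t"
    using coeff_deriv_mult[OF coeff_deriv_power[OF P'] coeff_deriv_power[OF Q'], of "n - l" l] by simp
  then have "((\<lambda>s. coeff (P s ^ (n - l) * Q s ^ l) k) has_vector_derivative coeff ?D k) (at t)"
    by (simp add: coeff_deriv_def)
  then have d: "((\<lambda>s. spin_rep n (g s) $$ (k, l)) has_vector_derivative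
      complex_of_real (sqrt (real (n choose l) / real (n choose k))) * coeff ?D k) (at t)"
    using k l unfolding P_def Q_def spin_rep_def
    by (simp add: has_vector_derivative_mult_right)
  let ?u = "\<lambda>j. complex_of_real (sqrt (real (n choose j) / real (n choose k))) * coeff (F j) k"
  have u: "spin_rep n (g t) $$ (k, j) = ?u j" if "j < n + 1" for j
    using k that by (simp add: spin_rep_def F_def P_def Q_def)
  have "(spin_rep n (g t) * spin_deriv n X) $$ (k, l) = (\<Sum>j<n + 1. ?u j * spin_deriv n X $$ (j, l))"
    using k l u spin_deriv_carrier[of n X] by (auto simp: scalar_prod_def atLeast0LessThan spin_rep_def F_def P_def Q_def
      intro!: sum.cong)
  also have "\<dots> = (\<Sum>j<n + 1. X $$ (0,1) * (?u j * raise n $$ (j, l)) + X $$ (1,0) * (?u j * lower n $$ (j, l))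
      + X $$ (0,0) * (?u j * weight n $$ (j, l)))"
    using l by (intro sum.cong) (auto simp: spin_deriv_def algebra_simps)
  also have "\<dots> = X $$ (0,1) * (?u (l - 1) * ladder_coeff n l) + X $$ (1,0) * (?u (Suc l) * ladder_coeff n (Suc l))
      + X $$ (0,0) * (?u l * (of_nat n - 2 * of_nat l))"
    unfolding sum.distrib sum_distrib_left[symmetric]
    using sum_mult_raise[OF l, of ?u] sum_mult_lower[OF l, of ?u] sum_mult_weight[OF l, of ?u] by simp
  also have "\<dots> = complex_of_real (sqrt (real (n choose l) / real (n choose k))) * coeff ?D k"
  proof -
    have 1: "?u (l - 1) * ladder_coeff n l = of_nat l * complex_of_real (sqrt (real (n choose l) / real (n choose k))) * coeff (F (l - 1)) k"
      using arg_cong[OF ladder_coeff_binomial(1)[OF l, of "real (n choose k)"], of complex_of_real]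
      unfolding ladder_coeff_def of_real_mult by (simp only: of_real_of_nat_eq mult_ac) 
    have 2: "?u (Suc l) * ladder_coeff n (Suc l) = of_nat (n - l) * complex_of_real (sqrt (real (n choose l) / real (n choose k))) * coeff (F (Suc l)) k"
      using arg_cong[OF ladder_coeff_binomial(2)[OF l, of "real (n choose k)"], of complex_of_real]
      unfolding ladder_coeff_def of_real_mult by (simp only: of_real_of_nat_eq mult_ac)
    show ?thesis
      unfolding 1 2 by (simp add: algebra_simps)
  qed
  finally show "((\<lambda>s. spin_rep n (g s) $$ (k, l)) has_vector_derivative (spin_rep n (g t) * spin_deriv n X) $$ (k, l)) (at t)"
    using d by simp
qed (use g in \<open>auto simp: flow_def spin_rep_one spin_deriv_def, auto simp: spin_rep_def\<close>)

text \<open>The product rule; the mixed product rule for Kronecker products collects both summands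
  into U t times V t, applied to the sum of the generators.\<close>

lemma flow_kron:
  assumes U: "flow p U X" and V: "flow q V Y"
  shows "flow (p * q) (\<lambda>t. U t \<otimes>\<^sub>m V t) (X \<otimes>\<^sub>m 1\<^sub>m q + 1\<^sub>m p \<otimes>\<^sub>m Y)"
  unfolding flow_def
proof (intro conjI allI impI)
  have X: "X \<in> carrier_mat p p" and Y: "Y \<in> carrier_mat q q"
    and Ut: "U t \<in> carrier_mat p p" and Vt: "V t \<in> carrier_mat q q" for t
    using U V by (auto simp: flow_def)
  show "X \<otimes>\<^sub>m 1\<^sub>m q + 1\<^sub>m p \<otimes>\<^sub>m Y \<in> carrier_mat (p * q) (p * q)"
    using X Y by auto
  show "U 0 \<otimes>\<^sub>m V 0 = 1\<^sub>m (p * q)"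
    using U V by (simp add: flow_def kron_one)
  show "U t \<otimes>\<^sub>m V t \<in> carrier_mat (p * q) (p * q)" for t
    using Ut Vt by auto
  fix t i j assume i: "i < p * q" and j: "j < p * q"
  note lt = div_less_factor[OF i] mod_less_factor[OF i] div_less_factor[OF j] mod_less_factor[OF j]
  have "(U t \<otimes>\<^sub>m V t) * (X \<otimes>\<^sub>m 1\<^sub>m q + 1\<^sub>m p \<otimes>\<^sub>m Y) =
      (U t \<otimes>\<^sub>m V t) * (X \<otimes>\<^sub>m 1\<^sub>m q) + (U t \<otimes>\<^sub>m V t) * (1\<^sub>m p \<otimes>\<^sub>m Y)"
    using X Y Ut Vt by (intro mult_add_distrib_mat[of _ "p * q" "p * q" _ "p * q"]) auto
  also have "\<dots> = (U t * X) \<otimes>\<^sub>m V t + U t \<otimes>\<^sub>m (V t * Y)"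
    using X Y Ut[of t] Vt[of t] by (simp add: kron_mult)
  finally have eq: "((U t \<otimes>\<^sub>m V t) * (X \<otimes>\<^sub>m 1\<^sub>m q + 1\<^sub>m p \<otimes>\<^sub>m Y)) $$ (i, j) =
      U t $$ (i div q, j div q) * (V t * Y) $$ (i mod q, j mod q) +
      (U t * X) $$ (i div q, j div q) * V t $$ (i mod q, j mod q)"
    using X Y Ut[of t] Vt[of t] i j by (simp add: index_kron del: index_mult_mat(1))
  have "((\<lambda>s. U s $$ (i div q, j div q) * V s $$ (i mod q, j mod q)) has_vector_derivative
      U t $$ (i div q, j div q) * (V t * Y) $$ (i mod q, j mod q) +
      (U t * X) $$ (i div q, j div q) * V t $$ (i mod q, j mod q)) (at t)"
    using U V lt by (intro has_vector_derivative_mult) (auto simp: flow_def simp del: index_mult_mat(1))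
  moreover have "(U s \<otimes>\<^sub>m V s) $$ (i, j) = U s $$ (i div q, j div q) * V s $$ (i mod q, j mod q)" for s
    using Ut[of s] Vt[of s] i j by (simp add: index_kron)
  ultimately show "((\<lambda>s. (U s \<otimes>\<^sub>m V s) $$ (i, j)) has_vector_derivative
      ((U t \<otimes>\<^sub>m V t) * (X \<otimes>\<^sub>m 1\<^sub>m q + 1\<^sub>m p \<otimes>\<^sub>m Y)) $$ (i, j)) (at t)"
    unfolding eq by simp
qed

lemma flow_vec_derivative:
  assumes "flow p U X" "v \<in> carrier_vec p" "i < p"
  shows "((\<lambda>s. (U s *\<^sub>v v) $ i) has_vector_derivative (U t *\<^sub>v (X *\<^sub>v v)) $ i) (at t)"
proof -
  have X: "X \<in> carrier_mat p p" and Ut: "U t \<in> carrier_mat p p" for t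
    using assms by (auto simp: flow_def)
  have entry: "(M *\<^sub>v v) $ i = (\<Sum>j<p. M $$ (i, j) * v $ j)" if "M \<in> carrier_mat p p" for M
    using assms that by (auto simp: scalar_prod_def atLeast0LessThan)
  have "((\<lambda>s. \<Sum>j<p. U s $$ (i, j) * v $ j) has_vector_derivative (\<Sum>j<p. (U t * X) $$ (i, j) * v $ j)) (at t)"
    using assms by (intro has_vector_derivative_sum has_vector_derivative_mult_left)
      (auto simp: flow_def simp del: index_mult_mat(1))
  moreover have "(U t *\<^sub>v (X *\<^sub>v v)) = (U t * X) *\<^sub>v v"
    using assms X Ut[of t] by (simp add: assoc_mult_mat_vec[of _ p p _ p])
  moreover have "U t * X \<in> carrier_mat p p"
    using X Ut[of t] by auto
  ultimately show ?thesis
    by (simp add: entry Ut del: index_mult_mat(1) index_mult_mat_vec)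
qed

text \<open>The derivative of U v is U X v, which is zero at every time, so each coordinate keeps
  its value at 0.\<close>

lemma flow_fixes:
  assumes U: "flow p U X" and v: "v \<in> carrier_vec p" and "X *\<^sub>v v = 0\<^sub>v p"
  shows "U t *\<^sub>v v = v"
proof (rule eq_vecI)
  have Ut: "U t \<in> carrier_mat p p" for t
    using U by (auto simp: flow_def)
  fix i assume "i < dim_vec v"
  with v have i: "i < p" by auto
  have "U t *\<^sub>v 0\<^sub>v p = 0\<^sub>v p" for t
    using Ut[of t] by auto
  with flow_vec_derivative[OF U v i] assms(3) i
  have "((\<lambda>s. (U s *\<^sub>v v) $ i) has_vector_derivative 0) (at t within UNIV)" for t
    by simp
  then obtain c where c: "\<And>s. (U s *\<^sub>v v) $ i = c"
    using has_vector_derivative_zero_constant[of UNIV "\<lambda>s. (U s *\<^sub>v v) $ i"] by auto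
  have "(U 0 *\<^sub>v v) $ i = v $ i"
    using U v by (auto simp: flow_def)
  with c show "(U t *\<^sub>v v) $ i = v $ i"
    by metis
qed (use assms in \<open>auto simp: flow_def\<close>)

lemma flow_generator:
  assumes U: "flow p U X" and v: "v \<in> carrier_vec p" and fixed: "\<And>t. U t *\<^sub>v v = v"
  shows "X *\<^sub>v v = 0\<^sub>v p"
proof (rule eq_vecI)
  have X: "X \<in> carrier_mat p p"
    using U by (auto simp: flow_def)
  fix i assume "i < dim_vec (0\<^sub>v p :: complex Matrix.vec)"
  then have i: "i < p" by auto
  have "((\<lambda>s. v $ i) has_vector_derivative (1\<^sub>m p *\<^sub>v (X *\<^sub>v v)) $ i) (at 0)"
    using flow_vec_derivative[OF U v i, of 0] U unfolding fixed flow_def by simp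
  moreover have "((\<lambda>s. v $ i) has_vector_derivative 0) (at (0::real))"
    by (rule has_vector_derivative_const)
  ultimately have "(1\<^sub>m p *\<^sub>v (X *\<^sub>v v)) $ i = 0"
    by (rule vector_derivative_unique_at)
  then show "(X *\<^sub>v v) $ i = 0\<^sub>v p $ i"
    using X v i by simp
qed (use assms in \<open>auto simp: flow_def\<close>)

text \<open>This is exp (t Z / 2) when \<open>Z\<close> squares to -1; it extends \<open>rot\<close>
  to arbitrary axes.\<close>

definition su2_path :: "complex mat \<Rightarrow> real \<Rightarrow> complex mat" where
  "su2_path Z t = complex_of_real (cos (t / 2)) \<cdot>\<^sub>m 1\<^sub>m 2 + complex_of_real (sin (t / 2)) \<cdot>\<^sub>m Z"

lemma flow_su2_path:
  assumes Z: "Z \<in> carrier_mat 2 2" and sq: "Z * Z = - 1\<^sub>m 2"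
  shows "flow 2 (su2_path Z) ((1 / 2) \<cdot>\<^sub>m Z)"
  unfolding flow_def
proof (intro conjI allI impI)
  fix t :: real and i j :: nat assume ij: "i < 2" "j < 2"
  have "(su2_path Z t * ((1 / 2) \<cdot>\<^sub>m Z)) $$ (i, j) =
      complex_of_real (cos (t / 2) / 2) * Z $$ (i, j) + complex_of_real (sin (t / 2) / 2) * (Z * Z) $$ (i, j)"
    using Z ij less_2_cases[OF ij(1)] less_2_cases[OF ij(2)]
    by (auto simp: su2_path_def scalar_prod_def numeral_2_eq_2 algebra_simps)
  then have "(su2_path Z t * ((1 / 2) \<cdot>\<^sub>m Z)) $$ (i, j) =
      complex_of_real (cos (t / 2) / 2) * Z $$ (i, j) + complex_of_real (- (sin (t / 2) / 2)) * 1\<^sub>m 2 $$ (i, j)"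
    unfolding sq using Z ij by simp
  moreover have "((\<lambda>s. complex_of_real (cos (s / 2)) * 1\<^sub>m 2 $$ (i, j) + complex_of_real (sin (s / 2)) * Z $$ (i, j))
      has_vector_derivative complex_of_real (- (sin (t / 2) / 2)) * 1\<^sub>m 2 $$ (i, j) + complex_of_real (cos (t / 2) / 2) * Z $$ (i, j)) (at t)"
    by (intro has_vector_derivative_add has_vector_derivative_mult_left has_vector_derivative_of_real)
      (auto intro!: derivative_eq_intros simp: has_real_derivative_iff_has_vector_derivative[symmetric])
  ultimately show "((\<lambda>s. su2_path Z s $$ (i, j)) has_vector_derivative (su2_path Z t * ((1 / 2) \<cdot>\<^sub>m Z)) $$ (i, j)) (at t)"
    using ij Z by (simp add: su2_path_def add.commute del: index_mult_mat(1))
qed (use Z in \<open>auto simp: su2_path_def\<close>)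

section \<open>Generators of the spin representations\<close>

lemma pauli_dim [simp]: "dim_row (pauli i) = 2" "dim_col (pauli i) = 2"
  by (simp_all add: pauli_def mat_of_rows_list_def)

lemma pauli_carrier [simp]: "pauli i \<in> carrier_mat 2 2"
  by (rule carrier_matI) simp_all

lemma index_pauli:
  "pauli i $$ (0, 0) = (if i = 1 \<or> i = 2 then 0 else 1)"
  "pauli i $$ (0, 1) = (if i = 1 then 1 else if i = 2 then - \<i> else 0)"
  "pauli i $$ (1, 0) = (if i = 1 then 1 else if i = 2 then \<i> else 0)"
  "pauli i $$ (1, 1) = (if i = 1 \<or> i = 2 then 0 else - 1)"
  by (simp_all add: pauli_def mat_of_rows_list_def)

lemma index_mult_2:
  fixes A B :: "complex mat"
  assumes "A \<in> carrier_mat 2 2" "B \<in> carrier_mat 2 2" "i < 2" "j < 2"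
  shows "(A * B) $$ (i, j) = A $$ (i, 0) * B $$ (0, j) + A $$ (i, 1) * B $$ (1, j)"
  using assms by (auto simp: scalar_prod_def numeral_2_eq_2)

lemma eq_mat_2I:
  fixes A B :: "complex mat"
  assumes "A \<in> carrier_mat 2 2" "B \<in> carrier_mat 2 2"
    "A $$ (0, 0) = B $$ (0, 0)" "A $$ (0, 1) = B $$ (0, 1)" "A $$ (1, 0) = B $$ (1, 0)" "A $$ (1, 1) = B $$ (1, 1)"
  shows "A = B"
  by (rule eq_matI) (use assms in \<open>auto dest!: less_2_cases\<close>)

lemma rot_eq_path: "rot i = su2_path (- \<i> \<cdot>\<^sub>m pauli i)"
  by (rule ext, rule eq_mat_2I) (auto simp: rot_def su2_path_def)

lemma pauli_path_square: "(- \<i> \<cdot>\<^sub>m pauli i) * (- \<i> \<cdot>\<^sub>m pauli i) = - 1\<^sub>m 2"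
  by (rule eq_mat_2I) (auto simp: index_mult_2 index_pauli simp del: index_mult_mat(1) One_nat_def)

lemma flow_rot: "flow 2 (rot i) ((1 / 2) \<cdot>\<^sub>m (- \<i> \<cdot>\<^sub>m pauli i))"
  unfolding rot_eq_path by (rule flow_su2_path) (auto intro: pauli_path_square)

lemma spin_op_eq: "spin_op n i = \<i> \<cdot>\<^sub>m spin_deriv n ((1 / 2) \<cdot>\<^sub>m (- \<i> \<cdot>\<^sub>m pauli i))" (is "_ = \<i> \<cdot>\<^sub>m ?D")
proof (rule eq_matI)
  have fl: "flow (n + 1) (\<lambda>t. spin_rep n (rot i t)) ?D"
    by (rule flow_spin_rep[OF flow_rot]) (simp add: index_pauli flip: One_nat_def)
  fix k l assume "k < dim_row (\<i> \<cdot>\<^sub>m ?D)" "l < dim_col (\<i> \<cdot>\<^sub>m ?D)"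
  then have kl: "k < n + 1" "l < n + 1"
    using spin_deriv_carrier[of n "(1 / 2) \<cdot>\<^sub>m (- \<i> \<cdot>\<^sub>m pauli i)"] by auto
  have "spin_rep n (rot i 0) * ?D = ?D"
    using fl left_mult_one_mat[OF spin_deriv_carrier] unfolding flow_def by metis
  moreover have "((\<lambda>t. spin_rep n (rot i t) $$ (k, l)) has_vector_derivative (spin_rep n (rot i 0) * ?D) $$ (k, l)) (at 0)"
    using fl kl unfolding flow_def by blast
  ultimately have "((\<lambda>t. spin_rep n (rot i t) $$ (k, l)) has_vector_derivative ?D $$ (k, l)) (at 0)"
    by (simp only:)
  then show "spin_op n i $$ (k, l) = (\<i> \<cdot>\<^sub>m ?D) $$ (k, l)"
    using kl spin_deriv_carrier[of n "(1 / 2) \<cdot>\<^sub>m (- \<i> \<cdot>\<^sub>m pauli i)"]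
    by (simp add: spin_op_def vector_derivative_at)
qed (auto simp: spin_op_def spin_deriv_def)

lemma spin_op_ladder:
  "spin_op n 1 = (1 / 2) \<cdot>\<^sub>m (raise n + lower n)"
  "spin_op n 2 = (- \<i> / 2) \<cdot>\<^sub>m (raise n - lower n)"
  "spin_op n 3 = (1 / 2) \<cdot>\<^sub>m weight n"
proof -
  have idx: "((1 / 2) \<cdot>\<^sub>m (- \<i> \<cdot>\<^sub>m pauli i)) $$ (k, l) = - \<i> / 2 * pauli i $$ (k, l)" if "k < 2" "l < 2" for i k l
    using that by simp
  have lt: "(0::nat) < 2" "(1::nat) < 2" by auto
  have eq: "spin_op n i = \<i> \<cdot>\<^sub>m ((- \<i> / 2 * pauli i $$ (0, 1)) \<cdot>\<^sub>m raise n
      + (- \<i> / 2 * pauli i $$ (1, 0)) \<cdot>\<^sub>m lower n + (- \<i> / 2 * pauli i $$ (0, 0)) \<cdot>\<^sub>m weight n)" for i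
    unfolding spin_op_eq spin_deriv_def idx[OF lt(1,2)] idx[OF lt(2,1)] idx[OF lt(1,1)] by (rule refl)
  show "spin_op n 1 = (1 / 2) \<cdot>\<^sub>m (raise n + lower n)" "spin_op n 2 = (- \<i> / 2) \<cdot>\<^sub>m (raise n - lower n)"
    "spin_op n 3 = (1 / 2) \<cdot>\<^sub>m weight n"
    unfolding eq index_pauli by (rule eq_matI; simp add: algebra_simps)+
qed

section \<open>Invariance under the group and under its Lie algebra\<close>

definition total_op :: "nat \<Rightarrow> nat \<Rightarrow> nat \<Rightarrow> (nat \<Rightarrow> complex mat) \<Rightarrow> complex mat" where
  "total_op nu nd nr f = up_leg nu nd nr (f nu) + down_leg nu nd nr (f nd) + tan_leg nu nd nr (f nr) + spin_leg nu nd nr (f 1)"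

lemma flow_total:
  assumes "flow 2 g X" and "X $$ (1, 1) = - X $$ (0, 0)"
  shows "flow (state_dim nu nd nr)
    (\<lambda>t. spin_rep nu (g t) \<otimes>\<^sub>m spin_rep nd (g t) \<otimes>\<^sub>m spin_rep nr (g t) \<otimes>\<^sub>m spin_rep 1 (g t))
    (total_op nu nd nr (\<lambda>n. spin_deriv n X))"
proof -
  note sp = flow_spin_rep[OF assms]
  let ?d = "\<lambda>n. spin_deriv n X"
  have c: "dim_row (?d n) = n + 1" "dim_col (?d n) = n + 1" for n
    using spin_deriv_carrier[of n X] by auto
  have one: "1\<^sub>m ((nu + 1) * (nd + 1)) = (1\<^sub>m (nu + 1) \<otimes>\<^sub>m 1\<^sub>m (nd + 1) :: complex mat)"
    "1\<^sub>m ((nu + 1) * (nd + 1) * (nr + 1)) = (1\<^sub>m (nu + 1) \<otimes>\<^sub>m 1\<^sub>m (nd + 1) \<otimes>\<^sub>m 1\<^sub>m (nr + 1) :: complex mat)"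
    unfolding kron_one by (rule refl)+
  have "((?d nu \<otimes>\<^sub>m 1\<^sub>m (nd + 1) + 1\<^sub>m (nu + 1) \<otimes>\<^sub>m ?d nd) \<otimes>\<^sub>m 1\<^sub>m (nr + 1)
      + 1\<^sub>m ((nu + 1) * (nd + 1)) \<otimes>\<^sub>m ?d nr) \<otimes>\<^sub>m 1\<^sub>m 2 + 1\<^sub>m ((nu + 1) * (nd + 1) * (nr + 1)) \<otimes>\<^sub>m ?d 1
    = total_op nu nd nr ?d"
    unfolding total_op_def leg_defs one
    by (simp add: kron_add_left c del: mult_Suc mult_Suc_right)
  then show ?thesis
    using flow_kron[OF flow_kron[OF flow_kron[OF sp[of nu] sp[of nd]] sp[of nr]] sp[of 1, unfolded one_add_one]]
    unfolding state_dim_def by (simp only:)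
qed

lemma total_carrier:
  assumes "\<And>n. f n \<in> carrier_mat (n + 1) (n + 1)"
  shows "total_op nu nd nr f \<in> carrier_mat (state_dim nu nd nr) (state_dim nu nd nr)"
  unfolding total_op_def
  using assms[of nu] assms[of nd] assms[of nr] assms[of 1]
  by (intro add_carrier_mat leg.leg_carrier[OF leg_up] leg.leg_carrier[OF leg_down] leg.leg_carrier[OF leg_tan]
    leg.leg_carrier[OF leg_spin]) auto

lemma total_spin_deriv:
  "total_op nu nd nr (\<lambda>n. spin_deriv n X) = X $$ (0, 1) \<cdot>\<^sub>m total_op nu nd nr raise
    + X $$ (1, 0) \<cdot>\<^sub>m total_op nu nd nr lower + X $$ (0, 0) \<cdot>\<^sub>m total_op nu nd nr weight"
proof -
  have lin: "f (spin_deriv n X) = X $$ (0, 1) \<cdot>\<^sub>m f (raise n) + X $$ (1, 0) \<cdot>\<^sub>m f (lower n) + X $$ (0, 0) \<cdot>\<^sub>m f (weight n)"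
    and car: "f (raise n) \<in> carrier_mat N N" "f (lower n) \<in> carrier_mat N N" "f (weight n) \<in> carrier_mat N N"
    if f: "leg N (n + 1) f" for f N n
  proof -
    note c = smult_carrier_mat[OF ladder_carrier(1)] smult_carrier_mat[OF ladder_carrier(2)] smult_carrier_mat[OF ladder_carrier(3)]
    show "f (spin_deriv n X) = X $$ (0, 1) \<cdot>\<^sub>m f (raise n) + X $$ (1, 0) \<cdot>\<^sub>m f (lower n) + X $$ (0, 0) \<cdot>\<^sub>m f (weight n)"
      unfolding spin_deriv_def
      by (simp only: leg.leg_add[OF f add_carrier_mat[OF c(2)] c(3)] leg.leg_add[OF f c(1) c(2)] leg.leg_smult[OF f])
    show "f (raise n) \<in> carrier_mat N N" "f (lower n) \<in> carrier_mat N N" "f (weight n) \<in> carrier_mat N N"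
      by (rule leg.leg_carrier[OF f ladder_carrier(1)] leg.leg_carrier[OF f ladder_carrier(2)] leg.leg_carrier[OF f ladder_carrier(3)])+
  qed
  have spin: "leg (state_dim nu nd nr) (1 + 1) (spin_leg nu nd nr)"
    using leg_spin by (simp add: numeral_2_eq_2)
  note legs = leg_up[of nu nd nr] leg_down[of nu nd nr] leg_tan[of nu nd nr] spin
  let ?N = "state_dim nu nd nr"
  have regroup: "(x \<cdot>\<^sub>m A1 + y \<cdot>\<^sub>m B1 + z \<cdot>\<^sub>m C1) + (x \<cdot>\<^sub>m A2 + y \<cdot>\<^sub>m B2 + z \<cdot>\<^sub>m C2)
    = x \<cdot>\<^sub>m (A1 + A2) + y \<cdot>\<^sub>m (B1 + B2) + z \<cdot>\<^sub>m (C1 + C2)"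
    if "A1 \<in> carrier_mat ?N ?N" "A2 \<in> carrier_mat ?N ?N" "B1 \<in> carrier_mat ?N ?N" "B2 \<in> carrier_mat ?N ?N"
      "C1 \<in> carrier_mat ?N ?N" "C2 \<in> carrier_mat ?N ?N"
    for A1 A2 B1 B2 C1 C2 :: "complex mat" and x y z
  proof (rule eq_matI)
    fix i j assume "i < dim_row (x \<cdot>\<^sub>m (A1 + A2) + y \<cdot>\<^sub>m (B1 + B2) + z \<cdot>\<^sub>m (C1 + C2))"
      "j < dim_col (x \<cdot>\<^sub>m (A1 + A2) + y \<cdot>\<^sub>m (B1 + B2) + z \<cdot>\<^sub>m (C1 + C2))"
    with that have "i < ?N" "j < ?N" by auto
    with that show "((x \<cdot>\<^sub>m A1 + y \<cdot>\<^sub>m B1 + z \<cdot>\<^sub>m C1) + (x \<cdot>\<^sub>m A2 + y \<cdot>\<^sub>m B2 + z \<cdot>\<^sub>m C2)) $$ (i, j)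
      = (x \<cdot>\<^sub>m (A1 + A2) + y \<cdot>\<^sub>m (B1 + B2) + z \<cdot>\<^sub>m (C1 + C2)) $$ (i, j)"
      by (simp add: distrib_left)
  qed (use that in auto)
  note u = car[OF legs(1)] and d = car[OF legs(2)] and t = car[OF legs(3)] and s = car[OF legs(4)]
  show ?thesis
    unfolding total_op_def lin[OF legs(1)] lin[OF legs(2)] lin[OF legs(3)] lin[OF legs(4)]
    using u d t s by (simp only: regroup add_carrier_mat)
qed

lemma det_mat_2:
  fixes A :: "complex mat"
  assumes "A \<in> carrier_mat 2 2"
  shows "det A = A $$ (0, 0) * A $$ (1, 1) - A $$ (0, 1) * A $$ (1, 0)"
  using assms by (subst laplace_expansion_row[of A 2 0])
    (auto simp: cofactor_def mat_delete_def det_single numeral_2_eq_2)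

lemma SU2_entries:
  assumes g: "g \<in> SU2"
  shows "g \<in> carrier_mat 2 2" "g $$ (1, 1) = cnj (g $$ (0, 0))" "g $$ (0, 1) = - cnj (g $$ (1, 0))"
    "(Re (g $$ (0, 0)))\<^sup>2 + (Im (g $$ (0, 0)))\<^sup>2 + (cmod (g $$ (1, 0)))\<^sup>2 = 1"
proof -
  define a b c d where abcd: "a = g $$ (0, 0)" "b = g $$ (0, 1)" "c = g $$ (1, 0)" "d = g $$ (1, 1)"
  show car: "g \<in> carrier_mat 2 2" using g by (simp add: SU2_def)
  have unit: "mat_adjoint g * g = 1\<^sub>m 2" and det: "a * d - b * c = 1"
    using g car by (auto simp: SU2_def det_mat_2 abcd)
  have entry: "(mat_adjoint g * g) $$ (i, j) = cnj (g $$ (0, i)) * g $$ (0, j) + cnj (g $$ (1, i)) * g $$ (1, j)"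
    if "i < 2" "j < 2" for i j
    using car that by (subst index_mult_2) (auto simp: index_mat_adjoint conjugate_complex_def)
  have 00: "cnj a * a + cnj c * c = 1" and 01: "cnj a * b + cnj c * d = 0"
    using entry[of 0 0] entry[of 0 1] unfolding unit abcd by auto
  \<comment> \<open>Multiplying by the squared length 1 of the first column and regrouping brings in
    the determinant and the orthogonality of the columns, which solves for d; b is found in the same
    way.\<close>
  have "d = (cnj a * a + cnj c * c) * d" using 00 by simp
  also have "\<dots> = cnj a * (a * d - b * c) + c * (cnj a * b + cnj c * d)" by (simp add: algebra_simps)
  finally have d: "d = cnj a" unfolding det 01 by simp
  have "b = (cnj a * a + cnj c * c) * b" using 00 by simp
  also have "\<dots> = a * (cnj a * b + cnj c * d) - cnj c * (a * d - b * c)" by (simp add: algebra_simps)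
  finally have b: "b = - cnj c" unfolding det 01 by simp
  show "g $$ (1, 1) = cnj (g $$ (0, 0))" "g $$ (0, 1) = - cnj (g $$ (1, 0))"
    using d b by (simp_all add: abcd)
  have "complex_of_real ((cmod a)\<^sup>2 + (cmod c)\<^sup>2) = 1"
    using 00 by (simp only: of_real_add complex_norm_square mult.commute)
  then have "(cmod a)\<^sup>2 + (cmod c)\<^sup>2 = 1"
    using of_real_eq_1_iff by blast
  then show "(Re (g $$ (0, 0)))\<^sup>2 + (Im (g $$ (0, 0)))\<^sup>2 + (cmod (g $$ (1, 0)))\<^sup>2 = 1"
    by (simp add: cmod_power2 abcd)
qed

text \<open>Every element has the form cos theta + sin theta Z, where cos theta is the real part of
  its diagonal entries and Z its normalised traceless part. This reduces invariance under the whole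
  group to the flows.\<close>

lemma SU2_path:
  assumes g: "g \<in> SU2"
  obtains Z t where "Z \<in> carrier_mat 2 2" "Z * Z = - 1\<^sub>m 2" "Z $$ (1, 1) = - Z $$ (0, 0)" "g = su2_path Z t"
proof -
  note e = SU2_entries[OF g]
  define a c where "a = g $$ (0, 0)" and "c = g $$ (1, 0)"
  have sum: "(Re a)\<^sup>2 + (Im a)\<^sup>2 + (cmod c)\<^sup>2 = 1"
    using e(4) by (simp add: a_def c_def)
  have "(Re a)\<^sup>2 \<le> 1" using sum by (smt (verit) zero_le_power2)
  then have le: "\<bar>Re a\<bar> \<le> 1" by (simp add: abs_square_le_1)
  define s where "s = sin (arccos (Re a))"
  have cos: "cos (arccos (Re a)) = Re a" using le by (simp add: cos_arccos_abs)
  have s2: "s\<^sup>2 = (Im a)\<^sup>2 + (cmod c)\<^sup>2"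
    using sum cos sin_cos_squared_add[of "arccos (Re a)"] by (simp add: s_def)
  show thesis
  \<comment> \<open>If the sine vanishes, g is plus or minus the identity and any axis serves; the
    third is taken. The parameter is twice the arc cosine because \<open>su2_path\<close> uses half
    angles.\<close>
  proof (cases "s = 0")
    case True
    then have "Im a = 0" "c = 0" using s2 by (auto simp: add_nonneg_eq_0_iff)
    then have a: "a = complex_of_real (Re a)" "cnj a = a" and c: "c = 0" by (auto simp: complex_eq_iff)
    show thesis
    proof (rule that[of "- \<i> \<cdot>\<^sub>m pauli 3" "2 * arccos (Re a)"])
      show "g = su2_path (- \<i> \<cdot>\<^sub>m pauli 3) (2 * arccos (Re a))"
        using e a c True cos by (intro eq_mat_2I) (auto simp: su2_path_def s_def a_def c_def)
    qed (use pauli_path_square[of 3] in \<open>auto simp: index_pauli simp del: One_nat_def\<close>)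
  next
    case False
    define Z where "Z = complex_of_real (1 / s) \<cdot>\<^sub>m (g - complex_of_real (Re a) \<cdot>\<^sub>m 1\<^sub>m 2)"
    have Zc: "Z \<in> carrier_mat 2 2" using e(1) by (auto simp: Z_def)
    have Z: "Z $$ (0, 0) = \<i> * complex_of_real (Im a / s)" "Z $$ (0, 1) = - cnj c / complex_of_real s"
      "Z $$ (1, 0) = c / complex_of_real s" "Z $$ (1, 1) = - (\<i> * complex_of_real (Im a / s))"
      using e(1) by (auto simp: Z_def e(2,3)[unfolded One_nat_def] a_def c_def complex_eq_iff)
    have "(complex_of_real (Im a / s))\<^sup>2 + c * cnj c / (complex_of_real s)\<^sup>2 = complex_of_real ((Im a)\<^sup>2 / s\<^sup>2 + (cmod c)\<^sup>2 / s\<^sup>2)"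
      by (simp add: complex_norm_square[symmetric] power_divide)
    also have "(Im a)\<^sup>2 / s\<^sup>2 + (cmod c)\<^sup>2 / s\<^sup>2 = 1"
      unfolding add_divide_distrib[symmetric] s2[symmetric] using False by simp
    finally have one: "(complex_of_real (Im a / s))\<^sup>2 + c * cnj c / (complex_of_real s)\<^sup>2 = 1" by simp
    show thesis
    proof (rule that[OF Zc, of "2 * arccos (Re a)"])
      show "Z * Z = - 1\<^sub>m 2"
      proof (rule eq_mat_2I)
        have "(Z * Z) $$ (0, 0) = - ((complex_of_real (Im a / s))\<^sup>2 + c * cnj c / (complex_of_real s)\<^sup>2)"
          "(Z * Z) $$ (1, 1) = - ((complex_of_real (Im a / s))\<^sup>2 + c * cnj c / (complex_of_real s)\<^sup>2)"
          using Zc by (simp_all add: index_mult_2 Z power2_eq_square algebra_simps del: index_mult_mat(1) of_real_divide One_nat_def)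
        then show "(Z * Z) $$ (0, 0) = (- 1\<^sub>m 2) $$ (0, 0)" "(Z * Z) $$ (1, 1) = (- 1\<^sub>m 2) $$ (1, 1)"
          unfolding one by simp_all
        show "(Z * Z) $$ (0, 1) = (- 1\<^sub>m 2) $$ (0, 1)" "(Z * Z) $$ (1, 0) = (- 1\<^sub>m 2) $$ (1, 0)"
          using Zc by (simp_all add: index_mult_2 Z del: index_mult_mat(1) One_nat_def)
      qed (use Zc in auto)
      show "Z $$ (1, 1) = - Z $$ (0, 0)" by (simp only: Z)
      have "complex_of_real s * complex_of_real (1 / s) = 1" using False by simp
      then have "complex_of_real s \<cdot>\<^sub>m Z = g - complex_of_real (Re a) \<cdot>\<^sub>m 1\<^sub>m 2"
        using e(1) by (intro eq_matI) (auto simp: Z_def mult.assoc[symmetric] simp del: of_real_divide)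
      then show "g = su2_path Z (2 * arccos (Re a))"
        using e(1) by (intro eq_matI) (auto simp: su2_path_def cos s_def[symmetric])
    qed
  qed
qed

lemma rot_SU2: "rot i t \<in> SU2"
proof -
  have car: "rot i t \<in> carrier_mat 2 2" "dim_row (rot i t) = 2" "dim_col (rot i t) = 2"
    by (simp_all add: rot_def)
  note adj = mat_adjoint_carrier[OF car(1)]
  have entries: "rot i t $$ (k, l) = complex_of_real (cos (t / 2)) * 1\<^sub>m 2 $$ (k, l) - \<i> * complex_of_real (sin (t / 2)) * pauli i $$ (k, l)"
    if "k < 2" "l < 2" for k l
    using that by (simp add: rot_def)
  have one: "complex_of_real (cos (t / 2)) * complex_of_real (cos (t / 2)) + complex_of_real (sin (t / 2)) * complex_of_real (sin (t / 2)) = 1"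
    unfolding of_real_mult[symmetric] of_real_add[symmetric] using sin_cos_squared_add2[of "t / 2"] by simp
  have "mat_adjoint (rot i t) * rot i t = 1\<^sub>m 2"
    using car adj one by (intro eq_mat_2I) (auto simp: index_mult_2 index_mat_adjoint entries index_pauli
        conjugate_complex_def algebra_simps simp del: index_mult_mat(1) One_nat_def)
  moreover have "det (rot i t) = 1"
    using car one by (subst det_mat_2) (auto simp: entries index_pauli algebra_simps simp del: One_nat_def)
  ultimately show ?thesis
    using car by (simp add: SU2_def)
qed

text \<open>Vectors killed by the total ladder operators are fixed because each group element lies
  on some \<open>su2_path\<close>. Conversely, the rotations about the three axes are differentiated
  at 0.\<close>

lemma intertwiners_eq:
  "intertwiners nu nd nr = {v \<in> carrier_vec (state_dim nu nd nr).
     total_op nu nd nr raise *\<^sub>v v = 0\<^sub>v (state_dim nu nd nr) \<and>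
     total_op nu nd nr lower *\<^sub>v v = 0\<^sub>v (state_dim nu nd nr) \<and>
     total_op nu nd nr weight *\<^sub>v v = 0\<^sub>v (state_dim nu nd nr)}" (is "_ = ?K")
proof -
  let ?N = "state_dim nu nd nr"
  let ?e = "total_op nu nd nr raise" and ?f = "total_op nu nd nr lower" and ?h = "total_op nu nd nr weight"
  have car: "?e \<in> carrier_mat ?N ?N" "?f \<in> carrier_mat ?N ?N" "?h \<in> carrier_mat ?N ?N"
    by (auto intro!: total_carrier simp del: One_nat_def)
  have act: "total_op nu nd nr (\<lambda>n. spin_deriv n X) *\<^sub>v v =
      X $$ (0, 1) \<cdot>\<^sub>v (?e *\<^sub>v v) + X $$ (1, 0) \<cdot>\<^sub>v (?f *\<^sub>v v) + X $$ (0, 0) \<cdot>\<^sub>v (?h *\<^sub>v v)"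
    if "v \<in> carrier_vec ?N" for X v
  proof -
    note sv = smult_mat_mult_vec[of _ ?N ?N, OF _ that]
    show ?thesis
      unfolding total_spin_deriv using car that
      by (simp add: add_mult_distrib_mat_vec[of _ ?N ?N] sv del: One_nat_def)
  qed
  show ?thesis
  proof (intro equalityI subsetI)
    fix v assume v: "v \<in> ?K"
    have "(spin_rep nu g \<otimes>\<^sub>m spin_rep nd g \<otimes>\<^sub>m spin_rep nr g \<otimes>\<^sub>m spin_rep 1 g) *\<^sub>v v = v" if g: "g \<in> SU2" for g
    proof -
      obtain Z t where Z: "Z \<in> carrier_mat 2 2" "Z * Z = - 1\<^sub>m 2" "Z $$ (1, 1) = - Z $$ (0, 0)" "g = su2_path Z t"
        using SU2_path[OF g] .
      have tr: "((1 / 2) \<cdot>\<^sub>m Z) $$ (1, 1) = - ((1 / 2) \<cdot>\<^sub>m Z) $$ (0, 0)" using Z by simp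
      show ?thesis
        unfolding Z(4)
      proof (rule flow_fixes[OF flow_total[OF flow_su2_path[OF Z(1,2)] tr]])
        show "total_op nu nd nr (\<lambda>n. spin_deriv n (1 / 2 \<cdot>\<^sub>m Z)) *\<^sub>v v = 0\<^sub>v ?N"
          using v by (simp add: act) (intro eq_vecI, auto)
      qed (use v in auto)
    qed
    with v show "v \<in> intertwiners nu nd nr"
      by (simp add: intertwiners_def)
  next
    fix v assume v: "v \<in> intertwiners nu nd nr"
    then have vN: "v \<in> carrier_vec ?N" by (simp add: intertwiners_def)
    have gen: "total_op nu nd nr (\<lambda>n. spin_deriv n ((1 / 2) \<cdot>\<^sub>m (- \<i> \<cdot>\<^sub>m pauli i))) *\<^sub>v v = 0\<^sub>v ?N" for i
    proof (rule flow_generator[OF flow_total[OF flow_rot] vN])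
      show "((1 / 2) \<cdot>\<^sub>m (- \<i> \<cdot>\<^sub>m pauli i)) $$ (1, 1) = - ((1 / 2) \<cdot>\<^sub>m (- \<i> \<cdot>\<^sub>m pauli i)) $$ (0, 0)"
        by (simp add: index_pauli del: One_nat_def)
      show "(spin_rep nu (rot i t) \<otimes>\<^sub>m spin_rep nd (rot i t) \<otimes>\<^sub>m spin_rep nr (rot i t) \<otimes>\<^sub>m spin_rep 1 (rot i t)) *\<^sub>v v = v" for t
        using v rot_SU2[of i t] by (simp add: intertwiners_def)
    qed
    have idx: "((1 / 2) \<cdot>\<^sub>m (- \<i> \<cdot>\<^sub>m pauli i)) $$ (k, l) = - \<i> / 2 * pauli i $$ (k, l)" if "k < 2" "l < 2" for i k l
      using that by simp
    have comp: "- \<i> / 2 * pauli i $$ (0, 1) * (?e *\<^sub>v v) $ k + - \<i> / 2 * pauli i $$ (1, 0) * (?f *\<^sub>v v) $ k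
        + - \<i> / 2 * pauli i $$ (0, 0) * (?h *\<^sub>v v) $ k = 0" if k: "k < ?N" for i k
      using arg_cong[OF gen[of i, unfolded act[OF vN]], of "\<lambda>u. u $ k"] k car
      by (simp add: idx del: One_nat_def index_mult_mat_vec index_smult_mat)
    \<comment> \<open>Axes 1, 2 and 3 give e + f = 0, e - f = 0 and h = 0, up to nonzero
      factors.\<close>
    have zero: "(?e *\<^sub>v v) $ k = 0 \<and> (?f *\<^sub>v v) $ k = 0 \<and> (?h *\<^sub>v v) $ k = 0" if k: "k < ?N" for k
      using comp[OF k, of 1] comp[OF k, of 2] comp[OF k, of 3]
      by (simp add: index_pauli del: One_nat_def index_mult_mat_vec) algebra
    have "?e *\<^sub>v v = 0\<^sub>v ?N" "?f *\<^sub>v v = 0\<^sub>v ?N" "?h *\<^sub>v v = 0\<^sub>v ?N"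
      using zero car by (auto intro!: eq_vecI simp del: index_mult_mat_vec)
    with vN show "v \<in> ?K" by simp
  qed
qed

section \<open>Positive square roots\<close>

lemma cscalar_self: "v \<bullet>c v = complex_of_real (\<Sum>i<dim_vec v. (cmod (v $ i))\<^sup>2)"
  unfolding scalar_prod_def of_real_sum complex_norm_square
  by (auto simp: atLeast0LessThan conjugate_complex_def intro!: sum.cong)

lemma cscalar_self_eq_0:
  assumes "v \<in> carrier_vec n"
  shows "v \<bullet>c v = 0 \<longleftrightarrow> v = (0\<^sub>v n :: complex Matrix.vec)"
  using conjugate_square_eq_0_vec[OF assms] by simp

text \<open>The block diagonal matrix with blocks \<open>c\<close> and \<open>M\<close>, the shape
  left after one eigenvector has been split off.\<close>

definition border :: "complex \<Rightarrow> complex mat \<Rightarrow> complex mat" where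
  "border c M = Matrix.mat (Suc (dim_row M)) (Suc (dim_col M))
     (\<lambda>(i, j). if i = 0 \<and> j = 0 then c else if i = 0 \<or> j = 0 then 0 else M $$ (i - 1, j - 1))"

lemma dim_border [simp]: "dim_row (border c M) = Suc (dim_row M)" "dim_col (border c M) = Suc (dim_col M)"
  by (simp_all add: border_def)

lemma index_border [simp]:
  "border c M $$ (0, 0) = c"
  "j < dim_col M \<Longrightarrow> border c M $$ (0, Suc j) = 0"
  "i < dim_row M \<Longrightarrow> border c M $$ (Suc i, 0) = 0"
  "i < dim_row M \<Longrightarrow> j < dim_col M \<Longrightarrow> border c M $$ (Suc i, Suc j) = M $$ (i, j)"
  by (simp_all add: border_def)

lemma border_mult:
  assumes "dim_col A = dim_row B"
  shows "border a A * border b B = border (a * b) (A * B)"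
proof (rule eq_matI)
  fix i j assume "i < dim_row (border (a * b) (A * B))" "j < dim_col (border (a * b) (A * B))"
  then have "i < Suc (dim_row A)" "j < Suc (dim_col B)" by auto
  then show "(border a A * border b B) $$ (i, j) = border (a * b) (A * B) $$ (i, j)"
    using assms by (cases i; cases j)
      (auto simp: scalar_prod_def atLeast0LessThan sum.lessThan_Suc_shift simp del: sum.lessThan_Suc)
qed auto

lemma border_adjoint: "mat_adjoint (border a A) = border (cnj a) (mat_adjoint A)"
proof (rule eq_matI)
  fix i j assume "i < dim_row (border (cnj a) (mat_adjoint A))" "j < dim_col (border (cnj a) (mat_adjoint A))"
  then have "i < Suc (dim_col A)" "j < Suc (dim_row A)" by auto
  then show "mat_adjoint (border a A) $$ (i, j) = border (cnj a) (mat_adjoint A) $$ (i, j)"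
    by (cases i; cases j) (auto simp: index_mat_adjoint conjugate_complex_def)
qed auto

lemma border_one: "border 1 (1\<^sub>m n) = 1\<^sub>m (Suc n)"
proof (rule eq_matI)
  fix i j assume "i < dim_row (1\<^sub>m (Suc n) :: complex mat)" "j < dim_col (1\<^sub>m (Suc n) :: complex mat)"
  then show "border 1 (1\<^sub>m n) $$ (i, j) = 1\<^sub>m (Suc n) $$ (i, j)"
    by (cases i; cases j) auto
qed auto

lemma dim_mat_diag [simp]: "dim_row (mat_diag n d) = n" "dim_col (mat_diag n d) = n"
  by (simp_all add: mat_diag_def)

lemma border_diag: "border e (mat_diag n d) = mat_diag (Suc n) (case_nat e d)"
proof (rule eq_matI)
  fix i j assume "i < dim_row (mat_diag (Suc n) (case_nat e d))" "j < dim_col (mat_diag (Suc n) (case_nat e d))"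
  then have "i < Suc n" "j < Suc n" by (auto simp: mat_diag_def)
  then show "border e (mat_diag n d) $$ (i, j) = mat_diag (Suc n) (case_nat e d) $$ (i, j)"
    by (cases i; cases j) (auto simp: mat_diag_def)
qed (auto simp: mat_diag_def)

text \<open>The phase prepares \<open>householder\<close>. With a nonpositive real first coordinate
  x, the difference of the unit vector and the first basis vector has squared length 2 (1 - x),
  bounded away from 0, and the reflection along it exchanges the two.\<close>

lemma unit_multiple_nonpos_head:
  assumes v: "v \<in> carrier_vec (Suc n)" "v \<noteq> 0\<^sub>v (Suc n)"
  obtains c :: complex and x :: real where "x \<le> 0" "c * v $ 0 = complex_of_real x" "(\<Sum>i<Suc n. (cmod (c * v $ i))\<^sup>2) = 1"
proof -
  define s where "s = (\<Sum>i<Suc n. (cmod (v $ i))\<^sup>2)"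
  have "v \<bullet>c v = complex_of_real s" using v by (simp only: cscalar_self s_def carrier_vecD)
  then have "s \<noteq> 0" using v cscalar_self_eq_0[OF v(1)] by auto
  moreover have "s \<ge> 0" unfolding s_def by (intro sum_nonneg) auto
  ultimately have s: "s > 0" by simp
  define p where "p = (if v $ 0 = 0 then 1 else - cnj (v $ 0) / complex_of_real (cmod (v $ 0)))"
  have p: "cmod p = 1" by (simp add: p_def norm_divide)
  have pv: "p * v $ 0 = complex_of_real (- cmod (v $ 0))"
  proof (cases "v $ 0 = 0")
    case False
    have "p * v $ 0 = - (v $ 0 * cnj (v $ 0)) / complex_of_real (cmod (v $ 0))"
      using False by (simp add: p_def)
    also have "\<dots> = - complex_of_real ((cmod (v $ 0))\<^sup>2) / complex_of_real (cmod (v $ 0))"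
      by (simp only: complex_norm_square)
    finally show ?thesis
      using False by (simp add: power2_eq_square)
  qed simp
  show thesis
  proof (rule that[of "- cmod (v $ 0) / sqrt s" "p / complex_of_real (sqrt s)"])
    show "- cmod (v $ 0) / sqrt s \<le> 0" using s by (simp add: divide_nonpos_pos)
    show "p / complex_of_real (sqrt s) * v $ 0 = complex_of_real (- cmod (v $ 0) / sqrt s)"
      using pv by simp
    have "(\<Sum>i<Suc n. (cmod (p / complex_of_real (sqrt s) * v $ i))\<^sup>2) = (\<Sum>i<Suc n. (cmod (v $ i))\<^sup>2 / s)"
      using s p by (intro sum.cong) (auto simp: norm_mult norm_divide power_divide power_mult_distrib)
    also have "\<dots> = 1" unfolding sum_divide_distrib[symmetric] s_def[symmetric] using s by simp
    finally show "(\<Sum>i<Suc n. (cmod (p / complex_of_real (sqrt s) * v $ i))\<^sup>2) = 1" .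
  qed
qed

text \<open>The reflection exchanging \<open>v\<close> with the first basis vector.\<close>
lemma householder:
  fixes v :: "complex Matrix.vec" and x :: real
  assumes v: "v \<in> carrier_vec (Suc n)" and head: "v $ 0 = complex_of_real x" "x \<le> 0"
    and unit: "(\<Sum>i<Suc n. (cmod (v $ i))\<^sup>2) = 1"
  obtains W where "W \<in> carrier_mat (Suc n) (Suc n)" "mat_adjoint W = W" "W * W = 1\<^sub>m (Suc n)"
    "\<And>i. i < Suc n \<Longrightarrow> W $$ (i, 0) = v $ i"
proof -
  define u where "u = (\<lambda>i. v $ i - (if i = 0 then 1 else 0))"
  \<comment> \<open>Two divided by the squared length 2 (1 - x) of \<open>u\<close>, as in every
    reflection along \<open>u\<close>.\<close>
  define q where "q = complex_of_real (1 / (1 - x))"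
  define W where "W = Matrix.mat (Suc n) (Suc n) (\<lambda>(i, j). (if i = j then 1 else 0) - q * u i * cnj (u j))"
  have q: "q * complex_of_real (1 - x) = 1" using head(2) by (simp add: q_def)
  have "(\<Sum>k<Suc n. u k * cnj (u k)) = (\<Sum>k<Suc n. v $ k * cnj (v $ k) + (if k = 0 then 1 - v $ 0 - cnj (v $ 0) else 0))"
    by (intro sum.cong) (auto simp: u_def algebra_simps)
  also have "\<dots> = complex_of_real (\<Sum>i<Suc n. (cmod (v $ i))\<^sup>2) + (1 - v $ 0 - cnj (v $ 0))"
    unfolding sum.distrib of_real_sum complex_norm_square by simp
  also have "\<dots> = 2 * complex_of_real (1 - x)"
    unfolding unit head by simp
  finally have uu: "(\<Sum>k<Suc n. cnj (u k) * u k) = 2 * complex_of_real (1 - x)" by (simp add: mult.commute)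
  show thesis
  proof (rule that[of W])
    show W: "W \<in> carrier_mat (Suc n) (Suc n)" by (simp add: W_def)
    have "cnj q = q" by (simp add: q_def)
    then show "mat_adjoint W = W"
      using W by (intro eq_matI) (auto simp: index_mat_adjoint W_def conjugate_complex_def)
    show "W * W = 1\<^sub>m (Suc n)"
    proof (rule eq_matI)
      fix i j assume "i < dim_row (1\<^sub>m (Suc n) :: complex mat)" "j < dim_col (1\<^sub>m (Suc n) :: complex mat)"
      then have ij: "i < Suc n" "j < Suc n" by auto
      have "(W * W) $$ (i, j) = (\<Sum>k<Suc n. W $$ (i, k) * W $$ (k, j))"
        using ij W by (auto simp: scalar_prod_def atLeast0LessThan)
      also have "\<dots> = (\<Sum>k<Suc n. (if k = i then (if i = j then 1 else 0) - q * u i * cnj (u j) else 0)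
          + (if k = j then - (q * u i * cnj (u j)) else 0) + (q * u i * cnj (u j) * q) * (cnj (u k) * u k))"
        using ij by (intro sum.cong) (auto simp: W_def algebra_simps)
      also have "\<dots> = (if i = j then 1 else 0) - q * u i * cnj (u j) + - (q * u i * cnj (u j))
          + (q * u i * cnj (u j) * q) * (2 * complex_of_real (1 - x))"
        unfolding sum.distrib sum_distrib_left[symmetric] uu using ij by simp
      also have "\<dots> = (if i = j then 1 else 0) - 2 * q * u i * cnj (u j) + 2 * q * u i * cnj (u j) * (q * complex_of_real (1 - x))"
        by (simp add: algebra_simps)
      also have "\<dots> = 1\<^sub>m (Suc n) $$ (i, j)"
        unfolding q using ij by simp
      finally show "(W * W) $$ (i, j) = 1\<^sub>m (Suc n) $$ (i, j)" .
    qed (use W in auto)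
    fix i assume i: "i < Suc n"
    have "cnj (u 0) = - complex_of_real (1 - x)" by (simp add: u_def head)
    then have "q * u i * cnj (u 0) = - (u i * (q * complex_of_real (1 - x)))" by (simp only: mult_ac mult_minus_right)
    then show "W $$ (i, 0) = v $ i"
      unfolding q using i by (simp add: W_def u_def)
  qed
qed

text \<open>Induction on the size: a reflection moves an eigenvector to the first basis vector, and
  Hermiticity then clears the first row along with the first column, leaving a smaller Hermitian
  block.\<close>

lemma hermitian_diagonalization:
  fixes A :: "complex mat"
  assumes "A \<in> carrier_mat n n" and "mat_adjoint A = A"
  shows "\<exists>U d. U \<in> carrier_mat n n \<and> mat_adjoint U * U = 1\<^sub>m n \<and> U * mat_adjoint U = 1\<^sub>m n
    \<and> A = U * mat_diag n d * mat_adjoint U"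
  using assms
proof (induction n arbitrary: A)
  case 0
  then show ?case
    by (intro exI[of _ "1\<^sub>m 0"] exI[of _ "\<lambda>_. 0"]) (auto simp: mat_adjoint_one intro!: eq_matI)
next
  case (Suc n)
  note A = Suc.prems
  let ?N = "Suc n"
  obtain e v0 where v0: "v0 \<in> carrier_vec ?N" "v0 \<noteq> 0\<^sub>v ?N" "A *\<^sub>v v0 = e \<cdot>\<^sub>v v0"
    using spectrum_non_empty[OF A(1)] A(1) by (auto simp: spectrum_def eigenvalue_def eigenvector_def)
  obtain c x where c: "x \<le> 0" "c * v0 $ 0 = complex_of_real x" "(\<Sum>i<?N. (cmod (c * v0 $ i))\<^sup>2) = 1"
    using unit_multiple_nonpos_head[OF v0(1,2)] .
  define v where "v = c \<cdot>\<^sub>v v0"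
  have v: "v \<in> carrier_vec ?N" and Av: "A *\<^sub>v v = e \<cdot>\<^sub>v v"
    using v0 A(1) by (auto simp: v_def mult_mat_vec[of _ ?N ?N] smult_smult_assoc mult.commute)
  obtain W where W: "W \<in> carrier_mat ?N ?N" "mat_adjoint W = W" "W * W = 1\<^sub>m ?N"
    and W0: "\<And>i. i < ?N \<Longrightarrow> W $$ (i, 0) = v $ i"
    using householder[of v n x] v c v0 by (auto simp: v_def)
  define A' where "A' = W * A * W"
  have A': "A' \<in> carrier_mat ?N ?N" using W A by (auto simp: A'_def)
  have herm: "mat_adjoint A' = A'"
    using W A by (simp add: A'_def mat_adjoint_mult assoc_mult_mat[of _ ?N ?N _ ?N _ ?N])
  have colW: "col W 0 = v" using W W0 v by (intro eq_vecI) auto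
  have "col A' 0 = (W * A) *\<^sub>v v"
    unfolding A'_def colW[symmetric] by (rule col_mult2[OF mult_carrier_mat[OF W(1) A(1)] W(1)]) simp
  also have "\<dots> = e \<cdot>\<^sub>v (W *\<^sub>v v)"
    using W A v Av by (simp add: assoc_mult_mat_vec[of _ ?N ?N _ ?N] mult_mat_vec[of _ ?N ?N])
  also have "W *\<^sub>v v = col (W * W) 0"
    using col_mult2[OF W(1) W(1), of 0] colW by simp
  finally have "col A' 0 = e \<cdot>\<^sub>v unit_vec ?N 0"
    unfolding W(3) by simp
  then have col0: "A' $$ (i, 0) = (if i = 0 then e else 0)" if "i < ?N" for i
    using that A' arg_cong[of _ _ "\<lambda>w. w $ i"] by (fastforce simp: col_def)
  have row0: "A' $$ (0, j) = (if j = 0 then e else 0)" if j: "j < ?N" for j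
  proof (cases "j = 0")
    case False
    have "A' $$ (0, j) = mat_adjoint A' $$ (0, j)" by (simp add: herm)
    also have "\<dots> = conjugate (A' $$ (j, 0))" using A' j by (intro index_mat_adjoint) auto
    finally show ?thesis using False j col0 by simp
  qed (use col0[of 0] in simp)
  define B where "B = Matrix.mat n n (\<lambda>(i, j). A' $$ (Suc i, Suc j))"
  have B: "B \<in> carrier_mat n n" by (simp add: B_def)
  have A'_eq: "A' = border e B"
  proof (rule eq_matI)
    fix i j assume "i < dim_row (border e B)" "j < dim_col (border e B)"
    then have "i < ?N" "j < ?N" using B by auto
    then show "A' $$ (i, j) = border e B $$ (i, j)"
      using col0 row0 by (cases i; cases j) (auto simp: B_def)
  qed (use A' B in auto)
  have "mat_adjoint B = B"
  proof (rule eq_matI)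
    fix i j assume "i < dim_row B" "j < dim_col B"
    then have ij: "i < n" "j < n" using B by auto
    have "A' $$ (Suc i, Suc j) = conjugate (A' $$ (Suc j, Suc i))"
      using index_mat_adjoint[of "Suc i" A' "Suc j"] herm A' ij by auto
    then show "mat_adjoint B $$ (i, j) = B $$ (i, j)"
      using ij by (simp add: index_mat_adjoint B_def)
  qed (use B in auto)
  from Suc.IH[OF B this] obtain U d where U: "U \<in> carrier_mat n n" "mat_adjoint U * U = 1\<^sub>m n"
    "U * mat_adjoint U = 1\<^sub>m n" and BU: "B = U * mat_diag n d * mat_adjoint U" by blast
  define V where "V = border 1 U"
  have V: "V \<in> carrier_mat ?N ?N" using U by (auto simp: V_def intro!: carrier_matI)
  have V1: "mat_adjoint V * V = 1\<^sub>m ?N" "V * mat_adjoint V = 1\<^sub>m ?N"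
    using U by (simp_all add: V_def border_adjoint border_mult border_one)
  have A'V: "A' = V * mat_diag ?N (case_nat e d) * mat_adjoint V"
    unfolding A'_eq BU V_def border_diag[symmetric] border_adjoint
    using U(1) by (simp add: border_mult mat_diag_def)
  have Vad: "mat_adjoint V \<in> carrier_mat ?N ?N" using V by auto
  have WV: "W * V \<in> carrier_mat ?N ?N" using W V by auto
  have adj: "mat_adjoint (W * V) = mat_adjoint V * W"
    using W V by (simp add: mat_adjoint_mult)
  have D: "mat_diag ?N (case_nat e d) \<in> carrier_mat ?N ?N" by simp
  note assoc = assoc_mult_mat[of _ ?N ?N _ ?N _ ?N] mult_carrier_mat[of _ ?N ?N _ ?N]
  have "mat_adjoint (W * V) * (W * V) = mat_adjoint V * ((W * W) * V)"
    unfolding adj using W(1) V Vad by (simp add: assoc)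
  then have 1: "mat_adjoint (W * V) * (W * V) = 1\<^sub>m ?N"
    using W(3) V V1 by simp
  have "(W * V) * mat_adjoint (W * V) = W * ((V * mat_adjoint V) * W)"
    unfolding adj using W(1) V Vad by (simp add: assoc)
  then have 2: "(W * V) * mat_adjoint (W * V) = 1\<^sub>m ?N"
    using W V1 by simp
  have "A = (W * W) * A * (W * W)"
    using A(1) by (simp add: W(3))
  also have "\<dots> = W * A' * W"
    using W(1) A(1) by (simp add: A'_def assoc)
  also have "\<dots> = (W * V) * mat_diag ?N (case_nat e d) * mat_adjoint (W * V)"
    unfolding adj A'V using W(1) V Vad D by (simp add: assoc)
  finally show ?case
    using 1 2 WV by blast
qed

text \<open>With mu = 1 / sqrt d one has (R + mu) (R - mu) v = 0. So (R - mu) v satisfies the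
  eigenvalue equation of \<open>R\<close> for -mu < 0, and positivity forces it to vanish. This
  evaluates the root on single eigenvectors and also yields its uniqueness.\<close>

lemma psd_root_eigenvector:
  assumes R: "R \<in> carrier_mat n n" "pos_semidef R" and M: "M \<in> carrier_mat n n"
    and RRM: "R * R * M = 1\<^sub>m n" and v: "v \<in> carrier_vec n" and Mv: "M *\<^sub>v v = complex_of_real d \<cdot>\<^sub>v v" and d: "d > 0"
  shows "R *\<^sub>v v = complex_of_real (1 / sqrt d) \<cdot>\<^sub>v v"
proof -
  define \<mu> where "\<mu> = 1 / sqrt d"
  have \<mu>: "\<mu> > 0" "\<mu> * \<mu> * d = 1" using d by (simp_all add: \<mu>_def field_simps)
  have Rv: "R *\<^sub>v v \<in> carrier_vec n" using R v by auto
  have "v = (R * R * M) *\<^sub>v v" using v by (simp add: RRM)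
  also have "\<dots> = complex_of_real d \<cdot>\<^sub>v (R *\<^sub>v (R *\<^sub>v v))"
    using R M v Mv by (simp add: assoc_mult_mat_vec[of _ n n _ n] mult_mat_vec[of _ n n])
  finally have vRR: "v = complex_of_real d \<cdot>\<^sub>v (R *\<^sub>v (R *\<^sub>v v))" .
  have RR: "R *\<^sub>v (R *\<^sub>v v) = complex_of_real (\<mu> * \<mu>) \<cdot>\<^sub>v v"
    by (subst (2) vRR) (simp add: smult_smult_assoc of_real_mult[symmetric] \<mu> del: of_real_mult)
  have smult_diff: "complex_of_real (\<mu> * \<mu>) \<cdot>\<^sub>v v - complex_of_real \<mu> \<cdot>\<^sub>v a
      = complex_of_real (- \<mu>) \<cdot>\<^sub>v (a - complex_of_real \<mu> \<cdot>\<^sub>v v)"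
    if "a \<in> carrier_vec n" "v \<in> carrier_vec n" for a v
    by (rule eq_vecI) (use that in \<open>auto simp: algebra_simps\<close>)
  define w where "w = R *\<^sub>v v - complex_of_real \<mu> \<cdot>\<^sub>v v"
  have w: "w \<in> carrier_vec n" using Rv v by (simp add: w_def)
  have "R *\<^sub>v w = R *\<^sub>v (R *\<^sub>v v) - complex_of_real \<mu> \<cdot>\<^sub>v (R *\<^sub>v v)"
    using R v Rv by (simp add: w_def mult_minus_distrib_mat_vec[of _ n n] mult_mat_vec[of _ n n])
  also have "\<dots> = complex_of_real (- \<mu>) \<cdot>\<^sub>v w"
    unfolding RR w_def using Rv v by (rule smult_diff)
  finally have Rw: "R *\<^sub>v w = complex_of_real (- \<mu>) \<cdot>\<^sub>v w" .
  define s where "s = (\<Sum>i<n. (cmod (w $ i))\<^sup>2)"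
  have ws: "w \<bullet>c w = complex_of_real s" using w by (simp add: cscalar_self s_def)
  have "0 \<le> (R *\<^sub>v w) \<bullet>c w"
    using R w by (auto simp: pos_semidef_def)
  also have "(R *\<^sub>v w) \<bullet>c w = complex_of_real (- \<mu> * s)"
    unfolding Rw using w ws by simp
  finally have "- \<mu> * s \<ge> 0" by (simp add: less_eq_complex_def)
  then have "s \<le> 0" using \<mu>(1) by (simp add: mult_le_0_iff)
  moreover have "s \<ge> 0" unfolding s_def by (intro sum_nonneg) auto
  ultimately have "w = 0\<^sub>v n"
    using cscalar_self_eq_0[OF w] ws by simp
  then show ?thesis
    using R(1) v unfolding w_def \<mu>_def[symmetric]
    by (intro eq_vecI) (auto simp: vec_eq_iff simp del: index_mult_mat_vec)
qed

text \<open>Existence takes 1 / sqrt of each eigenvalue in a diagonalization of \<open>M\<close>.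
  For uniqueness, any other root agrees with it on every column of \<open>U\<close> by
  \<open>psd_root_eigenvector\<close>.\<close>

lemma inv_sqrt_op:
  assumes M: "M \<in> carrier_mat n n" "pos_semidef M"
    and inj: "\<And>v. v \<in> carrier_vec n \<Longrightarrow> M *\<^sub>v v = 0\<^sub>v n \<Longrightarrow> v = 0\<^sub>v n"
  shows "inv_sqrt_op M \<in> carrier_mat n n" "pos_semidef (inv_sqrt_op M)" "inv_sqrt_op M * inv_sqrt_op M * M = 1\<^sub>m n"
proof -
  have herm: "mat_adjoint M = M" and psd: "\<And>v. v \<in> carrier_vec n \<Longrightarrow> 0 \<le> (M *\<^sub>v v) \<bullet>c v"
    using M by (auto simp: pos_semidef_def)
  obtain U d where U: "U \<in> carrier_mat n n" "mat_adjoint U * U = 1\<^sub>m n" "U * mat_adjoint U = 1\<^sub>m n"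
    and MU: "M = U * mat_diag n d * mat_adjoint U"
    using hermitian_diagonalization[OF M(1) herm] by blast
  have Uad: "mat_adjoint U \<in> carrier_mat n n" using U by auto
  note assoc = assoc_mult_mat[of _ n n _ n _ n] mult_carrier_mat[of _ n n _ n]
  have "M * U = U * mat_diag n d * (mat_adjoint U * U)"
    unfolding MU using U(1) Uad by (simp add: assoc)
  then have MU': "M * U = U * mat_diag n d" using U by (simp add: right_mult_one_mat[of _ n n])
  have col: "M *\<^sub>v col U i = d i \<cdot>\<^sub>v col U i" if i: "i < n" for i
  proof -
    have "M *\<^sub>v col U i = col (M * U) i" by (rule col_mult2[OF M(1) U(1) i, symmetric])
    also have "\<dots> = d i \<cdot>\<^sub>v col U i"
      unfolding MU' using U i by (intro eq_vecI) (auto simp: mat_diag_mult_right[of _ n])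
    finally show ?thesis .
  qed
  have colU: "col U i \<in> carrier_vec n" for i using U by auto
  have col0: "col U i \<noteq> 0\<^sub>v n" if i: "i < n" for i
  proof
    assume 0: "col U i = 0\<^sub>v n"
    have "(mat_adjoint U * U) $$ (i, i) = row (mat_adjoint U) i \<bullet> col U i"
      using U(1) i by (intro index_mult_mat(1)) auto
    also have "\<dots> = 0"
      unfolding 0 using Uad by (intro scalar_prod_right_zero carrier_vecI) auto
    finally have "(mat_adjoint U * U) $$ (i, i) = 0" .
    then show False using U i by simp
  qed
  \<comment> \<open>Positivity makes each eigenvalue real and nonnegative; injectivity excludes
    0.\<close>
  have d: "d i = complex_of_real (Re (d i)) \<and> Re (d i) > 0" if i: "i < n" for i
  proof -
    define s where "s = (\<Sum>k<n. (cmod (col U i $ k))\<^sup>2)"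
    have ss: "col U i \<bullet>c col U i = complex_of_real s" using colU[of i] U by (simp add: cscalar_self s_def)
    have "s \<noteq> 0"
    proof
      assume "s = 0"
      then have "col U i \<bullet>c col U i = 0" using ss by (simp only: of_real_0)
      then show False using cscalar_self_eq_0[OF colU[of i]] col0[OF i] by blast
    qed
    moreover have "s \<ge> 0" unfolding s_def by (intro sum_nonneg) auto
    ultimately have s: "s > 0" by simp
    have "0 \<le> d i * complex_of_real s"
      using psd[OF colU[of i]] unfolding col[OF i] using colU[of i] ss by simp
    then have "Im (d i) = 0" "Re (d i) \<ge> 0" using s by (auto simp: less_eq_complex_def zero_le_mult_iff)
    moreover have "d i \<noteq> 0"
    proof
      assume "d i = 0"
      have "0 \<cdot>\<^sub>v w = 0\<^sub>v n" if "w \<in> carrier_vec n" for w :: "complex Matrix.vec"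
        by (rule eq_vecI) (use that in auto)
      with \<open>d i = 0\<close> have "M *\<^sub>v col U i = 0\<^sub>v n"
        using col[OF i] colU[of i] by metis
      with inj colU col0 i show False by blast
    qed
    ultimately show ?thesis by (auto simp: complex_eq_iff less_le)
  qed
  define r where "r = (\<lambda>i. complex_of_real (1 / sqrt (Re (d i))))"
  define R where "R = U * mat_diag n r * mat_adjoint U"
  have R: "R \<in> carrier_mat n n" using U Uad by (simp add: R_def assoc)
  have Dr: "mat_adjoint (mat_diag n r) = mat_diag n r"
    by (rule eq_matI) (auto simp: index_mat_adjoint mat_diag_def r_def conjugate_complex_def)
  have "mat_adjoint R = R"
    unfolding R_def using U Uad by (simp add: mat_adjoint_mult mat_adjoint_adjoint Dr assoc)
  moreover have "0 \<le> (R *\<^sub>v v) \<bullet>c v" if v: "v \<in> carrier_vec n" for v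
  proof -
    let ?w = "mat_adjoint U *\<^sub>v v"
    have w: "?w \<in> carrier_vec n" using Uad v by auto
    have "R *\<^sub>v v = U *\<^sub>v (mat_diag n r *\<^sub>v ?w)"
      unfolding R_def using U Uad v by (simp add: assoc_mult_mat_vec[of _ n n _ n])
    then have "(R *\<^sub>v v) \<bullet>c v = (mat_diag n r *\<^sub>v ?w) \<bullet>c ?w"
      using inner_adjoint[OF U(1), of "mat_diag n r *\<^sub>v ?w" v] w v by (simp add: mult_mat_vec_carrier[of _ n n])
    also have "\<dots> = (\<Sum>i<n. r i * (?w $ i * cnj (?w $ i)))"
    proof -
      have "(mat_diag n r *\<^sub>v ?w) $ i = r i * ?w $ i" if i: "i < n" for i
      proof -
        have "(mat_diag n r *\<^sub>v ?w) $ i = (\<Sum>k<n. (if i = k then r k else 0) * ?w $ k)"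
          using i by (subst index_mult_mat_vec_sum[OF mat_diag_dim w]) (auto simp: mat_diag_def intro!: sum.cong)
        also have "\<dots> = (\<Sum>k<n. if k = i then r i * ?w $ i else 0)" by (intro sum.cong) auto
        finally show ?thesis using i by simp
      qed
      then show ?thesis
        using w U(1) by (auto simp: scalar_prod_def atLeast0LessThan conjugate_complex_def mult.assoc simp del: index_mult_mat_vec
          intro!: sum.cong)
    qed
    also have "\<dots> = complex_of_real (\<Sum>i<n. 1 / sqrt (Re (d i)) * (cmod (?w $ i))\<^sup>2)"
      unfolding of_real_sum of_real_mult complex_norm_square r_def by simp
    finally have "(R *\<^sub>v v) \<bullet>c v = complex_of_real (\<Sum>i<n. 1 / sqrt (Re (d i)) * (cmod (?w $ i))\<^sup>2)" .
    moreover have "(\<Sum>i<n. 1 / sqrt (Re (d i)) * (cmod (?w $ i))\<^sup>2) \<ge> 0"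
      using d by (intro sum_nonneg) (auto simp: less_imp_le)
    ultimately show ?thesis by (simp add: less_eq_complex_def)
  qed
  ultimately have Rpsd: "pos_semidef R" using R by (auto simp: pos_semidef_def)
  have "R * R * M = U * (mat_diag n r * ((mat_adjoint U * U) * (mat_diag n r * ((mat_adjoint U * U) * (mat_diag n d * mat_adjoint U)))))"
    unfolding R_def MU using U(1) Uad by (simp add: assoc)
  also have "\<dots> = U * (mat_diag n r * mat_diag n r * mat_diag n d * mat_adjoint U)"
    unfolding U(2) using Uad by (simp add: assoc del: mat_diag_diag)
  also have "mat_diag n r * mat_diag n r * mat_diag n d = 1\<^sub>m n"
  proof -
    have one: "r i * r i * d i = 1" if i: "i < n" for i
    proof -
      have "r i * r i * d i = r i * r i * complex_of_real (Re (d i))"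
        using d[OF i] by metis
      also have "\<dots> = complex_of_real (1 / sqrt (Re (d i)) * (1 / sqrt (Re (d i))) * Re (d i))"
        by (simp only: r_def of_real_mult)
      also have "1 / sqrt (Re (d i)) * (1 / sqrt (Re (d i))) * Re (d i) = 1"
        using d[OF i] by simp
      finally show ?thesis by simp
    qed
    show ?thesis
      unfolding mat_diag_diag by (rule eq_matI) (auto simp: mat_diag_def one)
  qed
  finally have RRM: "R * R * M = 1\<^sub>m n" using U Uad by simp
  have uniq: "R' = R" if R': "R' \<in> carrier_mat n n" "pos_semidef R'" "R' * R' * M = 1\<^sub>m n" for R'
  proof -
    have "R' * U = R * U"
    proof (rule mat_col_eqI)
      fix i assume "i < dim_col (R * U)"
      then have i: "i < n" using U by simp
      have e: "M *\<^sub>v col U i = complex_of_real (Re (d i)) \<cdot>\<^sub>v col U i" using col[OF i] d[OF i] by simp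
      show "col (R' * U) i = col (R * U) i"
        unfolding col_mult2[OF R'(1) U(1) i] col_mult2[OF R U(1) i]
        using psd_root_eigenvector[OF R' (1,2) M(1) R'(3) colU e] psd_root_eigenvector[OF R Rpsd M(1) RRM colU e] d[OF i]
        by simp
    qed (use R R' U in auto)
    then have "R' * U * mat_adjoint U = R * U * mat_adjoint U" by simp
    then show ?thesis using R R' U Uad by (simp add: assoc)
  qed
  have "inv_sqrt_op M = R"
  proof -
    have dM: "dim_row M = n" using M by simp
    show ?thesis
      unfolding inv_sqrt_op_def dM
      by (rule the_equality) (use R Rpsd RRM uniq in blast)+
  qed
  then show "inv_sqrt_op M \<in> carrier_mat n n" "pos_semidef (inv_sqrt_op M)" "inv_sqrt_op M * inv_sqrt_op M * M = 1\<^sub>m n"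
    using R Rpsd RRM by simp_all
qed

section \<open>Multiplicity one\<close>

context
  fixes nu nd nr :: nat
begin

text \<open>Inverts the iterated quotients and remainders of \<open>kron\<close>. The four arguments
  count lowering steps from the highest weight in each factor.\<close>

definition state_index :: "nat \<Rightarrow> nat \<Rightarrow> nat \<Rightarrow> nat \<Rightarrow> nat" where
  "state_index k l m s = ((k * (nd + 1) + l) * (nr + 1) + m) * 2 + s"

lemma state_index_less:
  assumes "k \<le> nu" "l \<le> nd" "m \<le> nr" "s \<le> 1"
  shows "state_index k l m s < state_dim nu nd nr"
  unfolding state_index_def state_dim_def using assms by (intro index_less_mult) auto

lemma state_index_cases:
  assumes "i < state_dim nu nd nr"
  obtains k l m s where "k \<le> nu" "l \<le> nd" "m \<le> nr" "s \<le> 1" "i = state_index k l m s"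
proof -
  let ?a = "i div 2" and ?b = "i div 2 div (nr + 1)"
  have a: "?a < (nu + 1) * (nd + 1) * (nr + 1)" using assms unfolding state_dim_def by (rule div_less_factor)
  have b: "?b < (nu + 1) * (nd + 1)" using a by (rule div_less_factor)
  show thesis
  proof (rule that[of "?b div (nd + 1)" "?b mod (nd + 1)" "?a mod (nr + 1)" "i mod 2"])
    show "?b div (nd + 1) \<le> nu" using div_less_factor[OF b] by simp
    show "?b mod (nd + 1) \<le> nd" using mod_less_factor[OF b] by simp
    show "?a mod (nr + 1) \<le> nr" using mod_less_factor[OF a] by simp
    show "i mod 2 \<le> 1" by simp
    show "i = state_index (?b div (nd + 1)) (?b mod (nd + 1)) (?a mod (nr + 1)) (i mod 2)"
      unfolding state_index_def by (simp only: div_mult_mod_eq)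
  qed
qed

lemma index_kron4:
  assumes A: "A \<in> carrier_mat (nu + 1) (nu + 1)" and B: "B \<in> carrier_mat (nd + 1) (nd + 1)"
    and C: "C \<in> carrier_mat (nr + 1) (nr + 1)" and D: "D \<in> carrier_mat 2 2"
    and "k \<le> nu" "l \<le> nd" "m \<le> nr" "s \<le> 1" "k' \<le> nu" "l' \<le> nd" "m' \<le> nr" "s' \<le> 1"
  shows "(A \<otimes>\<^sub>m B \<otimes>\<^sub>m C \<otimes>\<^sub>m D) $$ (state_index k l m s, state_index k' l' m' s') =
    A $$ (k, k') * B $$ (l, l') * C $$ (m, m') * D $$ (s, s')"
proof -
  have dims: "dim_row A = nu + 1" "dim_col A = nu + 1" "dim_row B = nd + 1" "dim_col B = nd + 1"
    "dim_row C = nr + 1" "dim_col C = nr + 1" "dim_row D = 2" "dim_col D = 2" using A B C D by auto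
  note less = index_less_mult[of k "nu + 1" l "nd + 1"] index_less_mult[of k' "nu + 1" l' "nd + 1"]
  have 1: "(A \<otimes>\<^sub>m B) $$ (k * (nd + 1) + l, k' * (nd + 1) + l') = A $$ (k, k') * B $$ (l, l')"
    using index_kron_mult_add[of k A k' l B l'] assms by (simp only: dims)
  have 2: "(A \<otimes>\<^sub>m B \<otimes>\<^sub>m C) $$ ((k * (nd + 1) + l) * (nr + 1) + m, (k' * (nd + 1) + l') * (nr + 1) + m')
    = A $$ (k, k') * B $$ (l, l') * C $$ (m, m')"
    unfolding 1[symmetric]
    using index_kron_mult_add[of "k * (nd + 1) + l" "A \<otimes>\<^sub>m B" "k' * (nd + 1) + l'" m C m'] assms less
    by (simp add: dims)
  show ?thesis
    unfolding state_index_def 2[symmetric]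
    using index_kron_mult_add[of "(k * (nd + 1) + l) * (nr + 1) + m" "A \<otimes>\<^sub>m B \<otimes>\<^sub>m C" "(k' * (nd + 1) + l') * (nr + 1) + m'" s D s'] assms less
      index_less_mult[of "k * (nd + 1) + l" "(nu + 1) * (nd + 1)" m "nr + 1"]
      index_less_mult[of "k' * (nd + 1) + l'" "(nu + 1) * (nd + 1)" m' "nr + 1"]
    by (simp add: dims del: mult_Suc mult_Suc_right)
qed

lemma sum_state_index:
  fixes f :: "nat \<Rightarrow> 'b::comm_monoid_add"
  shows "(\<Sum>r<state_dim nu nd nr. f r) =
    (\<Sum>k<nu + 1. \<Sum>l<nd + 1. \<Sum>m<nr + 1. \<Sum>s<2. f (state_index k l m s))"
  unfolding state_dim_def state_index_def sum_mult_index by (rule refl)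

lemma index_kron4_mult_vec:
  assumes A: "A \<in> carrier_mat (nu + 1) (nu + 1)" and B: "B \<in> carrier_mat (nd + 1) (nd + 1)"
    and C: "C \<in> carrier_mat (nr + 1) (nr + 1)" and D: "D \<in> carrier_mat 2 2"
    and v: "v \<in> carrier_vec (state_dim nu nd nr)"
    and k: "k \<le> nu" "l \<le> nd" "m \<le> nr" "s \<le> 1"
  shows "((A \<otimes>\<^sub>m B \<otimes>\<^sub>m C \<otimes>\<^sub>m D) *\<^sub>v v) $ state_index k l m s = (\<Sum>k'<nu + 1. \<Sum>l'<nd + 1. \<Sum>m'<nr + 1. \<Sum>s'<2.
    A $$ (k, k') * B $$ (l, l') * C $$ (m, m') * D $$ (s, s') * v $ state_index k' l' m' s')"
proof -
  have car: "A \<otimes>\<^sub>m B \<otimes>\<^sub>m C \<otimes>\<^sub>m D \<in> carrier_mat (state_dim nu nd nr) (state_dim nu nd nr)"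
    unfolding state_dim_def using A B C D by (intro kron_carrier)
  have "((A \<otimes>\<^sub>m B \<otimes>\<^sub>m C \<otimes>\<^sub>m D) *\<^sub>v v) $ state_index k l m s =
    (\<Sum>r<state_dim nu nd nr. (A \<otimes>\<^sub>m B \<otimes>\<^sub>m C \<otimes>\<^sub>m D) $$ (state_index k l m s, r) * v $ r)"
    by (rule index_mult_mat_vec_sum[OF car v state_index_less[OF k]])
  also have "\<dots> = (\<Sum>k'<nu + 1. \<Sum>l'<nd + 1. \<Sum>m'<nr + 1. \<Sum>s'<2.
    A $$ (k, k') * B $$ (l, l') * C $$ (m, m') * D $$ (s, s') * v $ state_index k' l' m' s')"
    unfolding sum_state_index
    by (intro sum.cong) (auto simp: index_kron4[OF A B C D k])
  finally show ?thesis .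
qed

context
  fixes v :: "complex Matrix.vec" and k l m s :: nat
  assumes v: "v \<in> carrier_vec (state_dim nu nd nr)"
    and k: "k \<le> nu" and l: "l \<le> nd" and m: "m \<le> nr" and s: "s \<le> 1"
begin

private lemma sum_one_mat: "i < n \<Longrightarrow> (\<Sum>j<n. 1\<^sub>m n $$ (i, j) * f j) = (f i :: complex)"
proof -
  assume i: "i < n"
  have "(\<Sum>j<n. 1\<^sub>m n $$ (i, j) * f j) = (\<Sum>j<n. if j = i then f i else 0)"
    using i by (intro sum.cong) auto
  then show ?thesis using i by simp
qed

private lemma less: "k < nu + 1" "l < nd + 1" "m < nr + 1" "s < 2"
  using k l m s by auto

lemma index_up_leg:
  assumes "A \<in> carrier_mat (nu + 1) (nu + 1)"
  shows "(up_leg nu nd nr A *\<^sub>v v) $ state_index k l m s = (\<Sum>j<nu + 1. A $$ (k, j) * v $ state_index j l m s)"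
  unfolding up_leg_def index_kron4_mult_vec[OF assms one_carrier_mat one_carrier_mat one_carrier_mat v k l m s]
  by (simp only: mult.assoc sum_distrib_left[symmetric] sum_one_mat less)

lemma index_down_leg:
  assumes "A \<in> carrier_mat (nd + 1) (nd + 1)"
  shows "(down_leg nu nd nr A *\<^sub>v v) $ state_index k l m s = (\<Sum>j<nd + 1. A $$ (l, j) * v $ state_index k j m s)"
  unfolding down_leg_def index_kron4_mult_vec[OF one_carrier_mat assms one_carrier_mat one_carrier_mat v k l m s]
  by (simp only: mult.assoc sum_distrib_left[symmetric] sum_one_mat less)

lemma index_tan_leg:
  assumes "A \<in> carrier_mat (nr + 1) (nr + 1)"
  shows "(tan_leg nu nd nr A *\<^sub>v v) $ state_index k l m s = (\<Sum>j<nr + 1. A $$ (m, j) * v $ state_index k l j s)"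
  unfolding tan_leg_def index_kron4_mult_vec[OF one_carrier_mat one_carrier_mat assms one_carrier_mat v k l m s]
  by (simp only: mult.assoc sum_distrib_left[symmetric] sum_one_mat less)

lemma index_spin_leg:
  assumes "A \<in> carrier_mat 2 2"
  shows "(spin_leg nu nd nr A *\<^sub>v v) $ state_index k l m s = (\<Sum>j<2. A $$ (s, j) * v $ state_index k l m j)"
  unfolding spin_leg_def index_kron4_mult_vec[OF one_carrier_mat one_carrier_mat one_carrier_mat assms v k l m s]
  by (simp only: mult.assoc sum_distrib_left[symmetric] sum_one_mat less)

lemmas index_up_ladder =
  index_up_leg[OF ladder_carrier(1), unfolded sum_raise[OF k]]
  index_up_leg[OF ladder_carrier(2), unfolded sum_lower[OF k]]
  index_up_leg[OF ladder_carrier(3), unfolded sum_weight[OF k]]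

lemmas index_down_ladder =
  index_down_leg[OF ladder_carrier(1), unfolded sum_raise[OF l]]
  index_down_leg[OF ladder_carrier(2), unfolded sum_lower[OF l]]
  index_down_leg[OF ladder_carrier(3), unfolded sum_weight[OF l]]

lemmas index_tan_ladder =
  index_tan_leg[OF ladder_carrier(1), unfolded sum_raise[OF m]]
  index_tan_leg[OF ladder_carrier(2), unfolded sum_lower[OF m]]
  index_tan_leg[OF ladder_carrier(3), unfolded sum_weight[OF m]]

lemma index_spin_ladder:
  "(spin_leg nu nd nr (raise 1) *\<^sub>v v) $ state_index k l m s = ladder_coeff 1 (Suc s) * v $ state_index k l m (Suc s)"
  "(spin_leg nu nd nr (lower 1) *\<^sub>v v) $ state_index k l m s = ladder_coeff 1 s * v $ state_index k l m (s - 1)"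
  "(spin_leg nu nd nr (weight 1) *\<^sub>v v) $ state_index k l m s = (1 - 2 * of_nat s) * v $ state_index k l m s"
  using index_spin_leg[OF ladder_carrier(1)[of 1, unfolded one_add_one]] sum_raise[OF s, unfolded one_add_one]
    index_spin_leg[OF ladder_carrier(2)[of 1, unfolded one_add_one]] sum_lower[OF s, unfolded one_add_one]
    index_spin_leg[OF ladder_carrier(3)[of 1, unfolded one_add_one]] sum_weight[OF s, unfolded one_add_one]
  by (simp_all only: of_nat_1)

lemma index_total_op:
  assumes "\<And>n. f n \<in> carrier_mat (n + 1) (n + 1)"
  shows "(total_op nu nd nr f *\<^sub>v v) $ state_index k l m s =
    (up_leg nu nd nr (f nu) *\<^sub>v v) $ state_index k l m s + (down_leg nu nd nr (f nd) *\<^sub>v v) $ state_index k l m s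
    + (tan_leg nu nd nr (f nr) *\<^sub>v v) $ state_index k l m s + (spin_leg nu nd nr (f 1) *\<^sub>v v) $ state_index k l m s"
proof -
  let ?N = "state_dim nu nd nr"
  have car: "up_leg nu nd nr (f nu) \<in> carrier_mat ?N ?N" "down_leg nu nd nr (f nd) \<in> carrier_mat ?N ?N"
    "tan_leg nu nd nr (f nr) \<in> carrier_mat ?N ?N" "spin_leg nu nd nr (f 1) \<in> carrier_mat ?N ?N"
    using assms[of nu] assms[of nd] assms[of nr] assms[of 1]
    by (auto intro!: leg.leg_carrier[OF leg_up] leg.leg_carrier[OF leg_down] leg.leg_carrier[OF leg_tan]
      leg.leg_carrier[OF leg_spin] simp: numeral_2_eq_2)
  show ?thesis
    unfolding total_op_def using car v state_index_less[OF k l m s]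
    by (simp add: add_mult_distrib_mat_vec[of _ ?N ?N] del: index_mult_mat_vec)
qed

end

text \<open>This is 4 S . J_r, so that K is -1 minus it.\<close>

definition spin_orbit :: "complex mat" where
  "spin_orbit = mat_dot (spin_leg nu nd nr (raise 1)) (spin_leg nu nd nr (lower 1)) (spin_leg nu nd nr (weight 1))
     (tan_leg nu nd nr (raise nr)) (tan_leg nu nd nr (lower nr)) (tan_leg nu nd nr (weight nr))"

lemma ladder_leg_carrier:
  "spin_leg nu nd nr (raise 1) \<in> carrier_mat (state_dim nu nd nr) (state_dim nu nd nr)"
  "spin_leg nu nd nr (lower 1) \<in> carrier_mat (state_dim nu nd nr) (state_dim nu nd nr)"
  "spin_leg nu nd nr (weight 1) \<in> carrier_mat (state_dim nu nd nr) (state_dim nu nd nr)"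
  "tan_leg nu nd nr (raise nr) \<in> carrier_mat (state_dim nu nd nr) (state_dim nu nd nr)"
  "tan_leg nu nd nr (lower nr) \<in> carrier_mat (state_dim nu nd nr) (state_dim nu nd nr)"
  "tan_leg nu nd nr (weight nr) \<in> carrier_mat (state_dim nu nd nr) (state_dim nu nd nr)"
  using ladder_carrier[of 1, unfolded one_add_one]
  by (simp_all only: leg.leg_carrier[OF leg_spin] leg.leg_carrier[OF leg_tan] ladder_carrier)

lemma spin_orbit_carrier: "spin_orbit \<in> carrier_mat (state_dim nu nd nr) (state_dim nu nd nr)"
  unfolding spin_orbit_def mat_dot_def using ladder_leg_carrier
  by (auto intro!: add_carrier_mat smult_carrier_mat mult_carrier_mat)

text \<open>At fermion spin up, index 0, the term containing the lowering operator of the fermion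
  drops out. At \<open>m = 0\<close> the truncated index \<open>m - 1\<close> is harmless, since its
  coefficient vanishes.\<close>

lemma index_spin_orbit:
  assumes v: "v \<in> carrier_vec (state_dim nu nd nr)" and k: "k \<le> nu" "l \<le> nd" "m \<le> nr"
  shows "(spin_orbit *\<^sub>v v) $ state_index k l m 0 =
    2 * ladder_coeff nr m * v $ state_index k l (m - 1) 1 + (of_nat nr - 2 * of_nat m) * v $ state_index k l m 0"
proof -
  let ?N = "state_dim nu nd nr"
  let ?e = "spin_leg nu nd nr (raise 1)" and ?f = "spin_leg nu nd nr (lower 1)" and ?h = "spin_leg nu nd nr (weight 1)"
  let ?e' = "tan_leg nu nd nr (raise nr)" and ?f' = "tan_leg nu nd nr (lower nr)" and ?h' = "tan_leg nu nd nr (weight nr)"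
  note car = ladder_leg_carrier
  have i: "state_index k l m 0 < ?N" using k by (intro state_index_less) auto
  note sv = smult_mat_mult_vec[of _ ?N ?N, OF _ v]
  have comb: "(2 \<cdot>\<^sub>v (a + b) + d) $ i = 2 * (a $ i + b $ i) + d $ i"
    if "a \<in> carrier_vec ?N" "b \<in> carrier_vec ?N" "d \<in> carrier_vec ?N" "i < ?N" for a b d :: "complex Matrix.vec" and i
    using that by simp
  have vc: "?e' *\<^sub>v v \<in> carrier_vec ?N" "?f' *\<^sub>v v \<in> carrier_vec ?N" "?h' *\<^sub>v v \<in> carrier_vec ?N"
    using car v by auto
  have "spin_orbit *\<^sub>v v = 2 \<cdot>\<^sub>v (?e *\<^sub>v (?f' *\<^sub>v v) + ?f *\<^sub>v (?e' *\<^sub>v v)) + ?h *\<^sub>v (?h' *\<^sub>v v)"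
    unfolding spin_orbit_def mat_dot_def using car v
    by (simp add: add_mult_distrib_mat_vec[of _ ?N ?N] sv assoc_mult_mat_vec[of _ ?N ?N _ ?N]
      mult_carrier_mat[of _ ?N ?N _ ?N] del: One_nat_def)
  moreover have "?e *\<^sub>v (?f' *\<^sub>v v) \<in> carrier_vec ?N" "?f *\<^sub>v (?e' *\<^sub>v v) \<in> carrier_vec ?N" "?h *\<^sub>v (?h' *\<^sub>v v) \<in> carrier_vec ?N"
    using car vc by auto
  ultimately have "(spin_orbit *\<^sub>v v) $ state_index k l m 0 = 2 * ((?e *\<^sub>v (?f' *\<^sub>v v)) $ state_index k l m 0
      + (?f *\<^sub>v (?e' *\<^sub>v v)) $ state_index k l m 0) + (?h *\<^sub>v (?h' *\<^sub>v v)) $ state_index k l m 0"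
    using comb i by (simp only:)
  also have "(?e *\<^sub>v (?f' *\<^sub>v v)) $ state_index k l m 0 = ladder_coeff nr m * v $ state_index k l (m - 1) 1"
    unfolding index_spin_ladder(1)[OF vc(2) k le0] index_tan_ladder(2)[OF v k order_refl, unfolded One_nat_def[symmetric]]
    using index_tan_ladder(2)[OF v k, of "Suc 0"] by (simp add: ladder_coeff_def)
  also have "(?f *\<^sub>v (?e' *\<^sub>v v)) $ state_index k l m 0 = 0"
    unfolding index_spin_ladder(2)[OF vc(1) k le0] by simp
  also have "(?h *\<^sub>v (?h' *\<^sub>v v)) $ state_index k l m 0 = (of_nat nr - 2 * of_nat m) * v $ state_index k l m 0"
    unfolding index_spin_ladder(3)[OF vc(3) k le0] index_tan_ladder(3)[OF v k le0] by simp
  finally show ?thesis by (simp add: algebra_simps)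
qed

text \<open>At the highest weight of the first factor, total lowering has no contribution from that
  factor and expresses the components at \<open>l - 1\<close> through those at \<open>l\<close>.
  Total raising then expresses the components at \<open>k + 1\<close> through those at
  \<open>k\<close>.\<close>

lemma intertwiner_zeroI:
  assumes v: "v \<in> intertwiners nu nd nr"
    and base: "\<And>m s. m \<le> nr \<Longrightarrow> s \<le> 1 \<Longrightarrow> v $ state_index 0 nd m s = 0"
  shows "v = 0\<^sub>v (state_dim nu nd nr)"
proof -
  let ?N = "state_dim nu nd nr"
  have vN: "v \<in> carrier_vec ?N" and low: "total_op nu nd nr lower *\<^sub>v v = 0\<^sub>v ?N"
    and raise: "total_op nu nd nr raise *\<^sub>v v = 0\<^sub>v ?N"
    using v by (auto simp: intertwiners_eq)
  have first: "\<forall>m\<le>nr. \<forall>s\<le>1. v $ state_index 0 (nd - j) m s = 0" if "j \<le> nd" for j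
    using that
  proof (induction j)
    case 0
    then show ?case using base by simp
  next
    case (Suc j)
    let ?l = "nd - j"
    have l: "?l \<le> nd" "0 < ?l" "nd - Suc j = ?l - 1" using Suc.prems by auto
    have IH: "v $ state_index 0 ?l m s = 0" if "m \<le> nr" "s \<le> 1" for m s
      using Suc that by simp
    show ?case
    proof (intro allI impI)
      fix m s :: nat assume m: "m \<le> nr" and s: "s \<le> 1"
      note pos = le0[of nu] l(1) m s
      have "(total_op nu nd nr lower *\<^sub>v v) $ state_index 0 ?l m s = 0"
        unfolding low using state_index_less[OF pos] by simp
      then have "ladder_coeff nd ?l * v $ state_index 0 (?l - 1) m s = 0"
        unfolding index_total_op[OF vN pos ladder_carrier(2)] index_up_ladder(2)[OF vN pos] index_down_ladder(2)[OF vN pos]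
          index_tan_ladder(2)[OF vN pos] index_spin_ladder(2)[OF vN pos]
        using IH m s by simp
      with l show "v $ state_index 0 (nd - Suc j) m s = 0"
        using ladder_coeff_nonzero[of ?l nd] by simp
    qed
  qed
  have all: "\<forall>l\<le>nd. \<forall>m\<le>nr. \<forall>s\<le>1. v $ state_index k l m s = 0" if "k \<le> nu" for k
    using that
  proof (induction k)
    case 0
    show ?case
    proof (intro allI impI)
      fix l m s :: nat assume "l \<le> nd" "m \<le> nr" "s \<le> 1"
      then show "v $ state_index 0 l m s = 0" using first[of "nd - l"] by simp
    qed
  next
    case (Suc k)
    have IH: "v $ state_index k l m s = 0" if "l \<le> nd" "m \<le> nr" "s \<le> 1" for l m s
      using Suc that by simp
    show ?case
    proof (intro allI impI)
      fix l m s :: nat assume l: "l \<le> nd" and m: "m \<le> nr" and s: "s \<le> 1"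
      have k: "k \<le> nu" using Suc.prems by simp
      note pos = k l m s
      have "(total_op nu nd nr raise *\<^sub>v v) $ state_index k l m s = 0"
        unfolding raise using state_index_less[OF pos] by simp
      \<comment> \<open>At the lowest weight of a factor the successor index is out of range, but
        its coefficient is 0; the next two facts split in the same way.\<close>
      moreover have "ladder_coeff nd (Suc l) * v $ state_index k (Suc l) m s = 0"
        using IH[of "Suc l" m s] l m s by (cases "l = nd") auto
      moreover have "ladder_coeff nr (Suc m) * v $ state_index k l (Suc m) s = 0"
        using IH[of l "Suc m" s] l m s by (cases "m = nr") auto
      moreover have "ladder_coeff 1 (Suc s) * v $ state_index k l m (Suc s) = 0"
        using IH[of l m "Suc s"] l m s ladder_coeff_Suc[of 1] by (cases "s = 1") auto
      ultimately have "ladder_coeff nu (Suc k) * v $ state_index (Suc k) l m s = 0"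
        unfolding index_total_op[OF vN pos ladder_carrier(1)] index_up_ladder(1)[OF vN pos] index_down_ladder(1)[OF vN pos]
          index_tan_ladder(1)[OF vN pos] index_spin_ladder(1)[OF vN pos]
        by (simp only: add_0_right)
      then show "v $ state_index (Suc k) l m s = 0"
        using ladder_coeff_nonzero[of "Suc k" nu] Suc.prems by simp
    qed
  qed
  show ?thesis
  proof (rule eq_vecI)
    fix i assume "i < dim_vec (0\<^sub>v ?N :: complex Matrix.vec)"
    then have i: "i < ?N" by simp
    obtain k l m s where "k \<le> nu" "l \<le> nd" "m \<le> nr" "s \<le> 1" "i = state_index k l m s"
      using state_index_cases[OF i] .
    with all[of k] i show "v $ i = 0\<^sub>v ?N $ i" by simp
  qed (use vN in simp)
qed

text \<open>Weight conservation leaves two possible nonzero components of the form \<open>v(0, nd, m, s)\<close>, and the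
  eigenvalue equation of \<^const>\<open>spin_orbit\<close> relates them.\<close>
lemma spin_orbit_eigenvector_determined:
  obtains i where "i < state_dim nu nd nr"
    "\<And>v. v \<in> intertwiners nu nd nr \<Longrightarrow> spin_orbit *\<^sub>v v = \<kappa> \<cdot>\<^sub>v v \<Longrightarrow> v $ i = 0 \<Longrightarrow> v = 0\<^sub>v (state_dim nu nd nr)"
proof -
  let ?N = "state_dim nu nd nr"
  \<comment> \<open>Weight zero means nu - nd + nr + 1 = 2 (m + s), so nonzero components have
    \<open>m + s = M\<close>, at (M, 0) or (M - 1, 1). The first position is taken whenever it
    exists; for \<open>M > nr\<close> only (nr, 1) can remain.\<close>
  define M where "M = (nu + nr + 1 - nd) div 2"
  define i where "i = (if M \<le> nr then state_index 0 nd M 0 else state_index 0 nd nr 1)"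
  show thesis
  proof (rule that[of i])
    show "i < ?N" by (auto simp: i_def intro!: state_index_less)
    fix v assume v: "v \<in> intertwiners nu nd nr" and eig: "spin_orbit *\<^sub>v v = \<kappa> \<cdot>\<^sub>v v" and zero: "v $ i = 0"
    have vN: "v \<in> carrier_vec ?N" and wt: "total_op nu nd nr weight *\<^sub>v v = 0\<^sub>v ?N"
      using v by (auto simp: intertwiners_eq)
    have weight: "m + s = M" if m: "m \<le> nr" and s: "s \<le> 1" and nz: "v $ state_index 0 nd m s \<noteq> 0" for m s
    proof -
      note pos = le0[of nu] order_refl[of nd] m s
      have "(total_op nu nd nr weight *\<^sub>v v) $ state_index 0 nd m s = 0"
        unfolding wt using state_index_less[OF pos] by simp
      then have "(of_nat nu - of_nat nd + of_nat nr - 2 * of_nat m + 1 - 2 * of_nat s) * v $ state_index 0 nd m s = 0"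
        unfolding index_total_op[OF vN pos ladder_carrier(3)] index_up_ladder(3)[OF vN pos] index_down_ladder(3)[OF vN pos]
          index_tan_ladder(3)[OF vN pos] index_spin_ladder(3)[OF vN pos]
        by (simp add: algebra_simps)
      with nz have "of_nat nu - of_nat nd + of_nat nr - 2 * of_nat m + 1 - 2 * of_nat s = (0 :: complex)"
        by (metis mult_eq_0_iff)
      then have "complex_of_nat (nu + nr + 1) = of_nat (nd + 2 * (m + s))"
        by (simp add: algebra_simps)
      then have "nu + nr + 1 = nd + 2 * (m + s)" by (simp only: of_nat_eq_iff)
      then show ?thesis by (simp add: M_def)
    qed
    show "v = 0\<^sub>v ?N"
    proof (rule intertwiner_zeroI[OF v], rule ccontr)
      fix m s :: nat assume m: "m \<le> nr" and s: "s \<le> 1" and nz: "v $ state_index 0 nd m s \<noteq> 0"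
      have M: "m + s = M" using weight[OF m s nz] .
      show False
      proof (cases "M \<le> nr")
        case False
        with M m s have "m = nr" "s = 1" by auto
        with False zero nz show False by (simp add: i_def)
      next
        case True
        then have z: "v $ state_index 0 nd M 0 = 0" using zero by (simp add: i_def)
        have "s \<noteq> 0"
        proof
          assume "s = 0"
          with z nz M show False by simp
        qed
        with s M have s1: "s = 1" "m = M - 1" "0 < M" by auto
        \<comment> \<open>At (M, 0), where \<open>v\<close> vanishes, the eigenvalue equation
          retains only the component at (M - 1, 1), with a nonzero coefficient.\<close>
        have "(spin_orbit *\<^sub>v v) $ state_index 0 nd M 0 = 0"
          unfolding eig using z vN state_index_less[of 0 nd M 0] True by simp
        then have "2 * ladder_coeff nr M * v $ state_index 0 nd m s = 0"
          unfolding index_spin_orbit[OF vN le0 order_refl True] s1 z by simp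
        then show False
          using nz ladder_coeff_nonzero[OF s1(3) True] by simp
      qed
    qed
  qed
qed

end

section \<open>Dimension of the intertwiner space, and eigenvalues on a plane\<close>

lemma submodule_dim_le_1:
  assumes W: "submodule class_ring W (module_vec TYPE(complex) N)" and w: "w \<in> W"
    and multiples: "\<And>v. v \<in> W \<Longrightarrow> \<exists>c. v = c \<cdot>\<^sub>v w"
  shows "vectorspace.dim class_ring ((module_vec TYPE(complex) N)\<lparr>carrier := W\<rparr>) \<le> 1"
proof -
  interpret V: vec_space "TYPE(complex)" N .
  have vs: "vectorspace class_ring (module_vec TYPE(complex) N)" by (rule vec_vs)
  have sub: "VectorSpace.subspace class_ring W (module_vec TYPE(complex) N)"
    using vs W by (simp add: subspace_def)
  interpret S: vectorspace class_ring "(module_vec TYPE(complex) N)\<lparr>carrier := W\<rparr>"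
    by (rule vectorspace.subspace_is_vs[OF vs sub])
  have Wc: "W \<subseteq> carrier_vec N" using submodule.subset[OF W] by (simp add: module_vec_simps)
  have "V.span {w} = W"
  proof
    show "V.span {w} \<subseteq> W" by (rule V.span_is_subset[OF _ W]) (use w in simp)
    show "W \<subseteq> V.span {w}"
    proof
      fix v assume "v \<in> W"
      then obtain c where v: "v = c \<cdot>\<^sub>v w" using multiples by blast
      have "w \<in> V.span {w}" using V.in_own_span[of "{w}"] w Wc by auto
      then show "v \<in> V.span {w}" unfolding v using w Wc by (intro V.prod_in_span) auto
    qed
  qed
  moreover have "S.span {w} = V.span {w}"
    by (rule V.span_li_not_depend(1)[OF _ W]) (use w in simp)
  ultimately show ?thesis
    by (intro S.dim_le1I) (use w in auto)
qed

lemma intertwiners_submodule: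
  "submodule class_ring (intertwiners nu nd nr) (module_vec TYPE(complex) (state_dim nu nd nr))"
proof -
  interpret V: vec_space "TYPE(complex)" "state_dim nu nd nr" .
  let ?N = "state_dim nu nd nr"
  have car: "total_op nu nd nr raise \<in> carrier_mat ?N ?N" "total_op nu nd nr lower \<in> carrier_mat ?N ?N"
    "total_op nu nd nr weight \<in> carrier_mat ?N ?N"
    by (rule total_carrier[OF ladder_carrier(1)] total_carrier[OF ladder_carrier(2)] total_carrier[OF ladder_carrier(3)])+
  show ?thesis
  proof (unfold_locales, goal_cases)
    case 1
    show ?case by (auto simp: intertwiners_def module_vec_simps)
  next
    case (2 v w)
    then show ?case
      using car by (auto simp: intertwiners_eq module_vec_simps mult_add_distrib_mat_vec[of _ ?N ?N])
  next
    case 3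
    show ?case using car by (auto simp: intertwiners_eq module_vec_simps)
  next
    case (4 c v)
    then show ?case
      using car by (auto simp: intertwiners_eq module_vec_simps mult_mat_vec[of _ ?N ?N])
  qed
qed

lemma intertwiners_add:
  "v \<in> intertwiners nu nd nr \<Longrightarrow> w \<in> intertwiners nu nd nr \<Longrightarrow> v + w \<in> intertwiners nu nd nr"
  using submodule.m_closed[OF intertwiners_submodule] by (simp add: module_vec_simps)

lemma intertwiners_smult: "v \<in> intertwiners nu nd nr \<Longrightarrow> c \<cdot>\<^sub>v v \<in> intertwiners nu nd nr"
  using submodule.smult_closed[OF intertwiners_submodule, of c v] by (simp add: module_vec_simps)

text \<open>Subtracting the multiple of \<open>w\<close> that clears the determining coordinate
  leaves an eigenvector which must be zero.\<close>

lemma spin_orbit_eigenvectors_proportional: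
  assumes w: "w \<in> intertwiners nu nd nr" "spin_orbit nu nd nr *\<^sub>v w = \<kappa> \<cdot>\<^sub>v w" "w \<noteq> 0\<^sub>v (state_dim nu nd nr)"
    and v: "v \<in> intertwiners nu nd nr" "spin_orbit nu nd nr *\<^sub>v v = \<kappa> \<cdot>\<^sub>v v"
  shows "\<exists>c. v = c \<cdot>\<^sub>v w"
proof -
  let ?N = "state_dim nu nd nr" and ?K = "spin_orbit nu nd nr"
  obtain i where i: "i < ?N" and det: "\<And>u. u \<in> intertwiners nu nd nr \<Longrightarrow> ?K *\<^sub>v u = \<kappa> \<cdot>\<^sub>v u \<Longrightarrow> u $ i = 0 \<Longrightarrow> u = 0\<^sub>v ?N"
    using spin_orbit_eigenvector_determined[of nu nd nr \<kappa>] by blast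
  note K = spin_orbit_carrier[of nu nd nr]
  have vN: "v \<in> carrier_vec ?N" and wN: "w \<in> carrier_vec ?N" using v w by (auto simp: intertwiners_def)
  have wi: "w $ i \<noteq> 0" using det[OF w(1,2)] w(3) by blast
  define c where "c = v $ i / w $ i"
  define u where "u = v + (- c) \<cdot>\<^sub>v w"
  have u: "u \<in> intertwiners nu nd nr" unfolding u_def by (intro intertwiners_add intertwiners_smult v w)
  have "?K *\<^sub>v u = ?K *\<^sub>v v + (- c) \<cdot>\<^sub>v (?K *\<^sub>v w)"
    unfolding u_def using K vN wN by (simp add: mult_add_distrib_mat_vec[of _ ?N ?N] mult_mat_vec[of _ ?N ?N])
  also have "\<dots> = \<kappa> \<cdot>\<^sub>v u"
    unfolding v(2) w(2) u_def using vN wN by (intro eq_vecI) (auto simp: algebra_simps)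
  finally have "?K *\<^sub>v u = \<kappa> \<cdot>\<^sub>v u" .
  moreover have "u $ i = 0" using i vN wN wi by (simp add: u_def c_def)
  ultimately have "u = 0\<^sub>v ?N" using det u by blast
  then have z: "u $ j = 0" if "j < ?N" for j using that by simp
  have "v = c \<cdot>\<^sub>v w"
    using z vN wN by (intro eq_vecI) (auto simp: u_def)
  then show ?thesis ..
qed

text \<open>Used in contrapositive form: on a two-dimensional intertwiner space K cannot be
  scalar.\<close>

lemma intertwiner_dim_le_1:
  assumes "\<And>v. v \<in> intertwiners nu nd nr \<Longrightarrow> spin_orbit nu nd nr *\<^sub>v v = \<kappa> \<cdot>\<^sub>v v"
  shows "intertwiner_dim nu nd nr \<le> 1"
proof -
  let ?N = "state_dim nu nd nr"
  have "\<exists>w \<in> intertwiners nu nd nr. \<forall>v \<in> intertwiners nu nd nr. \<exists>c. v = c \<cdot>\<^sub>v w"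
  proof (cases "\<exists>w \<in> intertwiners nu nd nr. w \<noteq> 0\<^sub>v ?N")
    case True
    then show ?thesis using spin_orbit_eigenvectors_proportional assms by metis
  next
    case False
    have "0\<^sub>v ?N \<in> intertwiners nu nd nr"
      using submodule.zero_closed[OF intertwiners_submodule] by (simp add: module_vec_simps)
    moreover have "0\<^sub>v ?N = 1 \<cdot>\<^sub>v (0\<^sub>v ?N :: complex Matrix.vec)" by (intro eq_vecI) auto
    ultimately show ?thesis using False by metis
  qed
  then show ?thesis
    unfolding intertwiner_dim_def using submodule_dim_le_1[OF intertwiners_submodule] by blast
qed

text \<open>The hypotheses on trace and determinant factor the characteristic polynomial of the
  restriction as (c - c1) (c - c2).\<close>

lemma two_dim_eigenvalues:
  fixes M :: "complex mat"
  assumes M: "M \<in> carrier_mat n n" and W: "W \<subseteq> carrier_vec n" and u: "u \<in> carrier_vec n" and w: "w \<in> carrier_vec n"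
    and span: "W = {x \<cdot>\<^sub>v u + y \<cdot>\<^sub>v w | x y. True}"
    and indep: "\<And>x y. x \<cdot>\<^sub>v u + y \<cdot>\<^sub>v w = 0\<^sub>v n \<Longrightarrow> x = 0 \<and> y = 0"
    and Mu: "M *\<^sub>v u = p \<cdot>\<^sub>v u + q \<cdot>\<^sub>v w" and Mw: "M *\<^sub>v w = q' \<cdot>\<^sub>v u + s \<cdot>\<^sub>v w"
    and trace: "p + s = c1 + c2" and det: "p * s - q * q' = c1 * c2"
  shows "eigenvalues_on W M = {c1, c2}"
proof -
  have app: "M *\<^sub>v (x \<cdot>\<^sub>v u + y \<cdot>\<^sub>v w) = (x * p + y * q') \<cdot>\<^sub>v u + (x * q + y * s) \<cdot>\<^sub>v w" for x y
  proof -
    have "M *\<^sub>v (x \<cdot>\<^sub>v u + y \<cdot>\<^sub>v w) = x \<cdot>\<^sub>v (M *\<^sub>v u) + y \<cdot>\<^sub>v (M *\<^sub>v w)"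
      using M u w by (simp add: mult_add_distrib_mat_vec[of _ n n] mult_mat_vec[of _ n n])
    also have "\<dots> = (x * p + y * q') \<cdot>\<^sub>v u + (x * q + y * s) \<cdot>\<^sub>v w"
      unfolding Mu Mw using u w by (intro eq_vecI) (auto simp: algebra_simps)
    finally show ?thesis .
  qed
  have coords: "x = x' \<and> y = y'" if "x \<cdot>\<^sub>v u + y \<cdot>\<^sub>v w = x' \<cdot>\<^sub>v u + y' \<cdot>\<^sub>v w" for x y x' y'
  proof -
    have "(x - x') \<cdot>\<^sub>v u + (y - y') \<cdot>\<^sub>v w = (x \<cdot>\<^sub>v u + y \<cdot>\<^sub>v w) - (x' \<cdot>\<^sub>v u + y' \<cdot>\<^sub>v w)"
      using u w by (intro eq_vecI) (auto simp: algebra_simps)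
    also have "\<dots> = 0\<^sub>v n" unfolding that using u w by (intro eq_vecI) auto
    finally show ?thesis using indep by force
  qed
  have sc: "c \<cdot>\<^sub>v (x \<cdot>\<^sub>v u + y \<cdot>\<^sub>v w) = (c * x) \<cdot>\<^sub>v u + (c * y) \<cdot>\<^sub>v w" for c x y
    using u w by (intro eq_vecI) (auto simp: algebra_simps)
  have eig: "M *\<^sub>v (x \<cdot>\<^sub>v u + y \<cdot>\<^sub>v w) = c \<cdot>\<^sub>v (x \<cdot>\<^sub>v u + y \<cdot>\<^sub>v w) \<longleftrightarrow> x * p + y * q' = c * x \<and> x * q + y * s = c * y" for c x y
    unfolding app sc using coords by metis
  have nz: "x \<cdot>\<^sub>v u + y \<cdot>\<^sub>v w = 0\<^sub>v n \<longleftrightarrow> x = 0 \<and> y = 0" for x y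
    using indep[of x y] u w by (auto intro!: eq_vecI)
  have dv: "dim_vec (x \<cdot>\<^sub>v u + y \<cdot>\<^sub>v w) = n" for x y using u w by simp
  have root: "(c - p) * (c - s) = q * q' \<longleftrightarrow> c = c1 \<or> c = c2" for c
  proof -
    have "(c - p) * (c - s) - q * q' = (c - c1) * (c - c2)"
    proof -
      have "(c - p) * (c - s) - q * q' = c * c - c * (p + s) + (p * s - q * q')" by (simp add: algebra_simps)
      also have "\<dots> = (c - c1) * (c - c2)" unfolding trace det by (simp add: algebra_simps)
      finally show ?thesis .
    qed
    then show ?thesis by (metis eq_iff_diff_eq_0 mult_eq_0_iff)
  qed
  have "c \<in> eigenvalues_on W M \<longleftrightarrow> (\<exists>x y. (x \<noteq> 0 \<or> y \<noteq> 0) \<and> x * p + y * q' = c * x \<and> x * q + y * s = c * y)" for c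
  proof
    assume "c \<in> eigenvalues_on W M"
    then obtain v where v: "v \<in> W" "v \<noteq> 0\<^sub>v (dim_vec v)" "M *\<^sub>v v = c \<cdot>\<^sub>v v" by (auto simp: eigenvalues_on_def)
    then obtain x y where xy: "v = x \<cdot>\<^sub>v u + y \<cdot>\<^sub>v w" using span by auto
    show "\<exists>x y. (x \<noteq> 0 \<or> y \<noteq> 0) \<and> x * p + y * q' = c * x \<and> x * q + y * s = c * y"
      using v(2,3) unfolding xy dv nz eig by blast
  next
    assume "\<exists>x y. (x \<noteq> 0 \<or> y \<noteq> 0) \<and> x * p + y * q' = c * x \<and> x * q + y * s = c * y"
    then obtain x y where xy: "\<not> (x = 0 \<and> y = 0)" "x * p + y * q' = c * x \<and> x * q + y * s = c * y" by auto
    then have "x \<cdot>\<^sub>v u + y \<cdot>\<^sub>v w \<noteq> 0\<^sub>v (dim_vec (x \<cdot>\<^sub>v u + y \<cdot>\<^sub>v w))" "M *\<^sub>v (x \<cdot>\<^sub>v u + y \<cdot>\<^sub>v w) = c \<cdot>\<^sub>v (x \<cdot>\<^sub>v u + y \<cdot>\<^sub>v w)"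
      unfolding dv nz eig by blast+
    moreover have "x \<cdot>\<^sub>v u + y \<cdot>\<^sub>v w \<in> W" using span by auto
    ultimately show "c \<in> eigenvalues_on W M" unfolding eigenvalues_on_def by blast
  qed
  moreover have "(\<exists>x y. (x \<noteq> 0 \<or> y \<noteq> 0) \<and> x * p + y * q' = c * x \<and> x * q + y * s = c * y) \<longleftrightarrow> (c - p) * (c - s) = q * q'" for c
  proof
    assume "\<exists>x y. (x \<noteq> 0 \<or> y \<noteq> 0) \<and> x * p + y * q' = c * x \<and> x * q + y * s = c * y"
    then obtain x y where xy: "x \<noteq> 0 \<or> y \<noteq> 0" and 1: "y * q' = (c - p) * x" and 2: "x * q = (c - s) * y"
      by (auto simp: algebra_simps)
    have "((c - p) * (c - s) - q * q') * x = (c - s) * ((c - p) * x) - (x * q) * q'" by (simp add: algebra_simps)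
    also have "\<dots> = 0" unfolding 1[symmetric] 2 by (simp add: algebra_simps)
    finally have x: "((c - p) * (c - s) - q * q') * x = 0" .
    have "((c - p) * (c - s) - q * q') * y = (c - p) * ((c - s) * y) - (y * q') * q" by (simp add: algebra_simps)
    also have "\<dots> = 0" unfolding 2[symmetric] 1 by (simp add: algebra_simps)
    finally show "(c - p) * (c - s) = q * q'" using x xy by auto
  next
    assume eq: "(c - p) * (c - s) = q * q'"
    show "\<exists>x y. (x \<noteq> 0 \<or> y \<noteq> 0) \<and> x * p + y * q' = c * x \<and> x * q + y * s = c * y"
    \<comment> \<open>For nonzero \<open>q'\<close> the coordinates (q', c - p) solve the first
      equation, and the characteristic equation gives the second. Otherwise the matrix is triangular
      with eigenvalues \<open>p\<close> and \<open>s\<close>.\<close>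
    proof (cases "q' = 0")
      case False
      then show ?thesis using eq by (intro exI[of _ q'] exI[of _ "c - p"]) (simp add: algebra_simps)
    next
      case q': True
      show ?thesis
      proof (cases "c = s")
        case True
        with q' show ?thesis by (intro exI[of _ 0] exI[of _ 1]) simp
      next
        case False
        with q' eq have "c = p" by simp
        with False q' show ?thesis by (intro exI[of _ "p - s"] exI[of _ q]) (simp add: algebra_simps)
      qed
    qed
  qed
  ultimately show ?thesis using root by blast
qed

section \<open>The cosine operator on intertwiners\<close>

lemma state_dim_pos: "state_dim nu nd nr > 0"
  by (simp add: state_dim_def)

text \<open>For a leg \<open>f\<close> this is a ring homomorphism from matrices on one tensor
  factor into \<open>lin_op\<close>.\<close>

definition leg_op :: "nat \<Rightarrow> (complex mat \<Rightarrow> complex mat) \<Rightarrow> complex mat \<Rightarrow> lin_op" where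
  "leg_op N f A = op_of N (f A)"

context leg
begin

context
  assumes N: "N > 0"
begin

lemma leg_op_mult:
  "A \<in> carrier_mat k k \<Longrightarrow> B \<in> carrier_mat k k \<Longrightarrow> leg_op N f (A * B) = leg_op N f A * leg_op N f B"
  by (simp add: leg_op_def leg_mult op_of_mult[OF N] leg_carrier)

lemma leg_op_add:
  "A \<in> carrier_mat k k \<Longrightarrow> B \<in> carrier_mat k k \<Longrightarrow> leg_op N f (A + B) = leg_op N f A + leg_op N f B"
  by (simp add: leg_op_def leg_add op_of_add[OF N] leg_carrier)

lemma leg_op_smult:
  "A \<in> carrier_mat k k \<Longrightarrow> leg_op N f (of_int z \<cdot>\<^sub>m A) = of_int z * leg_op N f A"
  by (simp add: leg_op_def leg_smult op_of_smult[OF N] leg_carrier)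

lemma leg_op_minus:
  assumes "A \<in> carrier_mat k k" "B \<in> carrier_mat k k"
  shows "leg_op N f (A - B) = leg_op N f A - leg_op N f B"
proof -
  have "A - B = A + of_int (- 1) \<cdot>\<^sub>m B" by (rule eq_matI) (use assms in auto)
  then show ?thesis
    using assms leg_op_add[of A "of_int (- 1) \<cdot>\<^sub>m B"] leg_op_smult[of B "- 1"] by simp
qed

lemma leg_op_one: "leg_op N f (1\<^sub>m k) = 1"
  by (simp add: leg_op_def leg_one op_of_one[OF N])

lemma leg_op_zero: "leg_op N f (0\<^sub>m k k) = 0"
proof -
  have "0\<^sub>m k k = 1\<^sub>m k - (1\<^sub>m k :: complex mat)" by (rule eq_matI) auto
  then show ?thesis by (simp add: leg_op_minus)
qed

lemma leg_op_ladder: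
  assumes k: "k = n + 1"
  shows "leg_op N f (lower n) * leg_op N f (raise n) = leg_op N f (raise n) * leg_op N f (lower n) - leg_op N f (weight n)"
    "leg_op N f (weight n) * leg_op N f (raise n) = leg_op N f (raise n) * leg_op N f (weight n) + leg_op N f (raise n) + leg_op N f (raise n)"
    "leg_op N f (weight n) * leg_op N f (lower n) = leg_op N f (lower n) * leg_op N f (weight n) - leg_op N f (lower n) - leg_op N f (lower n)"
    "spin_dot (leg_op N f (raise n)) (leg_op N f (lower n)) (leg_op N f (weight n)) (leg_op N f (raise n)) (leg_op N f (lower n)) (leg_op N f (weight n))
      = of_int ((int n + 1) * (int n + 1) - 1)"
proof -
  note c = ladder_carrier[of n, folded k]
  note cm = mult_carrier_mat[OF c(1) c(1)] mult_carrier_mat[OF c(1) c(2)] mult_carrier_mat[OF c(1) c(3)]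
    mult_carrier_mat[OF c(2) c(1)] mult_carrier_mat[OF c(2) c(3)] mult_carrier_mat[OF c(3) c(3)]
  show "leg_op N f (lower n) * leg_op N f (raise n) = leg_op N f (raise n) * leg_op N f (lower n) - leg_op N f (weight n)"
    by (simp only: leg_op_mult[symmetric] leg_op_minus[symmetric] c cm ladder_relations(1))
  show "leg_op N f (weight n) * leg_op N f (raise n) = leg_op N f (raise n) * leg_op N f (weight n) + leg_op N f (raise n) + leg_op N f (raise n)"
    by (simp only: leg_op_mult[symmetric] leg_op_add[symmetric] c cm ladder_relations(2) add_carrier_mat)
  show "leg_op N f (weight n) * leg_op N f (lower n) = leg_op N f (lower n) * leg_op N f (weight n) - leg_op N f (lower n) - leg_op N f (lower n)"
    by (simp only: leg_op_mult[symmetric] leg_op_minus[symmetric] c cm ladder_relations(3) minus_carrier_mat)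
  have "leg_op N f (mat_dot (raise n) (lower n) (weight n) (raise n) (lower n) (weight n)) = of_int ((int n + 1) * (int n + 1) - 1)"
    unfolding ladder_casimir k[symmetric] by (simp only: leg_op_smult one_carrier_mat leg_op_one mult_1_right)
  moreover have "leg_op N f (mat_dot (raise n) (lower n) (weight n) (raise n) (lower n) (weight n)) =
      spin_dot (leg_op N f (raise n)) (leg_op N f (lower n)) (leg_op N f (weight n)) (leg_op N f (raise n)) (leg_op N f (lower n)) (leg_op N f (weight n))"
  proof -
    have X: "raise n * lower n + lower n * raise n \<in> carrier_mat k k"
      by (rule add_carrier_mat[OF cm(4)])
    have "leg_op N f (2 \<cdot>\<^sub>m (raise n * lower n + lower n * raise n)) = 2 * leg_op N f (raise n * lower n + lower n * raise n)"
      using leg_op_smult[OF X, of 2] by simp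
    then show ?thesis
      unfolding mat_dot_def spin_dot_def
      by (simp only: leg_op_add[OF smult_carrier_mat[OF X] cm(6)] leg_op_add[OF cm(2) cm(4)] leg_op_mult c)
  qed
  ultimately show "spin_dot (leg_op N f (raise n)) (leg_op N f (lower n)) (leg_op N f (weight n)) (leg_op N f (raise n)) (leg_op N f (lower n)) (leg_op N f (weight n))
      = of_int ((int n + 1) * (int n + 1) - 1)" by simp
qed

end
end


context four_spins
begin

text \<open>If all components of V kill \<open>w\<close>, so do their commutators, which are the
  components of L. Then J_u and J_d kill \<open>w\<close> separately, and hence so do their
  Casimirs. The absence of 2-torsion permits the halving.\<close>

lemma difference_kernel:
  assumes torsion: "\<And>z :: 'a. z + z = 0 \<Longrightarrow> z = 0"
    and w: "(eu - ed) * w = 0" "(fu - fd) * w = 0" "(hu - hd) * w = 0"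
  shows "of_int (a * a - 1) * w = 0" "of_int (b * b - 1) * w = 0"
proof -
  have eq: "ed * w = eu * w" "fd * w = fu * w" "hd * w = hu * w"
    using w by (simp_all add: algebra_simps)
  have "(fu - fd) * ((eu - ed) * w) - (eu - ed) * ((fu - fd) * w) = - ((hu + hd) * w)"
    by (simp add: rel_simps algebra_simps)
  then have "(hu + hd) * w = 0" using w by simp
  then have hu: "hu * w = 0" using eq by - (rule torsion, simp add: distrib_right)
  have "(hu - hd) * ((eu - ed) * w) - (eu - ed) * ((hu - hd) * w) = ((eu + ed) + (eu + ed)) * w"
    by (simp add: rel_simps algebra_simps)
  then have "(eu + ed) * w + (eu + ed) * w = 0" using w by (simp only: distrib_right) simp
  then have "(eu + ed) * w = 0" by (rule torsion)
  then have eu: "eu * w = 0" using eq by - (rule torsion, simp add: distrib_right)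
  have "(fu - fd) * ((hu - hd) * w) - (hu - hd) * ((fu - fd) * w) = ((fu + fd) + (fu + fd)) * w"
    by (simp add: rel_simps algebra_simps)
  then have "(fu + fd) * w + (fu + fd) * w = 0" using w by (simp only: distrib_right) simp
  then have "(fu + fd) * w = 0" by (rule torsion)
  then have fu: "fu * w = 0" using eq by - (rule torsion, simp add: distrib_right)
  show "of_int (a * a - 1) * w = 0"
    unfolding casimir_u[symmetric] spin_dot_def by (simp add: distrib_right mult.assoc eu fu hu)
  show "of_int (b * b - 1) * w = 0"
    unfolding casimir_d[symmetric] spin_dot_def by (simp add: distrib_right mult.assoc eq eu fu hu)
qed

end

lemma lin_op_torsion: "z + z = 0 \<Longrightarrow> z = (0 :: lin_op)"
  by (simp add: app_inject[symmetric] app_simps fun_eq_iff)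

section \<open>Dot products in Cartesian and ladder components, and their positivity\<close>

lemma mat_dot_carrier:
  assumes "{e, f, h, e', f', h'} \<subseteq> carrier_mat n n"
  shows "mat_dot e f h e' f' h' \<in> carrier_mat n n"
  using assms unfolding mat_dot_def by (auto intro!: add_carrier_mat smult_carrier_mat mult_carrier_mat)

lemma op_of_mat_dot:
  assumes N: "N > 0" and c: "{e, f, h, e', f', h'} \<subseteq> carrier_mat N N"
  shows "op_of N (mat_dot e f h e' f' h') =
    spin_dot (op_of N e) (op_of N f) (op_of N h) (op_of N e') (op_of N f') (op_of N h')"
proof -
  have cm: "e * f' \<in> carrier_mat N N" "f * e' \<in> carrier_mat N N" "h * h' \<in> carrier_mat N N"
    using c by (auto intro: mult_carrier_mat)
  have "op_of N (2 \<cdot>\<^sub>m (e * f' + f * e')) = 2 * op_of N (e * f' + f * e')"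
    using op_of_smult[OF N, of "e * f' + f * e'" 2] cm by simp
  then show ?thesis
    unfolding mat_dot_def spin_dot_def using c cm by (simp add: op_of_add[OF N] op_of_mult[OF N])
qed

text \<open>In the first two summands the products e e' and f f' cancel because (-i/2)^2 = -1/4; the
  mixed products double.\<close>

lemma op_dot_ladder:
  assumes c: "{e, f, h, e', f', h'} \<subseteq> carrier_mat n n"
    and X: "X 1 = (1 / 2) \<cdot>\<^sub>m (e + f)" "X 2 = (- \<i> / 2) \<cdot>\<^sub>m (e - f)" "X 3 = (1 / 2) \<cdot>\<^sub>m h"
    and Y: "Y 1 = (1 / 2) \<cdot>\<^sub>m (e' + f')" "Y 2 = (- \<i> / 2) \<cdot>\<^sub>m (e' - f')" "Y 3 = (1 / 2) \<cdot>\<^sub>m h'"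
  shows "op_dot X Y = (1 / 4) \<cdot>\<^sub>m mat_dot e f h e' f' h'"
proof (rule eq_matI)
  have c': "e \<in> carrier_mat n n" "f \<in> carrier_mat n n" "h \<in> carrier_mat n n"
    "e' \<in> carrier_mat n n" "f' \<in> carrier_mat n n" "h' \<in> carrier_mat n n" using c by auto
  have XY: "X 1 \<in> carrier_mat n n" "X 2 \<in> carrier_mat n n" "X 3 \<in> carrier_mat n n"
    "Y 1 \<in> carrier_mat n n" "Y 2 \<in> carrier_mat n n" "Y 3 \<in> carrier_mat n n"
    unfolding X Y using c' by (auto intro: minus_carrier_mat)
  have md: "mat_dot e f h e' f' h' \<in> carrier_mat n n" by (rule mat_dot_carrier[OF c])
  have entry: "(A * B) $$ (i, j) = (\<Sum>k<n. A $$ (i, k) * B $$ (k, j))"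
    if "A \<in> carrier_mat n n" "B \<in> carrier_mat n n" "i < n" "j < n" for A B :: "complex mat" and i j
    using that by (auto simp: scalar_prod_def atLeast0LessThan)
  show "dim_row (op_dot X Y) = dim_row ((1 / 4) \<cdot>\<^sub>m mat_dot e f h e' f' h')"
    "dim_col (op_dot X Y) = dim_col ((1 / 4) \<cdot>\<^sub>m mat_dot e f h e' f' h')"
    using XY md by (auto simp: op_dot_def)
  fix i j assume "i < dim_row ((1 / 4) \<cdot>\<^sub>m mat_dot e f h e' f' h')" "j < dim_col ((1 / 4) \<cdot>\<^sub>m mat_dot e f h e' f' h')"
  then have ij: "i < n" "j < n" using md by auto
  have "op_dot X Y $$ (i, j) = (X 1 * Y 1) $$ (i, j) + (X 2 * Y 2) $$ (i, j) + (X 3 * Y 3) $$ (i, j)"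
    using XY ij by (simp add: op_dot_def del: index_mult_mat(1) One_nat_def)
  also have "\<dots> = (\<Sum>k<n. X 1 $$ (i, k) * Y 1 $$ (k, j) + X 2 $$ (i, k) * Y 2 $$ (k, j) + X 3 $$ (i, k) * Y 3 $$ (k, j))"
    by (simp only: entry XY ij sum.distrib)
  also have "\<dots> = (\<Sum>k<n. 1 / 4 * (2 * (e $$ (i, k) * f' $$ (k, j) + f $$ (i, k) * e' $$ (k, j)) + h $$ (i, k) * h' $$ (k, j)))"
    unfolding X Y using c' ij by (intro sum.cong) (auto simp: field_simps)
  also have "\<dots> = 1 / 4 * (2 * ((e * f') $$ (i, j) + (f * e') $$ (i, j)) + (h * h') $$ (i, j))"
    by (simp only: entry c' ij sum.distrib sum_distrib_left[symmetric])
  also have "\<dots> = ((1 / 4) \<cdot>\<^sub>m mat_dot e f h e' f' h') $$ (i, j)"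
    using c' ij by (simp add: mat_dot_def del: index_mult_mat(1))
  finally show "op_dot X Y $$ (i, j) = ((1 / 4) \<cdot>\<^sub>m mat_dot e f h e' f' h') $$ (i, j)" .
qed

lemma spin_op_carrier: "spin_op n i \<in> carrier_mat (n + 1) (n + 1)"
  by (simp add: spin_op_def)

lemma spin_op_hermitian: "i \<in> {1, 2, 3} \<Longrightarrow> mat_adjoint (spin_op n i) = spin_op n i"
proof -
  have "mat_adjoint (raise n + lower n) = raise n + lower n"
    using mat_adjoint_add[OF ladder_carrier(1,2)] by (simp add: ladder_adjoint comm_add_mat[OF ladder_carrier(1,2)])
  moreover have "mat_adjoint (raise n - lower n) = (- 1) \<cdot>\<^sub>m (raise n - lower n)"
    unfolding mat_adjoint_minus[OF ladder_carrier(1,2)] ladder_adjoint by (rule eq_matI) auto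
  moreover have "cnj (- \<i> / 2) \<cdot>\<^sub>m ((- 1) \<cdot>\<^sub>m (raise n - lower n)) = (- \<i> / 2) \<cdot>\<^sub>m (raise n - lower n)"
    by (rule eq_matI) (auto simp: algebra_simps)
  ultimately have "mat_adjoint (spin_op n 1) = spin_op n 1" "mat_adjoint (spin_op n 2) = spin_op n 2"
    "mat_adjoint (spin_op n 3) = spin_op n 3"
    unfolding spin_op_ladder mat_adjoint_smult ladder_adjoint by simp_all
  then show "i \<in> {1, 2, 3} \<Longrightarrow> mat_adjoint (spin_op n i) = spin_op n i"
    by blast
qed

lemma real_inner_self: "Im (v \<bullet>c v) = 0 \<and> Re (v \<bullet>c v) \<ge> 0"
  unfolding cscalar_self by (simp add: sum_nonneg)

text \<open>The quadratic form at \<open>v\<close> is the sum of the squared lengths of the three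
  vectors V_i v, so it is nonnegative and vanishes only if each of them does.\<close>

lemma op_dot_self_psd:
  fixes v :: "complex Matrix.vec"
  assumes V: "\<And>i. i \<in> {1, 2, 3} \<Longrightarrow> V i \<in> carrier_mat n n" "\<And>i. i \<in> {1, 2, 3} \<Longrightarrow> mat_adjoint (V i) = V i"
  shows "pos_semidef (op_dot V V)"
    and "v \<in> carrier_vec n \<Longrightarrow> op_dot V V *\<^sub>v v = 0\<^sub>v n \<Longrightarrow> i \<in> {1, 2, 3} \<Longrightarrow> V i *\<^sub>v v = 0\<^sub>v n"
proof -
  have c: "V 1 \<in> carrier_mat n n" "V 2 \<in> carrier_mat n n" "V 3 \<in> carrier_mat n n"
    and h: "mat_adjoint (V 1) = V 1" "mat_adjoint (V 2) = V 2" "mat_adjoint (V 3) = V 3"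
    using V by blast+
  have M: "op_dot V V \<in> carrier_mat n n"
    unfolding op_dot_def using c by (auto intro!: add_carrier_mat mult_carrier_mat)
  have sq: "V 1 * V 1 \<in> carrier_mat n n" "V 2 * V 2 \<in> carrier_mat n n" "V 3 * V 3 \<in> carrier_mat n n"
    using c by auto
  have quad: "(op_dot V V *\<^sub>v v) \<bullet>c v = (V 1 *\<^sub>v v) \<bullet>c (V 1 *\<^sub>v v) + (V 2 *\<^sub>v v) \<bullet>c (V 2 *\<^sub>v v) + (V 3 *\<^sub>v v) \<bullet>c (V 3 *\<^sub>v v)"
    if v: "v \<in> carrier_vec n" for v :: "complex Matrix.vec"
  proof -
    have one: "(A *\<^sub>v (A *\<^sub>v v)) \<bullet>c v = (A *\<^sub>v v) \<bullet>c (A *\<^sub>v v)"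
      if "A \<in> carrier_mat n n" "mat_adjoint A = A" for A
      using inner_adjoint[OF that(1), of "A *\<^sub>v v" v] that v by (simp add: mult_mat_vec_carrier[of _ n n])
    have cv: "V 1 *\<^sub>v (V 1 *\<^sub>v v) \<in> carrier_vec n" "V 2 *\<^sub>v (V 2 *\<^sub>v v) \<in> carrier_vec n" "V 3 *\<^sub>v (V 3 *\<^sub>v v) \<in> carrier_vec n"
      using c v by (auto intro!: mult_mat_vec_carrier)
    have "op_dot V V *\<^sub>v v = V 1 *\<^sub>v (V 1 *\<^sub>v v) + V 2 *\<^sub>v (V 2 *\<^sub>v v) + V 3 *\<^sub>v (V 3 *\<^sub>v v)"
      unfolding op_dot_def using c sq v
      by (simp add: add_mult_distrib_mat_vec[of _ n n] assoc_mult_mat_vec[of _ n n _ n] del: One_nat_def)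
    then show ?thesis
      using cv v c h one by (simp add: add_scalar_prod_distrib[of _ n] del: One_nat_def)
  qed
  have "mat_adjoint (op_dot V V) = op_dot V V"
    unfolding op_dot_def using c h sq
    by (simp add: mat_adjoint_add[of _ n n] mat_adjoint_mult del: One_nat_def)
  then show "pos_semidef (op_dot V V)"
    unfolding pos_semidef_def
  proof (intro conjI ballI)
    fix v :: "complex Matrix.vec" assume "v \<in> carrier_vec (dim_row (op_dot V V))"
    then have v: "v \<in> carrier_vec n" using M by simp
    show "0 \<le> (op_dot V V *\<^sub>v v) \<bullet>c v"
      unfolding quad[OF v] using real_inner_self[of "V 1 *\<^sub>v v"] real_inner_self[of "V 2 *\<^sub>v v"] real_inner_self[of "V 3 *\<^sub>v v"]
      by (simp add: less_eq_complex_def complex_eq_iff)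
  qed (use M in auto)
  assume v: "v \<in> carrier_vec n" and "op_dot V V *\<^sub>v v = 0\<^sub>v n" and i: "i \<in> {1, 2, 3}"
  then have "(V 1 *\<^sub>v v) \<bullet>c (V 1 *\<^sub>v v) + (V 2 *\<^sub>v v) \<bullet>c (V 2 *\<^sub>v v) + (V 3 *\<^sub>v v) \<bullet>c (V 3 *\<^sub>v v) = 0"
    using quad[OF v] by simp
  then have "Re ((V i *\<^sub>v v) \<bullet>c (V i *\<^sub>v v)) = 0"
    using real_inner_self[of "V 1 *\<^sub>v v"] real_inner_self[of "V 2 *\<^sub>v v"] real_inner_self[of "V 3 *\<^sub>v v"] i
    by (auto simp: complex_eq_iff add_nonneg_eq_0_iff simp del: One_nat_def)
  then have "(V i *\<^sub>v v) \<bullet>c (V i *\<^sub>v v) = 0"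
    using real_inner_self[of "V i *\<^sub>v v"] by (simp add: complex_eq_iff)
  then show "V i *\<^sub>v v = 0\<^sub>v n"
    using cscalar_self_eq_0[of "V i *\<^sub>v v" n] V(1)[OF i] v by (simp add: mult_mat_vec_carrier[of _ n n])
qed

lemma psd_eigenvalue_nonneg:
  assumes M: "M \<in> carrier_mat n n" "pos_semidef M" and v: "v \<in> carrier_vec n" "v \<noteq> 0\<^sub>v n"
    and eig: "M *\<^sub>v v = complex_of_real d \<cdot>\<^sub>v v"
  shows "d \<ge> 0"
proof -
  have pos: "Re (v \<bullet>c v) > 0"
  proof -
    have "Re (v \<bullet>c v) \<noteq> 0"
    proof
      assume "Re (v \<bullet>c v) = 0"
      then have "v \<bullet>c v = 0" using real_inner_self[of v] by (simp add: complex_eq_iff)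
      then show False using cscalar_self_eq_0[OF v(1)] v(2) by blast
    qed
    then show ?thesis using real_inner_self[of v] by simp
  qed
  have "0 \<le> (M *\<^sub>v v) \<bullet>c v" using M v by (auto simp: pos_semidef_def)
  also have "(M *\<^sub>v v) \<bullet>c v = complex_of_real d * (v \<bullet>c v)" unfolding eig using v by simp
  finally have "0 \<le> d * Re (v \<bullet>c v)" by (simp add: less_eq_complex_def)
  with pos show ?thesis by (simp add: zero_le_mult_iff)
qed

context
  fixes nu nd nr :: nat
begin

private abbreviation (input) "N \<equiv> state_dim nu nd nr"
private abbreviation (input) "Uop f \<equiv> leg_op N (up_leg nu nd nr) (f nu)"
private abbreviation (input) "Dop f \<equiv> leg_op N (down_leg nu nd nr) (f nd)"
private abbreviation (input) "Rop f \<equiv> leg_op N (tan_leg nu nd nr) (f nr)"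
private abbreviation (input) "Sop f \<equiv> leg_op N (spin_leg nu nd nr) (f 1)"

lemma leg_ladder_carrier:
  assumes "f \<in> {raise, lower, weight}"
  shows "up_leg nu nd nr (f nu) \<in> carrier_mat N N" "down_leg nu nd nr (f nd) \<in> carrier_mat N N"
    "tan_leg nu nd nr (f nr) \<in> carrier_mat N N" "spin_leg nu nd nr (f 1) \<in> carrier_mat N N"
proof -
  have f: "f n \<in> carrier_mat (n + 1) (n + 1)" for n using assms by auto
  show "up_leg nu nd nr (f nu) \<in> carrier_mat N N" "down_leg nu nd nr (f nd) \<in> carrier_mat N N"
    "tan_leg nu nd nr (f nr) \<in> carrier_mat N N" "spin_leg nu nd nr (f 1) \<in> carrier_mat N N"
    using leg.leg_carrier[OF leg_up f] leg.leg_carrier[OF leg_down f] leg.leg_carrier[OF leg_tan f]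
      leg.leg_carrier[OF leg_spin f[of 1, unfolded one_add_one]] by blast+
qed

lemma four_spins_legs:
  "four_spins (Sop raise) (Sop lower) (Sop weight) (Uop raise) (Uop lower) (Uop weight) (Dop raise) (Dop lower) (Dop weight)
     (Rop raise) (Rop lower) (Rop weight) (int nu + 1) (int nd + 1) (int nr + 1)"
proof -
  note N = state_dim_pos[of nu nd nr]
  note su2 = leg.leg_op_ladder[OF leg_up N refl] leg.leg_op_ladder[OF leg_down N refl] leg.leg_op_ladder[OF leg_tan N refl]
  note c1 = ladder_carrier[of 1, unfolded one_add_one]
  note spin = leg.leg_op_mult[OF leg_spin N] leg.leg_op_minus[OF leg_spin N] leg.leg_op_add[OF leg_spin N]
    leg.leg_op_one[OF leg_spin N] leg.leg_op_zero[OF leg_spin N]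
  have half: "Sop lower * Sop raise = 1 - Sop raise * Sop lower" "Sop raise * Sop raise = 0" "Sop lower * Sop lower = 0"
    "Sop weight = Sop raise * Sop lower + Sop raise * Sop lower - 1"
    using half_spin_relations[THEN arg_cong, of "leg_op N (spin_leg nu nd nr)"] c1
    by (simp_all only: spin mult_carrier_mat[OF c1(1) c1(2)] mult_carrier_mat[OF c1(2) c1(1)] one_carrier_mat add_carrier_mat)
  have comm: "leg_op N f A * leg_op N f' B = leg_op N f' B * leg_op N f A"
    if "leg N k f" "leg N k' f'" "A \<in> carrier_mat k k" "B \<in> carrier_mat k' k'" "f A * f' B = f' B * f A" for f f' A B k k'
    using that op_of_mult[OF N leg.leg_carrier leg.leg_carrier] unfolding leg_op_def by metis
  note ud = comm[OF leg_down leg_up _ _ leg_commute(1)]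
  note ur = comm[OF leg_tan leg_up _ _ leg_commute(2)]
  note us = comm[OF leg_spin leg_up _ _ leg_commute(3)]
  note dr = comm[OF leg_tan leg_down _ _ leg_commute(4)]
  note ds = comm[OF leg_spin leg_down _ _ leg_commute(5)]
  note rs = comm[OF leg_spin leg_tan _ _ leg_commute(6)]
  show ?thesis
    by unfold_locales
      (fact su2 half | (rule ud ur us dr ds rs, (rule ladder_carrier c1)+))+
qed

private abbreviation (input) "W \<equiv> intertwiners nu nd nr"
private abbreviation (input) "S f \<equiv> spin_leg nu nd nr (f 1)"

definition leg_diff :: "(nat \<Rightarrow> complex mat) \<Rightarrow> complex mat" where
  "leg_diff f = up_leg nu nd nr (f nu) - down_leg nu nd nr (f nd)"

definition spin_diff :: "complex mat" where
  "spin_diff = mat_dot (S raise) (S lower) (S weight) (leg_diff raise) (leg_diff lower) (leg_diff weight)"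

definition diff_square :: "complex mat" where
  "diff_square = mat_dot (leg_diff raise) (leg_diff lower) (leg_diff weight) (leg_diff raise) (leg_diff lower) (leg_diff weight)"

text \<open>On intertwiners, \<open>\<sigma> \<cdot> (J\<^sub>u + J\<^sub>d) + 1\<close> up to a factor 2, the analogue of Dirac's operator
  \<open>K\<close> for the hydrogen atom. Its anticommutator with \<open>spin_diff\<close> is a scalar.\<close>
definition dirac :: "complex mat" where
  "dirac = (- 1) \<cdot>\<^sub>m (1\<^sub>m N + spin_orbit nu nd nr)"

private lemma N: "N > 0" by (rule state_dim_pos)

private lemma ladder_in: "raise \<in> {raise, lower, weight}" "lower \<in> {raise, lower, weight}" "weight \<in> {raise, lower, weight}"
  by simp_all

private lemmas carriers = leg_ladder_carrier[OF ladder_in(1)] leg_ladder_carrier[OF ladder_in(2)]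
  leg_ladder_carrier[OF ladder_in(3)]

private lemma leg_diff_carrier: "f \<in> {raise, lower, weight} \<Longrightarrow> leg_diff f \<in> carrier_mat N N"
  unfolding leg_diff_def by (intro minus_carrier_mat leg_ladder_carrier)

private lemmas diff_carriers = leg_diff_carrier[OF ladder_in(1)] leg_diff_carrier[OF ladder_in(2)] leg_diff_carrier[OF ladder_in(3)]

lemma spin_diff_carrier: "spin_diff \<in> carrier_mat N N"
  unfolding spin_diff_def by (rule mat_dot_carrier) (use carriers diff_carriers in blast)

lemma diff_square_carrier: "diff_square \<in> carrier_mat N N"
  unfolding diff_square_def by (rule mat_dot_carrier) (use carriers diff_carriers in blast)

lemma dirac_carrier: "dirac \<in> carrier_mat N N"
  unfolding dirac_def using spin_orbit_carrier[of nu nd nr] by auto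

interpretation spins: four_spins
  "op_of N (S raise)" "op_of N (S lower)" "op_of N (S weight)"
  "op_of N (up_leg nu nd nr (raise nu))" "op_of N (up_leg nu nd nr (lower nu))" "op_of N (up_leg nu nd nr (weight nu))"
  "op_of N (down_leg nu nd nr (raise nd))" "op_of N (down_leg nu nd nr (lower nd))" "op_of N (down_leg nu nd nr (weight nd))"
  "op_of N (tan_leg nu nd nr (raise nr))" "op_of N (tan_leg nu nd nr (lower nr))" "op_of N (tan_leg nu nd nr (weight nr))"
  "int nu + 1" "int nd + 1" "int nr + 1"
  using four_spins_legs unfolding leg_op_def .

private lemma op_leg_diff:
  "f \<in> {raise, lower, weight} \<Longrightarrow> op_of N (leg_diff f) = op_of N (up_leg nu nd nr (f nu)) - op_of N (down_leg nu nd nr (f nd))"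
  unfolding leg_diff_def by (rule op_of_minus[OF N]) (rule leg_ladder_carrier; assumption)+

private lemmas op_leg_diffs = op_leg_diff[OF ladder_in(1)] op_leg_diff[OF ladder_in(2)] op_leg_diff[OF ladder_in(3)]

private lemma op_spin_diff: "op_of N spin_diff = spins.s_dot_v"
proof -
  have "op_of N spin_diff = spin_dot (op_of N (S raise)) (op_of N (S lower)) (op_of N (S weight))
    (op_of N (leg_diff raise)) (op_of N (leg_diff lower)) (op_of N (leg_diff weight))"
    unfolding spin_diff_def by (rule op_of_mat_dot[OF N]) (use carriers diff_carriers in blast)
  then show ?thesis unfolding spins.s_dot_v_def op_leg_diffs .
qed

private lemma op_diff_square: "op_of N diff_square = spins.v_dot_v"
proof -
  have "op_of N diff_square = spin_dot (op_of N (leg_diff raise)) (op_of N (leg_diff lower)) (op_of N (leg_diff weight))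
    (op_of N (leg_diff raise)) (op_of N (leg_diff lower)) (op_of N (leg_diff weight))"
    unfolding diff_square_def by (rule op_of_mat_dot[OF N]) (use carriers diff_carriers in blast)
  then show ?thesis unfolding spins.v_dot_v_def op_leg_diffs .
qed

private lemma op_dirac: "op_of N dirac = spins.dirac_op"
proof -
  have K: "op_of N (spin_orbit nu nd nr) = spin_dot (op_of N (S raise)) (op_of N (S lower)) (op_of N (S weight))
      (op_of N (tan_leg nu nd nr (raise nr))) (op_of N (tan_leg nu nd nr (lower nr))) (op_of N (tan_leg nu nd nr (weight nr)))"
    unfolding spin_orbit_def by (rule op_of_mat_dot[OF N]) (use carriers in blast)
  have "op_of N dirac = of_int (- 1) * op_of N (1\<^sub>m N + spin_orbit nu nd nr)"
    unfolding dirac_def using op_of_smult[OF N, of "1\<^sub>m N + spin_orbit nu nd nr" "- 1"] spin_orbit_carrier[of nu nd nr] by simp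
  also have "\<dots> = - (1 + op_of N (spin_orbit nu nd nr))"
    using spin_orbit_carrier[of nu nd nr] by (simp add: op_of_add[OF N] op_of_one[OF N])
  also have "\<dots> = spins.dirac_op" unfolding spins.dirac_op_def K by simp
  finally show ?thesis .
qed

section \<open>Identities of the algebra carried over to vectors\<close>

lemma intertwiners_carrier: "v \<in> W \<Longrightarrow> v \<in> carrier_vec N"
  by (simp add: intertwiners_def)

private lemma op_total:
  assumes "f \<in> {raise, lower, weight}"
  shows "op_of N (total_op nu nd nr f) = op_of N (up_leg nu nd nr (f nu)) + op_of N (down_leg nu nd nr (f nd))
    + op_of N (tan_leg nu nd nr (f nr)) + op_of N (spin_leg nu nd nr (f 1))"
  unfolding total_op_def using leg_ladder_carrier[OF assms]
  by (simp only: op_of_add[OF N] add_carrier_mat)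

text \<open>By \<open>intertwiners_eq\<close> both sides say that the three total ladder operators
  kill the vector. This connects the abstract algebra with invariance under the group.\<close>

private lemma invariant_op_vec:
  assumes v: "v \<in> carrier_vec N"
  shows "spins.invariant (op_vec N v) \<longleftrightarrow> v \<in> W"
proof -
  have car: "total_op nu nd nr raise \<in> carrier_mat N N" "total_op nu nd nr lower \<in> carrier_mat N N"
    "total_op nu nd nr weight \<in> carrier_mat N N"
    by (rule total_carrier[OF ladder_carrier(1)] total_carrier[OF ladder_carrier(2)] total_carrier[OF ladder_carrier(3)])+
  have z: "op_of N M * op_vec N v = 0 \<longleftrightarrow> M *\<^sub>v v = 0\<^sub>v N" if M: "M \<in> carrier_mat N N" for M
    unfolding op_vec_mult[OF N M v, symmetric] op_vec_zero[OF N, symmetric]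
    by (rule op_vec_inject[OF N]) (use M v in auto)
  show ?thesis
    unfolding spins.invariant_def op_total[OF ladder_in(1), symmetric] op_total[OF ladder_in(2), symmetric]
      op_total[OF ladder_in(3), symmetric] z[OF car(1)] z[OF car(2)] z[OF car(3)] intertwiners_eq
    using v by simp
qed

private lemma intertwiner_invariant: "v \<in> W \<Longrightarrow> spins.invariant (op_vec N v)"
  using invariant_op_vec intertwiners_carrier by blast

lemma spin_diff_intertwiner: "v \<in> W \<Longrightarrow> spin_diff *\<^sub>v v \<in> W"
  and dirac_intertwiner: "v \<in> W \<Longrightarrow> dirac *\<^sub>v v \<in> W"
proof -
  assume v: "v \<in> W"
  note vN = intertwiners_carrier[OF v]
  show "spin_diff *\<^sub>v v \<in> W"
    using spins.invariant_s_dot_v[OF intertwiner_invariant[OF v]] invariant_op_vec[of "spin_diff *\<^sub>v v"] spin_diff_carrier vN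
    by (simp add: op_vec_mult[OF N] op_spin_diff)
  show "dirac *\<^sub>v v \<in> W"
    using spins.invariant_dirac_op[OF intertwiner_invariant[OF v]] invariant_op_vec[of "dirac *\<^sub>v v"] dirac_carrier vN
    by (simp add: op_vec_mult[OF N] op_dirac)
qed

context
  fixes v
  assumes v: "v \<in> W"
begin

private lemma vN: "v \<in> carrier_vec N" by (rule intertwiners_carrier[OF v])

private lemma closed:
  "spin_diff *\<^sub>v v \<in> carrier_vec N" "dirac *\<^sub>v v \<in> carrier_vec N" "diff_square *\<^sub>v v \<in> carrier_vec N"
  "spin_diff *\<^sub>v (dirac *\<^sub>v v) \<in> carrier_vec N" "dirac *\<^sub>v (spin_diff *\<^sub>v v) \<in> carrier_vec N"
  "spin_diff *\<^sub>v (spin_diff *\<^sub>v v) \<in> carrier_vec N" "dirac *\<^sub>v (dirac *\<^sub>v v) \<in> carrier_vec N"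
  using vN spin_diff_carrier dirac_carrier diff_square_carrier by (auto intro!: mult_mat_vec_carrier)

private lemmas transfer = op_vec_mult[OF N] op_vec_add[OF N] op_vec_smult[OF N] op_spin_diff op_dirac op_diff_square

lemma spin_diff_square:
  "spin_diff *\<^sub>v (spin_diff *\<^sub>v v) = of_int (2 * (int nu + 1) * (int nu + 1) + 2 * (int nd + 1) * (int nd + 1) - (int nr + 1) * (int nr + 1)) \<cdot>\<^sub>v v"
proof -
  have "op_vec N (spin_diff *\<^sub>v (spin_diff *\<^sub>v v)) = op_vec N (of_int (2 * (int nu + 1) * (int nu + 1) + 2 * (int nd + 1) * (int nd + 1) - (int nr + 1) * (int nr + 1)) \<cdot>\<^sub>v v)"
    by (simp only: transfer vN closed spin_diff_carrier spins.s_dot_v_square_apply[OF intertwiner_invariant[OF v]])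
  then show ?thesis
    by (subst (asm) op_vec_inject[OF N]) (use vN closed in auto)
qed

lemma dirac_square: "dirac *\<^sub>v (dirac *\<^sub>v v) = of_int ((int nr + 1) * (int nr + 1)) \<cdot>\<^sub>v v"
proof -
  have "op_vec N (dirac *\<^sub>v (dirac *\<^sub>v v)) = op_vec N (of_int ((int nr + 1) * (int nr + 1)) \<cdot>\<^sub>v v)"
    by (simp only: transfer vN closed dirac_carrier mult.assoc[symmetric] spins.dirac_op_square)
  then show ?thesis
    by (subst (asm) op_vec_inject[OF N]) (use vN closed in auto)
qed

lemma dirac_spin_diff:
  "dirac *\<^sub>v (spin_diff *\<^sub>v v) + spin_diff *\<^sub>v (dirac *\<^sub>v v) =
    of_int (2 * ((int nu + 1) * (int nu + 1) - (int nd + 1) * (int nd + 1))) \<cdot>\<^sub>v v"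
proof -
  have "op_vec N (dirac *\<^sub>v (spin_diff *\<^sub>v v) + spin_diff *\<^sub>v (dirac *\<^sub>v v)) =
      op_vec N (of_int (2 * ((int nu + 1) * (int nu + 1) - (int nd + 1) * (int nd + 1))) \<cdot>\<^sub>v v)"
    by (simp only: transfer vN closed dirac_carrier spin_diff_carrier spins.anticommute_apply[OF intertwiner_invariant[OF v]])
  then show ?thesis
    by (subst (asm) op_vec_inject[OF N]) (use vN closed in auto)
qed

lemma diff_square_apply:
  "diff_square *\<^sub>v v = of_int (2 * (int nu + 1) * (int nu + 1) + 2 * (int nd + 1) * (int nd + 1) - (int nr + 1) * (int nr + 1) - 4) \<cdot>\<^sub>v v
    + 2 \<cdot>\<^sub>v (dirac *\<^sub>v v)"
proof -
  have "op_vec N (2 \<cdot>\<^sub>v (dirac *\<^sub>v v)) = 2 * op_vec N (dirac *\<^sub>v v)"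
    using op_vec_smult[OF N closed(2), of 2] by simp
  then have "op_vec N (diff_square *\<^sub>v v) = op_vec N (of_int (2 * (int nu + 1) * (int nu + 1) + 2 * (int nd + 1) * (int nd + 1) - (int nr + 1) * (int nr + 1) - 4) \<cdot>\<^sub>v v
    + 2 \<cdot>\<^sub>v (dirac *\<^sub>v v))"
    by (simp only: transfer vN closed dirac_carrier diff_square_carrier smult_carrier_vec spins.v_dot_v_apply[OF intertwiner_invariant[OF v]])
  then show ?thesis
    by (subst (asm) op_vec_inject[OF N]) (use vN closed in auto)
qed

lemma dirac_eigenvector_iff: "dirac *\<^sub>v v = c \<cdot>\<^sub>v v \<longleftrightarrow> spin_orbit nu nd nr *\<^sub>v v = (- 1 - c) \<cdot>\<^sub>v v"
proof -
  have K: "spin_orbit nu nd nr *\<^sub>v v \<in> carrier_vec N" using spin_orbit_carrier[of nu nd nr] vN by auto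
  note sv = smult_mat_mult_vec[of _ N N, OF _ vN]
  have eq: "dirac *\<^sub>v v = (- 1) \<cdot>\<^sub>v (v + spin_orbit nu nd nr *\<^sub>v v)"
    unfolding dirac_def using spin_orbit_carrier[of nu nd nr] vN
    by (simp add: sv add_mult_distrib_mat_vec[of _ N N])
  have "(- 1) \<cdot>\<^sub>v (v + k) = c \<cdot>\<^sub>v v \<longleftrightarrow> k = (- 1 - c) \<cdot>\<^sub>v v" if k: "k \<in> carrier_vec N" for k
  proof -
    have "k $ i = (- 1 - c) * v $ i \<longleftrightarrow> - 1 * (v $ i + k $ i) = c * v $ i" for i
    proof -
      have "k $ i - (- 1 - c) * v $ i = - (- 1 * (v $ i + k $ i) - c * v $ i)"
        by (simp add: algebra_simps)
      then show ?thesis by (metis eq_iff_diff_eq_0 neg_equal_0_iff_equal)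
    qed
    then show ?thesis
      using k vN by (auto simp: vec_eq_iff)
  qed
  then show ?thesis unfolding eq using K by blast
qed

end

section \<open>The operators of the statement in ladder form\<close>

lemma normal_op_ladder:
  "J_up nu nd nr 1 - J_down nu nd nr 1 = (1 / 2) \<cdot>\<^sub>m (leg_diff raise + leg_diff lower)"
  "J_up nu nd nr 2 - J_down nu nd nr 2 = (- \<i> / 2) \<cdot>\<^sub>m (leg_diff raise - leg_diff lower)"
  "J_up nu nd nr 3 - J_down nu nd nr 3 = (1 / 2) \<cdot>\<^sub>m leg_diff weight"
proof -
  have minus: "f (A - B) = f A - f B" if f: "leg N k f" and A: "A \<in> carrier_mat k k" and B: "B \<in> carrier_mat k k" for f k A B
  proof -
    have "A - B = A + (- 1) \<cdot>\<^sub>m B" by (rule eq_matI) (use A B in auto)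
    then have "f (A - B) = f A + (- 1) \<cdot>\<^sub>m f B"
      using leg.leg_add[OF f A] leg.leg_smult[OF f] B by simp
    then show ?thesis using leg.leg_carrier[OF f A] leg.leg_carrier[OF f B] by (intro eq_matI) auto
  qed
  have eq: "J_up nu nd nr i - J_down nu nd nr i = up_leg nu nd nr (spin_op nu i) - down_leg nu nd nr (spin_op nd i)" for i
    unfolding J_up_def J_down_def up_leg_def down_leg_def by (rule refl)
  note u = leg.leg_smult[OF leg_up] leg.leg_add[OF leg_up ladder_carrier(1,2)] minus[OF leg_up ladder_carrier(1,2)]
  note d = leg.leg_smult[OF leg_down] leg.leg_add[OF leg_down ladder_carrier(1,2)] minus[OF leg_down ladder_carrier(1,2)]
  show "J_up nu nd nr 1 - J_down nu nd nr 1 = (1 / 2) \<cdot>\<^sub>m (leg_diff raise + leg_diff lower)"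
    unfolding eq spin_op_ladder u d leg_diff_def by (rule eq_matI) (use carriers in \<open>auto simp: field_simps\<close>)
  show "J_up nu nd nr 2 - J_down nu nd nr 2 = (- \<i> / 2) \<cdot>\<^sub>m (leg_diff raise - leg_diff lower)"
    unfolding eq spin_op_ladder u d leg_diff_def by (rule eq_matI) (use carriers in \<open>auto simp: field_simps\<close>)
  show "J_up nu nd nr 3 - J_down nu nd nr 3 = (1 / 2) \<cdot>\<^sub>m leg_diff weight"
    unfolding eq spin_op_ladder u d leg_diff_def by (rule eq_matI) (use carriers in \<open>auto simp: field_simps\<close>)
qed

lemma S_op_ladder:
  "S_op nu nd nr 1 = (1 / 2) \<cdot>\<^sub>m (S raise + S lower)"
  "S_op nu nd nr 2 = (- \<i> / 2) \<cdot>\<^sub>m (S raise - S lower)"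
  "S_op nu nd nr 3 = (1 / 2) \<cdot>\<^sub>m S weight"
proof -
  note c1 = ladder_carrier[of 1, unfolded one_add_one]
  have eq: "S_op nu nd nr i = spin_leg nu nd nr (spin_op 1 i)" for i
    unfolding S_op_def spin_leg_def by (rule refl)
  have "raise 1 - lower 1 = raise 1 + (- 1) \<cdot>\<^sub>m lower 1" by (rule eq_matI) auto
  then have "spin_leg nu nd nr (raise 1 - lower 1) = S raise + (- 1) \<cdot>\<^sub>m S lower"
    using leg.leg_add[OF leg_spin c1(1)] leg.leg_smult[OF leg_spin] c1 by simp
  then have minus: "spin_leg nu nd nr (raise 1 - lower 1) = S raise - S lower"
    using carriers by (intro eq_matI) auto
  show "S_op nu nd nr 1 = (1 / 2) \<cdot>\<^sub>m (S raise + S lower)"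
    "S_op nu nd nr 2 = (- \<i> / 2) \<cdot>\<^sub>m (S raise - S lower)"
    "S_op nu nd nr 3 = (1 / 2) \<cdot>\<^sub>m S weight"
    unfolding eq spin_op_ladder leg.leg_smult[OF leg_spin] leg.leg_add[OF leg_spin c1(1,2)] minus by (rule refl)+
qed

private abbreviation (input) "V \<equiv> \<lambda>i. J_up nu nd nr i - J_down nu nd nr i"

lemma op_dot_normal: "op_dot V V = (1 / 4) \<cdot>\<^sub>m diff_square"
  unfolding diff_square_def
  by (rule op_dot_ladder[OF _ normal_op_ladder normal_op_ladder]) (use diff_carriers in blast)

lemma op_dot_spin_normal: "op_dot (S_op nu nd nr) V = (1 / 4) \<cdot>\<^sub>m spin_diff"
  unfolding spin_diff_def
  by (rule op_dot_ladder[OF _ S_op_ladder normal_op_ladder]) (use carriers diff_carriers in blast)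

lemma op_dot_spin: "op_dot (S_op nu nd nr) (S_op nu nd nr) = (3 / 4) \<cdot>\<^sub>m 1\<^sub>m N"
proof -
  let ?m = "mat_dot (S raise) (S lower) (S weight) (S raise) (S lower) (S weight)"
  have sub: "{S raise, S lower, S weight, S raise, S lower, S weight} \<subseteq> carrier_mat N N" using carriers by blast
  have "op_of N ?m = 3" unfolding op_of_mat_dot[OF N sub] by (rule spins.dot_half_half)
  also have "\<dots> = op_of N (of_int 3 \<cdot>\<^sub>m 1\<^sub>m N)" by (simp only: op_of_smult[OF N one_carrier_mat] op_of_one[OF N]) simp
  finally have "?m = of_int 3 \<cdot>\<^sub>m 1\<^sub>m N"
    by (subst (asm) op_of_inject[OF N]) (use mat_dot_carrier[OF sub] in auto)
  then show ?thesis
    unfolding op_dot_ladder[OF sub S_op_ladder S_op_ladder] by (intro eq_matI) auto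
qed

lemma normal_op_carrier: "V i \<in> carrier_mat N N"
proof -
  have "J_up nu nd nr i = up_leg nu nd nr (spin_op nu i)" "J_down nu nd nr i = down_leg nu nd nr (spin_op nd i)"
    unfolding J_up_def J_down_def up_leg_def down_leg_def by (rule refl)+
  then show ?thesis
    using leg.leg_carrier[OF leg_up spin_op_carrier] leg.leg_carrier[OF leg_down spin_op_carrier]
    by (simp only: minus_carrier_mat)
qed

lemma normal_op_hermitian: "i \<in> {1, 2, 3} \<Longrightarrow> mat_adjoint (V i) = V i"
proof -
  assume i: "i \<in> {1, 2, 3}"
  have eq: "J_up nu nd nr i = up_leg nu nd nr (spin_op nu i)" "J_down nu nd nr i = down_leg nu nd nr (spin_op nd i)"
    unfolding J_up_def J_down_def up_leg_def down_leg_def by (rule refl)+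
  show ?thesis
    unfolding eq mat_adjoint_minus[OF leg.leg_carrier[OF leg_up spin_op_carrier] leg.leg_carrier[OF leg_down spin_op_carrier]]
      leg.leg_adjoint[OF leg_up, symmetric] leg.leg_adjoint[OF leg_down, symmetric] spin_op_hermitian[OF i] by (rule refl)
qed

lemma normal_psd: "pos_semidef (op_dot V V)"
  by (rule op_dot_self_psd(1)[OF normal_op_carrier normal_op_hermitian])

text \<open>The kernel of V^2 lies in the kernels of the three components of V. By
  \<open>difference_kernel\<close> the numbers a^2 - 1 and b^2 - 1 then annihilate the vector, and
  at least one of them is nonzero.\<close>

lemma normal_injective:
  assumes n: "nu \<noteq> 0 \<or> nd \<noteq> 0" and v: "v \<in> carrier_vec N" and zero: "op_dot V V *\<^sub>v v = 0\<^sub>v N"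
  shows "v = 0\<^sub>v N"
proof -
  have V0: "V i *\<^sub>v v = 0\<^sub>v N" if "i \<in> {1, 2, 3}" for i
    using op_dot_self_psd(2)[OF normal_op_carrier normal_op_hermitian v zero that] .
  let ?e = "leg_diff raise *\<^sub>v v" and ?f = "leg_diff lower *\<^sub>v v" and ?h = "leg_diff weight *\<^sub>v v"
  note sv = smult_mat_mult_vec[of _ N N, OF _ v]
  have efh: "?e \<in> carrier_vec N" "?f \<in> carrier_vec N" "?h \<in> carrier_vec N" using diff_carriers v by auto
  have 1: "(1 / 2) \<cdot>\<^sub>v (?e + ?f) = 0\<^sub>v N"
    using V0[of 1] unfolding normal_op_ladder using diff_carriers v
    by (simp add: sv add_mult_distrib_mat_vec[of _ N N])
  have 2: "(- \<i> / 2) \<cdot>\<^sub>v (?e - ?f) = 0\<^sub>v N"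
    using V0[of 2] unfolding normal_op_ladder using diff_carriers v
    by (simp add: sv minus_mult_distrib_mat_vec[of _ N N] minus_carrier_mat)
  have 3: "(1 / 2) \<cdot>\<^sub>v ?h = 0\<^sub>v N"
    using V0[of 3] unfolding normal_op_ladder using diff_carriers v by (simp add: sv)
  have solve: "e = 0\<^sub>v N" "f = 0\<^sub>v N" "h = 0\<^sub>v N"
    if efh: "e \<in> carrier_vec N" "f \<in> carrier_vec N" "h \<in> carrier_vec N"
      and eqs: "(1 / 2) \<cdot>\<^sub>v (e + f) = 0\<^sub>v N" "(- \<i> / 2) \<cdot>\<^sub>v (e - f) = 0\<^sub>v N" "(1 / 2) \<cdot>\<^sub>v h = 0\<^sub>v N" for e f h :: "complex Matrix.vec"
  proof -
    have "e $ i = 0 \<and> f $ i = 0 \<and> h $ i = 0" if i: "i < N" for i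
    proof -
      have "(1 / 2) * (e $ i + f $ i) = 0" "(- \<i> / 2) * (e $ i - f $ i) = 0" "(1 / 2) * h $ i = 0"
        using efh eqs[THEN arg_cong, of "\<lambda>u. u $ i"] i by auto
      then show ?thesis by auto
    qed
    then show "e = 0\<^sub>v N" "f = 0\<^sub>v N" "h = 0\<^sub>v N" using efh by (auto intro!: eq_vecI)
  qed
  have "op_of N (leg_diff f) * op_vec N v = 0" if f: "f \<in> {raise, lower, weight}" for f
    using solve[OF efh 1 2 3] f op_vec_mult[OF N leg_diff_carrier[OF f] v] op_vec_zero[OF N] by auto
  note ops = this[OF ladder_in(1), unfolded op_leg_diffs] this[OF ladder_in(2), unfolded op_leg_diffs] this[OF ladder_in(3), unfolded op_leg_diffs]
  have "of_int ((int nu + 1) * (int nu + 1) - 1) * op_vec N v = 0" "of_int ((int nd + 1) * (int nd + 1) - 1) * op_vec N v = 0"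
    using spins.difference_kernel[OF lin_op_torsion ops] by blast+
  then have "op_vec N (of_int ((int nu + 1) * (int nu + 1) - 1) \<cdot>\<^sub>v v) = op_vec N (0\<^sub>v N)"
    "op_vec N (of_int ((int nd + 1) * (int nd + 1) - 1) \<cdot>\<^sub>v v) = op_vec N (0\<^sub>v N)"
    by (simp_all only: op_vec_smult[OF N v] op_vec_zero[OF N])
  then have sm: "of_int ((int nu + 1) * (int nu + 1) - 1) \<cdot>\<^sub>v v = 0\<^sub>v N" "of_int ((int nd + 1) * (int nd + 1) - 1) \<cdot>\<^sub>v v = 0\<^sub>v N"
    using v by (simp_all only: op_vec_inject[OF N] smult_carrier_vec zero_carrier_vec)
  have cancel: "v = 0\<^sub>v N" if k: "k \<noteq> 0" "of_int k \<cdot>\<^sub>v v = 0\<^sub>v N" for k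
  proof (rule eq_vecI)
    fix i assume "i < dim_vec (0\<^sub>v N :: complex Matrix.vec)"
    then have i: "i < N" by simp
    have "(of_int k \<cdot>\<^sub>v v) $ i = 0" unfolding k(2) using i by simp
    then show "v $ i = 0\<^sub>v N $ i" using k(1) v i by simp
  qed (use v in simp)
  have "(int m + 1) * (int m + 1) - 1 \<noteq> 0" if "m \<noteq> 0" for m :: nat
  proof -
    have "(int m + 1) * (int m + 1) - 1 = int m * (int m + 2)" by (simp add: algebra_simps)
    then show ?thesis using that by simp
  qed
  then show ?thesis using n cancel sm by blast
qed

private abbreviation (input) "X \<equiv> spin_diff"
private abbreviation (input) "G \<equiv> dirac"

lemma inv_sqrt_spin:
  assumes v: "v \<in> carrier_vec N"
  shows "inv_sqrt_op (op_dot (S_op nu nd nr) (S_op nu nd nr)) *\<^sub>v v = complex_of_real (2 / sqrt 3) \<cdot>\<^sub>v v"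
    and "inv_sqrt_op (op_dot (S_op nu nd nr) (S_op nu nd nr)) \<in> carrier_mat N N"
    and "pos_semidef (inv_sqrt_op (op_dot (S_op nu nd nr) (S_op nu nd nr)))"
proof -
  let ?M = "(3 / 4) \<cdot>\<^sub>m 1\<^sub>m N :: complex mat"
  have M: "?M \<in> carrier_mat N N" by simp
  have app: "?M *\<^sub>v u = complex_of_real (3 / 4) \<cdot>\<^sub>v u" if "u \<in> carrier_vec N" for u
  proof (rule eq_vecI)
    fix i assume "i < dim_vec (complex_of_real (3 / 4) \<cdot>\<^sub>v u)"
    then have i: "i < N" using that by simp
    have "(?M *\<^sub>v u) $ i = (\<Sum>j<N. if j = i then 3 / 4 * u $ i else 0)"
      unfolding index_mult_mat_vec_sum[OF M that i] using i by (intro sum.cong) auto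
    then show "(?M *\<^sub>v u) $ i = (complex_of_real (3 / 4) \<cdot>\<^sub>v u) $ i" using i that by simp
  qed (use that in simp)
  have psd: "pos_semidef ?M"
    unfolding pos_semidef_def
  proof (intro conjI ballI)
    show "mat_adjoint ?M = ?M" by (simp add: mat_adjoint_smult mat_adjoint_one)
    fix u :: "complex Matrix.vec" assume "u \<in> carrier_vec (dim_row ?M)"
    then have u: "u \<in> carrier_vec N" by simp
    show "0 \<le> (?M *\<^sub>v u) \<bullet>c u"
      unfolding app[OF u] using real_inner_self[of u] u by (simp add: less_eq_complex_def)
  qed simp
  have inj: "u = 0\<^sub>v N" if u: "u \<in> carrier_vec N" "?M *\<^sub>v u = 0\<^sub>v N" for u
  proof (rule eq_vecI)
    fix i assume "i < dim_vec (0\<^sub>v N :: complex Matrix.vec)"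
    then have i: "i < N" by simp
    have "(complex_of_real (3 / 4) \<cdot>\<^sub>v u) $ i = 0" unfolding app[OF u(1), symmetric] u(2) using i by simp
    then show "u $ i = 0\<^sub>v N $ i" using u(1) i by simp
  qed (use u in simp)
  have R: "inv_sqrt_op ?M \<in> carrier_mat N N" "pos_semidef (inv_sqrt_op ?M)" "inv_sqrt_op ?M * inv_sqrt_op ?M * ?M = 1\<^sub>m N"
    using inv_sqrt_op[OF M psd] inj by blast+
  have "1 / sqrt (3 / 4) = 2 / sqrt 3" by (simp add: real_sqrt_divide)
  then show "inv_sqrt_op (op_dot (S_op nu nd nr) (S_op nu nd nr)) *\<^sub>v v = complex_of_real (2 / sqrt 3) \<cdot>\<^sub>v v"
    unfolding op_dot_spin using psd_root_eigenvector[OF R(1,2) M R(3) v app[OF v]] by simp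
  show "inv_sqrt_op (op_dot (S_op nu nd nr) (S_op nu nd nr)) \<in> carrier_mat N N"
    "pos_semidef (inv_sqrt_op (op_dot (S_op nu nd nr) (S_op nu nd nr)))"
    unfolding op_dot_spin using R by simp_all
qed

context
  assumes n: "nu \<noteq> 0 \<or> nd \<noteq> 0"
begin

private abbreviation (input) "RV \<equiv> inv_sqrt_op (op_dot V V)"

private lemma normal_square_carrier: "op_dot V V \<in> carrier_mat N N"
  unfolding op_dot_def using normal_op_carrier by (auto intro!: add_carrier_mat mult_carrier_mat)

private lemma RV: "RV \<in> carrier_mat N N" "pos_semidef RV" "RV * RV * op_dot V V = 1\<^sub>m N"
proof -
  have "u = 0\<^sub>v N" if "u \<in> carrier_vec N" "op_dot V V *\<^sub>v u = 0\<^sub>v N" for u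
    using normal_injective[OF n that] .
  then show "RV \<in> carrier_mat N N" "pos_semidef RV" "RV * RV * op_dot V V = 1\<^sub>m N"
    using inv_sqrt_op[OF normal_square_carrier normal_psd] by blast+
qed

text \<open>This is the sum of the products S_i V_i, whose factors are Hermitian and commute because
  they act on different tensor factors.\<close>

private lemma spin_normal_hermitian: "mat_adjoint ((1 / 4) \<cdot>\<^sub>m X) = (1 / 4) \<cdot>\<^sub>m X"
proof -
  have S: "S_op nu nd nr i = spin_leg nu nd nr (spin_op 1 i)" for i
    unfolding S_op_def spin_leg_def by (rule refl)
  have J: "J_up nu nd nr i = up_leg nu nd nr (spin_op nu i)" "J_down nu nd nr i = down_leg nu nd nr (spin_op nd i)" for i
    unfolding J_up_def J_down_def up_leg_def down_leg_def by (rule refl)+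
  note c1 = spin_op_carrier[of 1, unfolded one_add_one]
  have Sc: "S_op nu nd nr i \<in> carrier_mat N N" for i unfolding S by (rule leg.leg_carrier[OF leg_spin c1])
  have Sh: "mat_adjoint (S_op nu nd nr i) = S_op nu nd nr i" if "i \<in> {1, 2, 3}" for i
    unfolding S leg.leg_adjoint[OF leg_spin, symmetric] spin_op_hermitian[OF that] by (rule refl)
  have comm: "S_op nu nd nr i * V i = V i * S_op nu nd nr i" for i
  proof -
    have u: "up_leg nu nd nr (spin_op nu i) \<in> carrier_mat N N" and d: "down_leg nu nd nr (spin_op nd i) \<in> carrier_mat N N"
      by (rule leg.leg_carrier[OF leg_up spin_op_carrier] leg.leg_carrier[OF leg_down spin_op_carrier])+
    show ?thesis
      unfolding J mult_minus_distrib_mat[OF Sc u d] minus_mult_distrib_mat[OF u d Sc]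
      unfolding S leg_commute(3)[OF spin_op_carrier c1] leg_commute(5)[OF spin_op_carrier c1] by (rule refl)
  qed
  note Vc = normal_op_carrier
  have SV: "S_op nu nd nr i * V i \<in> carrier_mat N N" for i using Sc Vc by (rule mult_carrier_mat)
  have adj: "mat_adjoint (S_op nu nd nr i * V i) = S_op nu nd nr i * V i" if "i \<in> {1, 2, 3}" for i
  proof -
    have "mat_adjoint (S_op nu nd nr i * V i) = mat_adjoint (V i) * mat_adjoint (S_op nu nd nr i)"
      by (rule mat_adjoint_mult) (use carrier_matD[OF Sc] carrier_matD[OF Vc] in metis)
    then show ?thesis unfolding Sh[OF that] normal_op_hermitian[OF that] comm .
  qed
  have "mat_adjoint (op_dot (S_op nu nd nr) V) = op_dot (S_op nu nd nr) V"
    unfolding op_dot_def mat_adjoint_add[OF add_carrier_mat[OF SV] SV] mat_adjoint_add[OF SV SV]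
    using adj[of 1] adj[of 2] adj[of 3] by simp
  then show ?thesis unfolding op_dot_spin_normal .
qed

text \<open>In C the inverse root of V^2 meets the eigenvector \<open>v\<close> first and becomes a
  number; in the adjoint of C it acts after X and stays. The constant is (1/2) (2 / sqrt 3) (1/4),
  from the average, from S^2 = 3/4 and from X = 4 S . V.\<close>

lemma cos_op_apply:
  assumes v: "v \<in> carrier_vec N" and Vv: "op_dot V V *\<^sub>v v = complex_of_real d \<cdot>\<^sub>v v" and d: "d > 0"
  shows "cos_op nu nd nr *\<^sub>v v = complex_of_real (1 / (4 * sqrt 3)) \<cdot>\<^sub>v
    (complex_of_real (1 / sqrt d) \<cdot>\<^sub>v (X *\<^sub>v v) + RV *\<^sub>v (X *\<^sub>v v))"
proof -
  let ?RS = "inv_sqrt_op (op_dot (S_op nu nd nr) (S_op nu nd nr))" and ?Y = "(1 / 4) \<cdot>\<^sub>m X"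
  let ?C = "C_op nu nd nr"
  note RS = inv_sqrt_spin(2,3)[OF v]
  have Y: "?Y \<in> carrier_mat N N" using spin_diff_carrier by simp
  note sv = smult_mat_mult_vec[of _ N N]
  have C: "?C = ?RS * ?Y * RV"
    unfolding C_op_def Let_def op_dot_spin_normal by (rule refl)
  have adj: "mat_adjoint ?RS = ?RS" "mat_adjoint RV = RV"
    using RS(2) RV(2) by (auto simp: pos_semidef_def)
  have RSY: "?RS * ?Y \<in> carrier_mat N N" using RS(1) Y by (rule mult_carrier_mat)
  have Cc: "?C \<in> carrier_mat N N" unfolding C using RSY RV(1) by (rule mult_carrier_mat)
  have Cadj: "mat_adjoint ?C = RV * (?Y * ?RS)"
  proof -
    have "mat_adjoint ?C = mat_adjoint RV * mat_adjoint (?RS * ?Y)"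
      unfolding C using RSY RV(1) by (intro mat_adjoint_mult) (simp only: carrier_matD)
    also have "mat_adjoint (?RS * ?Y) = mat_adjoint ?Y * mat_adjoint ?RS"
      using RS(1) Y by (intro mat_adjoint_mult) (simp only: carrier_matD)
    finally show ?thesis unfolding adj spin_normal_hermitian .
  qed
  have YRS: "?Y * ?RS \<in> carrier_mat N N" using Y RS(1) by (rule mult_carrier_mat)
  have Cadjc: "mat_adjoint ?C \<in> carrier_mat N N" unfolding Cadj using RV(1) YRS by (rule mult_carrier_mat)
  have Xv: "X *\<^sub>v v \<in> carrier_vec N" using spin_diff_carrier v by (rule mult_mat_vec_carrier)
  have RXv: "RV *\<^sub>v (X *\<^sub>v v) \<in> carrier_vec N" using RV(1) Xv by (rule mult_mat_vec_carrier)
  have "?C *\<^sub>v v = ?RS *\<^sub>v (?Y *\<^sub>v (RV *\<^sub>v v))"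
    unfolding C using RS(1) Y RSY RV(1) v mult_mat_vec_carrier[OF RV(1) v]
    by (simp only: assoc_mult_mat_vec)
  also have "RV *\<^sub>v v = complex_of_real (1 / sqrt d) \<cdot>\<^sub>v v"
    by (rule psd_root_eigenvector[OF RV(1,2) normal_square_carrier RV(3) v Vv d])
  also have "?Y *\<^sub>v \<dots> = complex_of_real (1 / sqrt d) \<cdot>\<^sub>v ((1 / 4) \<cdot>\<^sub>v (X *\<^sub>v v))"
    unfolding mult_mat_vec[OF Y v] sv[OF spin_diff_carrier v] by (rule refl)
  also have "?RS *\<^sub>v \<dots> = complex_of_real (2 / sqrt 3) \<cdot>\<^sub>v (complex_of_real (1 / sqrt d) \<cdot>\<^sub>v ((1 / 4) \<cdot>\<^sub>v (X *\<^sub>v v)))"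
    by (rule inv_sqrt_spin(1)) (use Xv in simp)
  finally have 1: "?C *\<^sub>v v = complex_of_real (2 / sqrt 3) \<cdot>\<^sub>v (complex_of_real (1 / sqrt d) \<cdot>\<^sub>v ((1 / 4) \<cdot>\<^sub>v (X *\<^sub>v v)))" .
  have "mat_adjoint ?C *\<^sub>v v = RV *\<^sub>v (?Y *\<^sub>v (?RS *\<^sub>v v))"
    unfolding Cadj using RS(1) Y YRS RV(1) v by (simp only: assoc_mult_mat_vec)
  also have "?RS *\<^sub>v v = complex_of_real (2 / sqrt 3) \<cdot>\<^sub>v v" by (rule inv_sqrt_spin(1)[OF v])
  also have "?Y *\<^sub>v \<dots> = complex_of_real (2 / sqrt 3) \<cdot>\<^sub>v ((1 / 4) \<cdot>\<^sub>v (X *\<^sub>v v))"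
    unfolding mult_mat_vec[OF Y v] sv[OF spin_diff_carrier v] by (rule refl)
  also have "RV *\<^sub>v \<dots> = complex_of_real (2 / sqrt 3) \<cdot>\<^sub>v ((1 / 4) \<cdot>\<^sub>v (RV *\<^sub>v (X *\<^sub>v v)))"
    using Xv by (simp only: mult_mat_vec[OF RV(1)] smult_carrier_vec)
  finally have 2: "mat_adjoint ?C *\<^sub>v v = complex_of_real (2 / sqrt 3) \<cdot>\<^sub>v ((1 / 4) \<cdot>\<^sub>v (RV *\<^sub>v (X *\<^sub>v v)))" .
  have "cos_op nu nd nr *\<^sub>v v = (1 / 2) \<cdot>\<^sub>v (?C *\<^sub>v v + mat_adjoint ?C *\<^sub>v v)"
    unfolding cos_op_def sv[OF add_carrier_mat[OF Cadjc] v] add_mult_distrib_mat_vec[OF Cc Cadjc v] by (rule refl)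
  also have "\<dots> = complex_of_real (1 / (4 * sqrt 3)) \<cdot>\<^sub>v
    (complex_of_real (1 / sqrt d) \<cdot>\<^sub>v (X *\<^sub>v v) + RV *\<^sub>v (X *\<^sub>v v))"
    unfolding 1 2 
  proof -
    have "(1 / 2) \<cdot>\<^sub>v (complex_of_real (2 / sqrt 3) \<cdot>\<^sub>v (complex_of_real (1 / sqrt d) \<cdot>\<^sub>v ((1 / 4) \<cdot>\<^sub>v a)) +
        complex_of_real (2 / sqrt 3) \<cdot>\<^sub>v ((1 / 4) \<cdot>\<^sub>v b))
      = complex_of_real (1 / (4 * sqrt 3)) \<cdot>\<^sub>v (complex_of_real (1 / sqrt d) \<cdot>\<^sub>v a + b)"
      if "a \<in> carrier_vec N" "b \<in> carrier_vec N" for a b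
      by (rule eq_vecI) (use that in \<open>auto simp: field_simps\<close>)
    from this[OF Xv RXv] show "(1 / 2) \<cdot>\<^sub>v (complex_of_real (2 / sqrt 3) \<cdot>\<^sub>v (complex_of_real (1 / sqrt d) \<cdot>\<^sub>v ((1 / 4) \<cdot>\<^sub>v (X *\<^sub>v v))) +
        complex_of_real (2 / sqrt 3) \<cdot>\<^sub>v ((1 / 4) \<cdot>\<^sub>v (RV *\<^sub>v (X *\<^sub>v v))))
      = complex_of_real (1 / (4 * sqrt 3)) \<cdot>\<^sub>v (complex_of_real (1 / sqrt d) \<cdot>\<^sub>v (X *\<^sub>v v) + RV *\<^sub>v (X *\<^sub>v v))" .
  qed
  finally show ?thesis .
qed

lemma inv_sqrt_normal_carrier: "RV \<in> carrier_mat N N"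
  by (rule RV(1))

lemma inv_sqrt_normal_apply:
  assumes "v \<in> carrier_vec N" "op_dot V V *\<^sub>v v = complex_of_real d \<cdot>\<^sub>v v" "d > 0"
  shows "RV *\<^sub>v v = complex_of_real (1 / sqrt d) \<cdot>\<^sub>v v"
  by (rule psd_root_eigenvector[OF RV(1,2) normal_square_carrier RV(3) assms])

lemma cos_op_carrier: "cos_op nu nd nr \<in> carrier_mat N N"
proof -
  have "C_op nu nd nr = inv_sqrt_op (op_dot (S_op nu nd nr) (S_op nu nd nr)) * ((1 / 4) \<cdot>\<^sub>m X) * RV"
    unfolding C_op_def Let_def op_dot_spin_normal by (rule refl)
  then have "C_op nu nd nr \<in> carrier_mat N N"
    using inv_sqrt_spin(2)[OF zero_carrier_vec] spin_diff_carrier RV(1) by (auto intro!: mult_carrier_mat)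
  then show ?thesis unfolding cos_op_def by auto
qed

lemma normal_square_nonneg_eigenvalue_pos:
  assumes "v \<in> carrier_vec N" "v \<noteq> 0\<^sub>v N" "op_dot V V *\<^sub>v v = complex_of_real d \<cdot>\<^sub>v v"
  shows "d > 0"
proof -
  have "d \<ge> 0" by (rule psd_eigenvalue_nonneg[OF normal_square_carrier normal_psd assms])
  moreover have "d \<noteq> 0"
  proof
    assume "d = 0"
    then have "op_dot V V *\<^sub>v v = 0\<^sub>v N" using assms by (auto intro!: eq_vecI)
    with normal_injective[OF n assms(1)] assms(2) show False by blast
  qed
  ultimately show ?thesis by simp
qed

end

text \<open>Since K^2 = c^2 and s is a sign, (1 + s K / c) / 2 is the projection onto the eigenspace
  of K for s c.\<close>

lemma dirac_component:
  fixes s :: complex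
  assumes v: "v \<in> W" and s: "s * s = 1"
  defines "p \<equiv> (1 / 2) \<cdot>\<^sub>v (v + (s / of_nat (nr + 1)) \<cdot>\<^sub>v (G *\<^sub>v v))"
  shows "p \<in> W" "G *\<^sub>v p = (s * of_nat (nr + 1)) \<cdot>\<^sub>v p"
proof -
  let ?c = "of_nat (nr + 1) :: complex"
  have c: "?c \<noteq> 0" by (simp only: of_nat_eq_0_iff)
  note vN = intertwiners_carrier[OF v] and GvW = dirac_intertwiner[OF v]
  note GvN = intertwiners_carrier[OF GvW]
  show "p \<in> W" unfolding p_def by (intro intertwiners_smult intertwiners_add v GvW)
  have sq: "G *\<^sub>v (G *\<^sub>v v) = (?c * ?c) \<cdot>\<^sub>v v"
  proof -
    have "of_int ((int nr + 1) * (int nr + 1)) = ?c * ?c" by (simp add: add.commute)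
    then show ?thesis using dirac_square[OF v] by (simp only:)
  qed
  have "G *\<^sub>v p = (1 / 2) \<cdot>\<^sub>v (G *\<^sub>v v + (s / ?c) \<cdot>\<^sub>v (G *\<^sub>v (G *\<^sub>v v)))"
    unfolding p_def using dirac_carrier vN GvN
    by (simp add: mult_mat_vec[of _ N N] mult_add_distrib_mat_vec[of _ N N] del: of_nat_add of_nat_Suc)
  also have "\<dots> = (s * ?c) \<cdot>\<^sub>v p"
  proof -
    have "(1 / 2) \<cdot>\<^sub>v (k + (s / ?c) \<cdot>\<^sub>v ((?c * ?c) \<cdot>\<^sub>v v)) = (s * ?c) \<cdot>\<^sub>v ((1 / 2) \<cdot>\<^sub>v (v + (s / ?c) \<cdot>\<^sub>v k))"
      if k: "k \<in> carrier_vec N" for k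
    proof (rule eq_vecI)
      fix i assume "i < dim_vec ((s * ?c) \<cdot>\<^sub>v ((1 / 2) \<cdot>\<^sub>v (v + (s / ?c) \<cdot>\<^sub>v k)))"
      then have i: "i < N" using k vN by simp
      have "(s * ?c) * (1 / 2 * (v $ i + s / ?c * k $ i)) = 1 / 2 * (s * ?c * v $ i + (s * s) * k $ i)"
        using c by (simp add: field_simps del: of_nat_add of_nat_Suc)
      also have "\<dots> = 1 / 2 * (k $ i + s / ?c * (?c * ?c * v $ i))"
        unfolding s using c by (simp add: field_simps del: of_nat_add of_nat_Suc)
      finally show "((1 / 2) \<cdot>\<^sub>v (k + (s / ?c) \<cdot>\<^sub>v ((?c * ?c) \<cdot>\<^sub>v v))) $ i = ((s * ?c) \<cdot>\<^sub>v ((1 / 2) \<cdot>\<^sub>v (v + (s / ?c) \<cdot>\<^sub>v k))) $ i"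
        using i k vN by simp
    qed (use k vN in simp)
    from this[OF GvN] show ?thesis unfolding sq p_def .
  qed
  finally show "G *\<^sub>v p = (s * ?c) \<cdot>\<^sub>v p" .
qed

text \<open>Without such an eigenvector the projection in \<open>dirac_component\<close> would
  vanish on all intertwiners. Then K would be the scalar -s c there, and the dimension would be at
  most 1.\<close>

lemma dirac_eigenvector:
  fixes s :: complex
  assumes dim: "intertwiner_dim nu nd nr = 2" and s: "s * s = 1"
  obtains u where "u \<in> W" "u \<noteq> 0\<^sub>v N" "G *\<^sub>v u = (s * of_nat (nr + 1)) \<cdot>\<^sub>v u"
proof -
  let ?c = "of_nat (nr + 1) :: complex"
  have c: "?c \<noteq> 0" by (simp only: of_nat_eq_0_iff)
  have "\<exists>u\<in>W. u \<noteq> 0\<^sub>v N \<and> G *\<^sub>v u = (s * ?c) \<cdot>\<^sub>v u"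
  proof (rule ccontr)
    assume "\<not> ?thesis"
    then have none: "u = 0\<^sub>v N" if "u \<in> W" "G *\<^sub>v u = (s * ?c) \<cdot>\<^sub>v u" for u
      using that by blast
    have "spin_orbit nu nd nr *\<^sub>v v = (- 1 - (- s * ?c)) \<cdot>\<^sub>v v" if v: "v \<in> W" for v
    proof -
      note vN = intertwiners_carrier[OF v] and GvN = intertwiners_carrier[OF dirac_intertwiner[OF v]]
      have zero: "(1 / 2) \<cdot>\<^sub>v (v + (s / ?c) \<cdot>\<^sub>v (G *\<^sub>v v)) = 0\<^sub>v N"
        by (rule none[OF dirac_component[OF v s]])
      have "k = (- s * ?c) \<cdot>\<^sub>v v" if k: "k \<in> carrier_vec N" and z: "(1 / 2) \<cdot>\<^sub>v (v + (s / ?c) \<cdot>\<^sub>v k) = 0\<^sub>v N" for k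
      proof (rule eq_vecI)
        fix i assume "i < dim_vec ((- s * ?c) \<cdot>\<^sub>v v)"
        then have i: "i < N" using vN by simp
        have "((1 / 2) \<cdot>\<^sub>v (v + (s / ?c) \<cdot>\<^sub>v k)) $ i = 0" unfolding z using i by simp
        then have "v $ i + s / ?c * k $ i = 0" using i k vN by simp
        then have "s * ?c * (v $ i + s / ?c * k $ i) = 0" by (simp only: mult_zero_right)
        moreover have "s * ?c * (s / ?c * k $ i) = (s * s) * k $ i" using c by simp
        ultimately have "s * ?c * v $ i + (s * s) * k $ i = 0" by (simp only: distrib_left)
        then have "k $ i = - s * ?c * v $ i" unfolding s by (simp add: eq_neg_iff_add_eq_0 add.commute)
        then show "k $ i = ((- s * ?c) \<cdot>\<^sub>v v) $ i" using i vN by simp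
      qed (use k vN in simp)
      from this[OF GvN zero] show ?thesis
        using dirac_eigenvector_iff[OF v] by blast
    qed
    then have "intertwiner_dim nu nd nr \<le> 1" by (rule intertwiner_dim_le_1)
    with dim show False by simp
  qed
  with that show thesis by blast
qed

lemma normal_square_apply:
  assumes v: "v \<in> W" and Gv: "G *\<^sub>v v = complex_of_real g \<cdot>\<^sub>v v"
  shows "op_dot V V *\<^sub>v v = complex_of_real ((2 * (real nu + 1)\<^sup>2 + 2 * (real nd + 1)\<^sup>2 - (real nr + 1)\<^sup>2 - 4 + 2 * g) / 4) \<cdot>\<^sub>v v"
proof -
  note vN = intertwiners_carrier[OF v]
  note D = diff_square_carrier
  note sv = smult_mat_mult_vec[of _ N N, OF _ vN]
  show ?thesis
    unfolding op_dot_normal sv[OF D] diff_square_apply[OF v] Gv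
    using vN by (intro eq_vecI) (auto simp: power2_eq_square field_simps)
qed

end

section \<open>The matrix of \<open>spin_diff\<close> in an eigenbasis of
  \<open>dirac\<close>\<close>

lemma smult_vec_cancel:
  fixes u :: "complex Matrix.vec"
  assumes "u \<in> carrier_vec n" "u \<noteq> 0\<^sub>v n" "x \<cdot>\<^sub>v u = y \<cdot>\<^sub>v u"
  shows "x = y"
proof -
  obtain i where i: "i < n" "u $ i \<noteq> 0"
    using assms(1,2) by (metis eq_vecI carrier_vecD index_zero_vec)
  have "(x \<cdot>\<^sub>v u) $ i = (y \<cdot>\<^sub>v u) $ i" using assms(3) by simp
  then show ?thesis using i assms(1) by simp
qed

text \<open>In the eigenbasis \<open>u, w\<close> of \<^const>\<open>dirac\<close>, the anticommutation relation fixes the diagonal of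
  \<^const>\<open>spin_diff\<close> as \<open>- t, t\<close>, and its square fixes the product of the off-diagonal entries.\<close>
lemma spin_diff_matrix:
  fixes nu nd nr :: nat
  defines "N \<equiv> state_dim nu nd nr" and "c \<equiv> real nr + 1"
    and "t \<equiv> complex_of_real (((real nu + 1)\<^sup>2 - (real nd + 1)\<^sup>2) / (real nr + 1))"
  assumes u: "u \<in> intertwiners nu nd nr" "u \<noteq> 0\<^sub>v N" "dirac nu nd nr *\<^sub>v u = complex_of_real (- c) \<cdot>\<^sub>v u"
    and w: "w \<in> intertwiners nu nd nr" "w \<noteq> 0\<^sub>v N" "dirac nu nd nr *\<^sub>v w = complex_of_real c \<cdot>\<^sub>v w"
  obtains \<beta> \<gamma> where "spin_diff nu nd nr *\<^sub>v u = (- t) \<cdot>\<^sub>v u + \<beta> \<cdot>\<^sub>v w"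
    "spin_diff nu nd nr *\<^sub>v w = \<gamma> \<cdot>\<^sub>v u + t \<cdot>\<^sub>v w"
    "\<beta> * \<gamma> = complex_of_real (2 * (real nu + 1)\<^sup>2 + 2 * (real nd + 1)\<^sup>2 - (real nr + 1)\<^sup>2) - t * t"
proof -
  let ?W = "intertwiners nu nd nr" and ?X = "spin_diff nu nd nr" and ?G = "dirac nu nd nr"
  have cpos: "c > 0" by (simp add: c_def)
  have X: "?X \<in> carrier_mat N N" and G: "?G \<in> carrier_mat N N"
    unfolding N_def by (rule spin_diff_carrier dirac_carrier)+
  have WN: "v \<in> carrier_vec N" if "v \<in> ?W" for v using that by (simp add: intertwiners_def N_def)
  note uN = WN[OF u(1)] and wN = WN[OF w(1)]
  have k2: "of_int (2 * ((int nu + 1) * (int nu + 1) - (int nd + 1) * (int nd + 1))) = 2 * t * complex_of_real c"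
    using cpos by (simp add: t_def c_def[symmetric] power2_eq_square)
  \<comment> \<open>The anticommutator gives K X v = 2 t c v - s c X v. Subtracting s t v from X v
    leaves a vector in the opposite eigenspace, so s t is the diagonal entry of X at v.\<close>
  have step: "?X *\<^sub>v v - (s * t) \<cdot>\<^sub>v v \<in> ?W \<and> ?G *\<^sub>v (?X *\<^sub>v v - (s * t) \<cdot>\<^sub>v v) = (- s * complex_of_real c) \<cdot>\<^sub>v (?X *\<^sub>v v - (s * t) \<cdot>\<^sub>v v)"
    if v: "v \<in> ?W" and Gv: "?G *\<^sub>v v = (s * complex_of_real c) \<cdot>\<^sub>v v" and s: "s * s = 1" for v s
  proof
    note vN = WN[OF v] and XvW = spin_diff_intertwiner[OF v]
    note XvN = WN[OF XvW]
    have GXvN: "?G *\<^sub>v (?X *\<^sub>v v) \<in> carrier_vec N" by (rule WN[OF dirac_intertwiner[OF XvW]])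
    have eq: "?X *\<^sub>v v - (s * t) \<cdot>\<^sub>v v = ?X *\<^sub>v v + (- (s * t)) \<cdot>\<^sub>v v"
      using XvN vN by (intro eq_vecI) (auto simp del: index_mult_mat_vec)
    show "?X *\<^sub>v v - (s * t) \<cdot>\<^sub>v v \<in> ?W"
      unfolding eq by (intro intertwiners_add intertwiners_smult XvW v)
    have anti: "?G *\<^sub>v (?X *\<^sub>v v) + (s * complex_of_real c) \<cdot>\<^sub>v (?X *\<^sub>v v) = (2 * t * complex_of_real c) \<cdot>\<^sub>v v"
      using dirac_spin_diff[OF v] unfolding Gv mult_mat_vec[OF X vN] k2 .
    have GX: "?G *\<^sub>v (?X *\<^sub>v v) = (2 * t * complex_of_real c) \<cdot>\<^sub>v v - (s * complex_of_real c) \<cdot>\<^sub>v (?X *\<^sub>v v)"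
    proof -
      have "a = b - d" if "a \<in> carrier_vec N" "d \<in> carrier_vec N" "a + d = b" for a b d :: "complex Matrix.vec"
        unfolding that(3)[symmetric] using that by (intro eq_vecI) auto
      then show ?thesis using GXvN XvN anti by (metis smult_carrier_vec)
    qed
    have "?G *\<^sub>v (?X *\<^sub>v v - (s * t) \<cdot>\<^sub>v v) = ?G *\<^sub>v (?X *\<^sub>v v) - (s * t) \<cdot>\<^sub>v (?G *\<^sub>v v)"
      using G XvN vN by (simp add: mult_minus_distrib_mat_vec[of _ N N] mult_mat_vec[of _ N N])
    also have "\<dots> = (- s * complex_of_real c) \<cdot>\<^sub>v (?X *\<^sub>v v - (s * t) \<cdot>\<^sub>v v)"
      unfolding GX Gv
    proof -
      have "((2 * t * complex_of_real c) \<cdot>\<^sub>v v - (s * complex_of_real c) \<cdot>\<^sub>v a) - (s * t) \<cdot>\<^sub>v ((s * complex_of_real c) \<cdot>\<^sub>v v) =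
          (- s * complex_of_real c) \<cdot>\<^sub>v (a - (s * t) \<cdot>\<^sub>v v)" if a: "a \<in> carrier_vec N" for a
      proof (rule eq_vecI)
        fix i assume "i < dim_vec ((- s * complex_of_real c) \<cdot>\<^sub>v (a - (s * t) \<cdot>\<^sub>v v))"
        then have i: "i < N" using a vN by simp
        have "2 * t * complex_of_real c * v $ i - s * complex_of_real c * a $ i - s * t * (s * complex_of_real c * v $ i)
          = 2 * t * complex_of_real c * v $ i - s * complex_of_real c * a $ i - (s * s) * t * complex_of_real c * v $ i"
          by (simp add: algebra_simps)
        also have "\<dots> = - s * complex_of_real c * a $ i + (s * s) * t * complex_of_real c * v $ i"
          unfolding s by (simp add: algebra_simps)
        also have "\<dots> = - s * complex_of_real c * (a $ i - s * t * v $ i)"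
          by (simp add: algebra_simps)
        finally show "((2 * t * complex_of_real c) \<cdot>\<^sub>v v - (s * complex_of_real c) \<cdot>\<^sub>v a - (s * t) \<cdot>\<^sub>v ((s * complex_of_real c) \<cdot>\<^sub>v v)) $ i =
          ((- s * complex_of_real c) \<cdot>\<^sub>v (a - (s * t) \<cdot>\<^sub>v v)) $ i"
          using i a vN by simp
      qed (use a vN in simp)
      from this[OF XvN] show "((2 * t * complex_of_real c) \<cdot>\<^sub>v v - (s * complex_of_real c) \<cdot>\<^sub>v (?X *\<^sub>v v)) - (s * t) \<cdot>\<^sub>v ((s * complex_of_real c) \<cdot>\<^sub>v v) =
          (- s * complex_of_real c) \<cdot>\<^sub>v (?X *\<^sub>v v - (s * t) \<cdot>\<^sub>v v)" .
    qed
    finally show "?G *\<^sub>v (?X *\<^sub>v v - (s * t) \<cdot>\<^sub>v v) = (- s * complex_of_real c) \<cdot>\<^sub>v (?X *\<^sub>v v - (s * t) \<cdot>\<^sub>v v)" .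
  qed
  have parallel: "\<exists>z. v = z \<cdot>\<^sub>v v'" if "v \<in> ?W" "v' \<in> ?W" "v' \<noteq> 0\<^sub>v N" "?G *\<^sub>v v = e \<cdot>\<^sub>v v" "?G *\<^sub>v v' = e \<cdot>\<^sub>v v'" for v v' e
    using spin_orbit_eigenvectors_proportional[OF that(2) _ _ that(1)] that dirac_eigenvector_iff unfolding N_def by metis
  have "?X *\<^sub>v u - (- 1 * t) \<cdot>\<^sub>v u \<in> ?W \<and> ?G *\<^sub>v (?X *\<^sub>v u - (- 1 * t) \<cdot>\<^sub>v u) = (- (- 1) * complex_of_real c) \<cdot>\<^sub>v (?X *\<^sub>v u - (- 1 * t) \<cdot>\<^sub>v u)"
    by (rule step[OF u(1)]) (use u(3) in simp_all)
  then obtain \<beta> where \<beta>: "?X *\<^sub>v u - (- t) \<cdot>\<^sub>v u = \<beta> \<cdot>\<^sub>v w"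
    using parallel[OF _ w(1,2) _ w(3)] by auto
  have "?X *\<^sub>v w - (1 * t) \<cdot>\<^sub>v w \<in> ?W \<and> ?G *\<^sub>v (?X *\<^sub>v w - (1 * t) \<cdot>\<^sub>v w) = (- 1 * complex_of_real c) \<cdot>\<^sub>v (?X *\<^sub>v w - (1 * t) \<cdot>\<^sub>v w)"
    by (rule step[OF w(1)]) (use w(3) in simp_all)
  then obtain \<gamma> where \<gamma>: "?X *\<^sub>v w - t \<cdot>\<^sub>v w = \<gamma> \<cdot>\<^sub>v u"
    using parallel[OF _ u(1,2) _ u(3)] by auto
  have move: "a = b + d" "a = d + b" if "a - b = d" "a \<in> carrier_vec N" "b \<in> carrier_vec N" for a b d :: "complex Matrix.vec"
    unfolding that(1)[symmetric] using that by (auto intro!: eq_vecI)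
  have XuN: "?X *\<^sub>v u \<in> carrier_vec N" "?X *\<^sub>v w \<in> carrier_vec N" using WN spin_diff_intertwiner u(1) w(1) by blast+
  have Xu: "?X *\<^sub>v u = (- t) \<cdot>\<^sub>v u + \<beta> \<cdot>\<^sub>v w" by (rule move(1)[OF \<beta> XuN(1)]) (use uN in simp)
  have Xw: "?X *\<^sub>v w = \<gamma> \<cdot>\<^sub>v u + t \<cdot>\<^sub>v w" by (rule move(2)[OF \<gamma> XuN(2)]) (use wN in simp)
  let ?k = "complex_of_real (2 * (real nu + 1)\<^sup>2 + 2 * (real nd + 1)\<^sup>2 - (real nr + 1)\<^sup>2)"
  have "?X *\<^sub>v (?X *\<^sub>v u) = ?X *\<^sub>v ((- t) \<cdot>\<^sub>v u + \<beta> \<cdot>\<^sub>v w)"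
    by (simp only: Xu)
  also have "\<dots> = (- t) \<cdot>\<^sub>v (?X *\<^sub>v u) + \<beta> \<cdot>\<^sub>v (?X *\<^sub>v w)"
    using X uN wN by (simp add: mult_add_distrib_mat_vec[of _ N N] mult_mat_vec[of _ N N])
  \<comment> \<open>The diagonal entries are opposite, so the terms in \<open>w\<close>
    cancel.\<close>
  also have "\<dots> = (t * t + \<beta> * \<gamma>) \<cdot>\<^sub>v u"
    unfolding Xu Xw using uN wN by (intro eq_vecI) (auto simp: algebra_simps)
  finally have "?X *\<^sub>v (?X *\<^sub>v u) = (t * t + \<beta> * \<gamma>) \<cdot>\<^sub>v u" .
  moreover have "?X *\<^sub>v (?X *\<^sub>v u) = ?k \<cdot>\<^sub>v u"
  proof -
    have "of_int (2 * (int nu + 1) * (int nu + 1) + 2 * (int nd + 1) * (int nd + 1) - (int nr + 1) * (int nr + 1)) = ?k"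
      by (simp add: power2_eq_square algebra_simps)
    then show ?thesis using spin_diff_square[OF u(1)] by (simp only:)
  qed
  ultimately have "t * t + \<beta> * \<gamma> = ?k"
    by (intro smult_vec_cancel[OF uN u(2)]) simp
  then have "\<beta> * \<gamma> = ?k - t * t" by (simp add: algebra_simps)
  with Xu Xw show thesis by (rule that)
qed

text \<open>An intertwiner is the sum of its two projections from \<open>dirac_component\<close>,
  each a multiple of the corresponding eigenvector. Independence follows by applying K, which
  changes the relative sign of the two terms.\<close>

lemma dirac_eigenbasis:
  fixes nu nd nr :: nat
  defines "N \<equiv> state_dim nu nd nr" and "c \<equiv> real nr + 1"
  assumes u: "u \<in> intertwiners nu nd nr" "u \<noteq> 0\<^sub>v N" "dirac nu nd nr *\<^sub>v u = complex_of_real (- c) \<cdot>\<^sub>v u"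
    and w: "w \<in> intertwiners nu nd nr" "w \<noteq> 0\<^sub>v N" "dirac nu nd nr *\<^sub>v w = complex_of_real c \<cdot>\<^sub>v w"
  shows "intertwiners nu nd nr = {x \<cdot>\<^sub>v u + y \<cdot>\<^sub>v w | x y. True}"
    and "x \<cdot>\<^sub>v u + y \<cdot>\<^sub>v w = 0\<^sub>v N \<Longrightarrow> x = 0 \<and> y = 0"
proof -
  let ?W = "intertwiners nu nd nr" and ?G = "dirac nu nd nr"
  have cpos: "c > 0" by (simp add: c_def)
  have WN: "v \<in> carrier_vec N" if "v \<in> ?W" for v using that by (simp add: intertwiners_def N_def)
  note uN = WN[OF u(1)] and wN = WN[OF w(1)]
  have G: "?G \<in> carrier_mat N N" unfolding N_def by (rule dirac_carrier)
  have parallel: "\<exists>z. v = z \<cdot>\<^sub>v v'" if "v \<in> ?W" "v' \<in> ?W" "v' \<noteq> 0\<^sub>v N" "?G *\<^sub>v v = e \<cdot>\<^sub>v v" "?G *\<^sub>v v' = e \<cdot>\<^sub>v v'" for v v' e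
    using spin_orbit_eigenvectors_proportional[OF that(2) _ _ that(1)] that dirac_eigenvector_iff unfolding N_def by metis
  have e: "- 1 * of_nat (nr + 1) = complex_of_real (- c)" "1 * of_nat (nr + 1) = complex_of_real c"
    by (simp_all add: c_def)
  show "?W = {x \<cdot>\<^sub>v u + y \<cdot>\<^sub>v w | x y. True}"
  proof (intro equalityI subsetI)
    fix v assume v: "v \<in> ?W"
    note vN = WN[OF v] and GvN = WN[OF dirac_intertwiner[OF v]]
    let ?p = "\<lambda>s. (1 / 2) \<cdot>\<^sub>v (v + (s / of_nat (nr + 1)) \<cdot>\<^sub>v (?G *\<^sub>v v))"
    have "\<exists>x. ?p (- 1) = x \<cdot>\<^sub>v u" "\<exists>y. ?p 1 = y \<cdot>\<^sub>v w"
      using parallel[OF dirac_component(1)[OF v, of "- 1"] u(1,2) _ u(3)] parallel[OF dirac_component(1)[OF v, of 1] w(1,2) _ w(3)]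
        dirac_component(2)[OF v, of "- 1"] dirac_component(2)[OF v, of 1]
      unfolding e by simp_all
    then obtain x y where xy: "?p (- 1) = x \<cdot>\<^sub>v u" "?p 1 = y \<cdot>\<^sub>v w" by blast
    have "v = ?p (- 1) + ?p 1"
    proof -
      have "v = (1 / 2) \<cdot>\<^sub>v (v + (- 1 / z) \<cdot>\<^sub>v k) + (1 / 2) \<cdot>\<^sub>v (v + (1 / z) \<cdot>\<^sub>v k)" if "k \<in> carrier_vec N" for k z
        using that vN by (intro eq_vecI) (auto simp: algebra_simps)
      then show ?thesis using GvN by blast
    qed
    then show "v \<in> {x \<cdot>\<^sub>v u + y \<cdot>\<^sub>v w | x y. True}" unfolding xy by blast
  next
    fix v assume "v \<in> {x \<cdot>\<^sub>v u + y \<cdot>\<^sub>v w | x y. True}"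
    then show "v \<in> ?W" using u(1) w(1) by (auto intro: intertwiners_add intertwiners_smult)
  qed
  assume zero: "x \<cdot>\<^sub>v u + y \<cdot>\<^sub>v w = 0\<^sub>v N"
  let ?c = "complex_of_real c"
  have "x \<cdot>\<^sub>v (?G *\<^sub>v u) + y \<cdot>\<^sub>v (?G *\<^sub>v w) = ?G *\<^sub>v (x \<cdot>\<^sub>v u + y \<cdot>\<^sub>v w)"
    using G uN wN by (simp add: mult_add_distrib_mat_vec[of _ N N] mult_mat_vec[of _ N N])
  then have G0: "x \<cdot>\<^sub>v (complex_of_real (- c) \<cdot>\<^sub>v u) + y \<cdot>\<^sub>v (?c \<cdot>\<^sub>v w) = 0\<^sub>v N"
  proof -
    have "?G *\<^sub>v 0\<^sub>v N = 0\<^sub>v N" using G by (intro eq_vecI) auto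
    then show ?thesis
      using \<open>x \<cdot>\<^sub>v (?G *\<^sub>v u) + y \<cdot>\<^sub>v (?G *\<^sub>v w) = ?G *\<^sub>v (x \<cdot>\<^sub>v u + y \<cdot>\<^sub>v w)\<close>
      unfolding zero u(3) w(3) by simp
  qed
  have comp: "x * u $ i = 0 \<and> y * w $ i = 0" if i: "i < N" for i
  proof -
    have "(x \<cdot>\<^sub>v u + y \<cdot>\<^sub>v w) $ i = 0" "(x \<cdot>\<^sub>v (complex_of_real (- c) \<cdot>\<^sub>v u) + y \<cdot>\<^sub>v (?c \<cdot>\<^sub>v w)) $ i = 0"
      unfolding zero G0 using i by simp_all
    then have 1: "x * u $ i + y * w $ i = 0" and 2: "?c * (y * w $ i - x * u $ i) = 0"
      using i uN wN by (simp_all add: algebra_simps)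
    from 2 cpos have "y * w $ i - x * u $ i = 0" by simp
    with 1 have "x * u $ i + x * u $ i = 0" by simp
    then have "x * u $ i = 0" by simp
    with 1 show ?thesis by simp
  qed
  have "x \<cdot>\<^sub>v u = 0 \<cdot>\<^sub>v u" "y \<cdot>\<^sub>v w = 0 \<cdot>\<^sub>v w"
    using comp uN wN by (auto intro!: eq_vecI)
  then show "x = 0 \<and> y = 0"
    using smult_vec_cancel[OF uN u(2)] smult_vec_cancel[OF wN w(2)] by blast
qed

theorem proposition3p1:
  fixes ju jd jr Ju Jd Jr A C :: real and nu nd nr :: nat and B :: "real \<Rightarrow> real"
  assumes "ju = real nu / 2" and "jd = real nd / 2" and "jr = real nr / 2"
    and "intertwiner_dim nu nd nr = 2"
    and "Ju = ju + 1 / 2" and "Jd = jd + 1 / 2" and "Jr = jr + 1 / 2"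
    and "A = 1 / 2 * (Ju / Jr)\<^sup>2 + 1 / 2 * (Jd / Jr)\<^sup>2 - 1 / 4"
    and "C = 1 / 2 * (Ju / Jr)\<^sup>2 - 1 / 2 * (Jd / Jr)\<^sup>2"
    and "\<And>r. B r = 1 / 2 * (Ju / Jr)\<^sup>2 + 1 / 2 * (Jd / Jr)\<^sup>2 - 1 / 4
                - r / 4 * (1 / Jr) - 1 / 4 * (1 / Jr\<^sup>2)"
  shows "eigenvalues_on (intertwiners nu nd nr) (cos_op nu nd nr) =
    {complex_of_real (1 / sqrt 3 * (1 / sqrt (B 1) * ((sqrt A - C) / 2)
                                  + 1 / sqrt (B (- 1)) * ((sqrt A + C) / 2))),
     complex_of_real (- (1 / sqrt 3 * (1 / sqrt (B 1) * ((sqrt A + C) / 2)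
                                     + 1 / sqrt (B (- 1)) * ((sqrt A - C) / 2))))}"
proof -
  let ?N = "state_dim nu nd nr" and ?W = "intertwiners nu nd nr" and ?G = "dirac nu nd nr" and ?X = "spin_diff nu nd nr"
  let ?V = "\<lambda>i. J_up nu nd nr i - J_down nu nd nr i"
  define a b c where "a = real nu + 1" and "b = real nd + 1" and "c = real nr + 1"
  have pos: "a \<ge> 1" "b \<ge> 1" "c \<ge> 1" by (simp_all add: a_def b_def c_def)
  have J: "Ju = a / 2" "Jd = b / 2" "Jr = c / 2"
    using assms(1-3,5-7) by (simp_all add: a_def b_def c_def add_divide_distrib)
  have A: "A = (2 * a\<^sup>2 + 2 * b\<^sup>2 - c\<^sup>2) / (4 * c\<^sup>2)" and C: "C = (a\<^sup>2 - b\<^sup>2) / (2 * c\<^sup>2)"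
    and B: "B r = (2 * a\<^sup>2 + 2 * b\<^sup>2 - c\<^sup>2 - 4 - 2 * r * c) / 4 / c\<^sup>2" for r
    unfolding assms(8-10) J using pos by (simp_all add: power_divide power2_eq_square field_simps)
  have WN: "v \<in> carrier_vec ?N" if "v \<in> ?W" for v using that by (simp add: intertwiners_def)
  have e: "- 1 * of_nat (nr + 1) = complex_of_real (- c)" "1 * of_nat (nr + 1) = complex_of_real c"
    by (simp_all add: c_def)
  \<comment> \<open>K = -c means 4 S . J_r = c - 1, so the tangential and fermion spins couple to
    j_r + 1/2. Thus \<open>u\<close> belongs to r = +1 and \<open>w\<close>, with K = c, to r =
    -1.\<close>
  obtain u where u: "u \<in> ?W" "u \<noteq> 0\<^sub>v ?N" "?G *\<^sub>v u = complex_of_real (- c) \<cdot>\<^sub>v u"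
    using dirac_eigenvector[OF assms(4), of "- 1"] unfolding e by auto
  obtain w where w: "w \<in> ?W" "w \<noteq> 0\<^sub>v ?N" "?G *\<^sub>v w = complex_of_real c \<cdot>\<^sub>v w"
    using dirac_eigenvector[OF assms(4), of 1] unfolding e by auto
  note uN = WN[OF u(1)] and wN = WN[OF w(1)]
  \<comment> \<open>The eigenvalues of V^2, equal to c^2 times \<open>B r\<close>.\<close>
  define d where "d = (\<lambda>r. (2 * a\<^sup>2 + 2 * b\<^sup>2 - c\<^sup>2 - 4 - 2 * r * c) / 4)"
  have Vu: "op_dot ?V ?V *\<^sub>v u = complex_of_real (d 1) \<cdot>\<^sub>v u"
    using normal_square_apply[OF u(1,3)] by (simp add: d_def a_def b_def c_def)
  have Vw: "op_dot ?V ?V *\<^sub>v w = complex_of_real (d (- 1)) \<cdot>\<^sub>v w"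
    using normal_square_apply[OF w(1,3)] by (simp add: d_def a_def b_def c_def)
  \<comment> \<open>If both spins were 0, the positive semidefinite operator V^2 would have the
    negative eigenvalue \<open>d 1\<close> at \<open>u\<close>.\<close>
  have n: "nu \<noteq> 0 \<or> nd \<noteq> 0"
  proof (rule ccontr)
    assume "\<not> (nu \<noteq> 0 \<or> nd \<noteq> 0)"
    then have "a = 1" "b = 1" by (simp_all add: a_def b_def)
    then have "d 1 = - (c * c + 2 * c) / 4" by (simp add: d_def power2_eq_square)
    also have "\<dots> < 0"
    proof -
      have "0 < c * c + 2 * c" using pos by (intro add_pos_pos mult_pos_pos) auto
      then show ?thesis by (intro divide_neg_pos) auto
    qed
    finally have neg: "d 1 < 0" .
    have "op_dot ?V ?V \<in> carrier_mat ?N ?N"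
      unfolding op_dot_def using normal_op_carrier[of nu nd nr] by (auto intro!: add_carrier_mat mult_carrier_mat)
    from psd_eigenvalue_nonneg[OF this normal_psd uN u(2) Vu] neg show False by simp
  qed
  have d: "d 1 > 0" "d (- 1) > 0"
    using normal_square_nonneg_eigenvalue_pos[OF n uN u(2) Vu] normal_square_nonneg_eigenvalue_pos[OF n wN w(2) Vw] by blast+
  define T where "T = (a\<^sup>2 - b\<^sup>2) / c"
  obtain \<beta> \<gamma> where Xu: "?X *\<^sub>v u = (- complex_of_real T) \<cdot>\<^sub>v u + \<beta> \<cdot>\<^sub>v w"
    and Xw: "?X *\<^sub>v w = \<gamma> \<cdot>\<^sub>v u + complex_of_real T \<cdot>\<^sub>v w"
    and \<beta>\<gamma>: "\<beta> * \<gamma> = complex_of_real (2 * a\<^sup>2 + 2 * b\<^sup>2 - c\<^sup>2) - complex_of_real T * complex_of_real T"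
    using spin_diff_matrix[OF u[unfolded c_def] w[unfolded c_def]] unfolding T_def a_def b_def c_def by blast
  define r s k where "r = complex_of_real (1 / sqrt (d 1))" and "s = complex_of_real (1 / sqrt (d (- 1)))"
    and "k = complex_of_real (1 / (4 * sqrt 3))"
  let ?R = "inv_sqrt_op (op_dot ?V ?V)"
  have Ru: "?R *\<^sub>v u = r \<cdot>\<^sub>v u" and Rw: "?R *\<^sub>v w = s \<cdot>\<^sub>v w"
    unfolding r_def s_def
    using inv_sqrt_normal_apply[OF n uN Vu d(1)] inv_sqrt_normal_apply[OF n wN Vw d(2)] by blast+
  have Rcar: "?R \<in> carrier_mat ?N ?N" by (rule inv_sqrt_normal_carrier[OF n])
  have R: "?R *\<^sub>v (x \<cdot>\<^sub>v u + y \<cdot>\<^sub>v w) = (x * r) \<cdot>\<^sub>v u + (y * s) \<cdot>\<^sub>v w" for x y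
  proof -
    have "?R *\<^sub>v (x \<cdot>\<^sub>v u + y \<cdot>\<^sub>v w) = x \<cdot>\<^sub>v (?R *\<^sub>v u) + y \<cdot>\<^sub>v (?R *\<^sub>v w)"
      using Rcar uN wN by (simp add: mult_add_distrib_mat_vec[of _ ?N ?N] mult_mat_vec[of _ ?N ?N])
    then show ?thesis unfolding Ru Rw by (simp add: smult_smult_assoc)
  qed
  \<comment> \<open>The cosine is \<open>k\<close> times X R + R X: an entry of X is multiplied by
    \<open>k\<close> and by 2 r or 2 s on the diagonal, by r + s off it.\<close>
  have cosu: "cos_op nu nd nr *\<^sub>v u = (- 2 * k * complex_of_real T * r) \<cdot>\<^sub>v u + (k * \<beta> * (r + s)) \<cdot>\<^sub>v w"
    unfolding cos_op_apply[OF n uN Vu d(1), folded r_def k_def] Xu R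
    using uN wN by (intro eq_vecI) (auto simp: algebra_simps)
  have cosw: "cos_op nu nd nr *\<^sub>v w = (k * \<gamma> * (r + s)) \<cdot>\<^sub>v u + (2 * k * complex_of_real T * s) \<cdot>\<^sub>v w"
    unfolding cos_op_apply[OF n wN Vw d(2), folded s_def k_def] Xw R
    using uN wN by (intro eq_vecI) (auto simp: algebra_simps)
  define h p q where "h = 1 / sqrt 3" and "p = 1 / sqrt (B 1)" and "q = 1 / sqrt (B (- 1))"
  have c0: "c \<noteq> 0" using pos by simp
  have Bd: "B x = d x / c\<^sup>2" for x unfolding B d_def by simp
  have rs: "r = complex_of_real (p / c)" "s = complex_of_real (q / c)"
    unfolding r_def s_def p_def q_def Bd using pos d by (simp_all add: real_sqrt_divide)
  have k: "k = complex_of_real (h / 4)" unfolding k_def h_def by simp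
  \<comment> \<open>In the scale of the statement T is 2 c C and the scalar X^2 is 4 c^2 A.
    \<open>A\<close> is nonnegative because it exceeds \<open>B 1\<close>, which is
    positive.\<close>
  have T: "T = 2 * c * C" unfolding T_def C using c0 by (simp add: power2_eq_square field_simps)
  have "A = B 1 + 1 / (2 * c) + 1 / c\<^sup>2"
    unfolding A B using c0 by (simp add: power2_eq_square field_simps)
  moreover have "B 1 > 0" unfolding Bd using d pos by simp
  ultimately have "A \<ge> 0" using pos by (simp add: add_nonneg_nonneg)
  then have sA: "sqrt A * sqrt A = A" by simp
  have K: "2 * a\<^sup>2 + 2 * b\<^sup>2 - c\<^sup>2 = 4 * c * c * (sqrt A * sqrt A)"
    unfolding sA unfolding A using c0 by (simp add: power2_eq_square)
  show ?thesis
    unfolding h_def[symmetric] p_def[symmetric] q_def[symmetric]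
  proof (rule two_dim_eigenvalues[OF cos_op_carrier[OF n] _ uN wN _ _ cosu cosw])
    show "?W \<subseteq> carrier_vec ?N" using WN by blast
    show "?W = {x \<cdot>\<^sub>v u + y \<cdot>\<^sub>v w |x y. True}"
      by (rule dirac_eigenbasis(1)[OF u[unfolded c_def] w[unfolded c_def]])
    show "x = 0 \<and> y = 0" if "x \<cdot>\<^sub>v u + y \<cdot>\<^sub>v w = 0\<^sub>v ?N" for x y
      by (rule dirac_eigenbasis(2)[OF u[unfolded c_def] w[unfolded c_def] that])
    \<comment> \<open>For the trace, both sides equal h C (q - p); the terms with sqrt A
      cancel.\<close>
    have "- 2 * k * complex_of_real T * r + 2 * k * complex_of_real T * s
      = complex_of_real (- 2 * (h / 4) * T * (p / c) + 2 * (h / 4) * T * (q / c))"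
      unfolding rs k by simp
    also have "- 2 * (h / 4) * T * (p / c) + 2 * (h / 4) * T * (q / c) =
      h * (p * ((sqrt A - C) / 2) + q * ((sqrt A + C) / 2)) + - (h * (p * ((sqrt A + C) / 2) + q * ((sqrt A - C) / 2)))"
      unfolding T using c0 by (simp add: field_simps)
    finally show "- 2 * k * complex_of_real T * r + 2 * k * complex_of_real T * s =
      complex_of_real (h * (p * ((sqrt A - C) / 2) + q * ((sqrt A + C) / 2)))
      + complex_of_real (- (h * (p * ((sqrt A + C) / 2) + q * ((sqrt A - C) / 2))))" by simp
    \<comment> \<open>For the determinant, both sides equal -(h^2 / 4) (A (p + q)^2 - C^2 (p -
      q)^2), since (p + q)^2 - 4 p q = (p - q)^2.\<close>
    have "- 2 * k * complex_of_real T * r * (2 * k * complex_of_real T * s) - k * \<beta> * (r + s) * (k * \<gamma> * (r + s))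
      = - 2 * k * complex_of_real T * r * (2 * k * complex_of_real T * s) - k * k * (r + s) * (r + s) * (\<beta> * \<gamma>)"
      by (simp add: algebra_simps)
    also have "\<dots> = complex_of_real (- 2 * (h / 4) * T * (p / c) * (2 * (h / 4) * T * (q / c))
        - (h / 4) * (h / 4) * (p / c + q / c) * (p / c + q / c) * (2 * a\<^sup>2 + 2 * b\<^sup>2 - c\<^sup>2 - T * T))"
      unfolding \<beta>\<gamma> rs k by simp
    also have "- 2 * (h / 4) * T * (p / c) * (2 * (h / 4) * T * (q / c))
        - (h / 4) * (h / 4) * (p / c + q / c) * (p / c + q / c) * (2 * a\<^sup>2 + 2 * b\<^sup>2 - c\<^sup>2 - T * T) =
      h * (p * ((sqrt A - C) / 2) + q * ((sqrt A + C) / 2)) * - (h * (p * ((sqrt A + C) / 2) + q * ((sqrt A - C) / 2)))"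
    proof -
      have 1: "- 2 * (h / 4) * T * (p / c) * (2 * (h / 4) * T * (q / c)) = - (h * h) * C * C * p * q"
        unfolding T using c0 by (simp add: field_simps)
      have 2: "(h / 4) * (h / 4) * (p / c + q / c) * (p / c + q / c) * (2 * a\<^sup>2 + 2 * b\<^sup>2 - c\<^sup>2 - T * T)
        = (h * h) / 4 * (p + q) * (p + q) * (sqrt A * sqrt A - C * C)"
      proof -
        \<comment> \<open>A variable \<open>y\<close> in place of \<open>sqrt A\<close> keeps
          simplification from rewriting products of the root.\<close>
        have "(h / 4) * (h / 4) * (p / c + q / c) * (p / c + q / c) * (4 * c * c * (y * y) - 2 * c * C * (2 * c * C))
          = (h * h) / 4 * (p + q) * (p + q) * (y * y - C * C)" for y
          unfolding add_divide_distrib[symmetric] using c0 by (simp add: field_simps)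
        then show ?thesis unfolding K T .
      qed
      have "- (h * h) * C * C * p * q - (h * h) / 4 * (p + q) * (p + q) * (y * y - C * C) =
        h * (p * ((y - C) / 2) + q * ((y + C) / 2)) * - (h * (p * ((y + C) / 2) + q * ((y - C) / 2)))" for y
        by (simp add: field_simps)
      then show ?thesis unfolding 1 2 .
    qed
    finally show "- 2 * k * complex_of_real T * r * (2 * k * complex_of_real T * s) - k * \<beta> * (r + s) * (k * \<gamma> * (r + s)) =
      complex_of_real (h * (p * ((sqrt A - C) / 2) + q * ((sqrt A + C) / 2)))
      * complex_of_real (- (h * (p * ((sqrt A + C) / 2) + q * ((sqrt A - C) / 2))))" by simp
  qed
qed

end
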